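(* Let $N_1,N_2\in\mathbb N_+$ and $\epsilon_1,\epsilon_2>0$. Then there exists a family of measure-preserving maps $(\Psi^t_{(N_1,N_2)})_{t\in\mathbb R}:\mathcal D\to\mathcal D$, realizing the global-in-time elastic hard-sphere dynamics for almost every initial configuration, such that for all $t,s\in\mathbb R^+$: 1. $\Psi^{t+s}_{(N_1,N_2)}(Z)=\big(\Psi^t_{(N_1,N_2)}\circ\Psi^s_{(N_1,N_2)}\big)(Z)=\big(\Psi^s_{(N_1,N_2)}\circ\Psi^t_{(N_1,N_2)}\big)(Z)$ for a.e. $Z\in\mathcal D$; 2. $E(\Psi^t_{(N_1,N_2)}(Z))=E(Z)$ for a.e. $Z\in\mathcal D$; 3. $\Psi^t_{(N_1,N_2)}(\mathcal T(Z))=\Psi^t_{(N_1,N_2)}(Z)$ for $\mathcal H^{2d(N_1+N_2)-1}$-a.e. $Z\in\partial_{sc,ng}\mathcal D$.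
   Context: Types are $\mathscr T=\{(1,0),(0,1)\}$, ordered $(1,0)<(0,1)$; index $1$ (resp. $2$) abbreviates $(1,0)$ (resp. $(0,1)$). There are $N_\alpha$ particles of type $\alpha$ in $\mathbb R^d$, with mass $M_\alpha>0$ and diameter $\epsilon_\alpha$; $\epsilon_{(\alpha,\beta)}=(\epsilon_\alpha+\epsilon_\beta)/2$. A configuration is $Z=(X,V)\in\mathbb R^{2d(N_1+N_2)}$ with positions $x_i^\alpha$, velocities $v_i^\alpha$, $1\le i\le N_\alpha$. $\mathcal I^{(\alpha,\beta)}=\{1,\dots,N_\alpha\}\times\{1,\dots,N_\beta\}$ if $\alpha\ne\beta$, and $\{(i,j):1\le i<j\le N_\alpha\}$ if $\alpha=\beta$. Phase space: $\mathcal D=\{Z:|x_i^\alpha-x_j^\beta|\ge\epsilon_{(\alpha,\beta)}\ \forall\alpha\le\beta,(i,j)\in\mathcal I^{(\alpha,\beta)}\}$. Energy: $E(Z)=\sum_\alpha\sum_{i=1}^{N_\alpha}M_\alpha|v_i^\alpha|^2$. $\Sigma^{(\alpha,\beta)}_{(i,j)}=\{Z\in\mathcal D:|x_i^\alpha-x_j^\beta|=\epsilon_{(\alpha,\beta)}\}$; $\Sigma^{(\alpha,\beta)}_{(i,j),sc}$ is the set of $Z\in\partial\mathcal D$ lying in $\Sigma^{(\alpha,\beta)}_{(i,j)}$ and in no other such set ($\alpha\le\beta$, $(i,j)\in\mathcal I^{(\alpha,\beta)}$). Such $Z$ is pre-collisional, post-collisional or grazing if $(x_i^\alpha-x_j^\beta)\cdot(v_i^\alpha-v_j^\beta)$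 is $<0$, $>0$ or $=0$, respectively. $\partial_{sc,ng}\mathcal D$ is the set of non-grazing $Z$ in the union of all $\Sigma^{(\alpha,\beta)}_{(i,j),sc}$. The impact operator $\mathcal T:\partial_{sc,ng}\mathcal D\to\partial_{sc,ng}\mathcal D$ replaces, for $Z\in\Sigma^{(\alpha,\beta)}_{(i,j),sc}$, the velocities $v_i^\alpha,v_j^\beta$ by $v_i^\alpha-\frac{2M_\beta}{M_\alpha+M_\beta}((v_i^\alpha-v_j^\beta)\cdot n)n$ and $v_j^\beta+\frac{2M_\alpha}{M_\alpha+M_\beta}((v_i^\alpha-v_j^\beta)\cdot n)n$, $n=(x_i^\alpha-x_j^\beta)/|x_i^\alpha-x_j^\beta|$, leaving everything else unchanged. "Realizing the hard-sphere dynamics" means: for a.e. $Z$, the trajectory $t\mapsto\Psi^t_{(N_1,N_2)}(Z)$ performs free motion ($\dot x_i^\alpha=v_i^\alpha$, $\dot v_i^\alpha=0$) while in the interior of $\mathcal D$, and on reaching $\partial\mathcal D$ it does so at a point of $\partial_{sc,ng}\mathcal D$, from which it continues with velocities updated by $\mathcal T$. Measure is Lebesgue measure; $\mathcal H^k$ is $k$-dimensional Hausdorff measure. *)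

theory Defs
  imports "HOL-Analysis.Analysis"
begin

section \<open>Hausdorff measure\<close>

text \<open>
  The \<open>k\<close>-dimensional Hausdorff (outer) measure, normalised so as to agree with Lebesgue measure in
  dimension \<open>k\<close>.  Boundedness of the covering sets has to be demanded explicitly because
  \<^const>\<open>diameter\<close> is unspecified on unbounded sets; the case distinction on the empty set only
  matters for \<open>k = 0\<close>.
\<close>

definition hausdorff_premeasure :: "nat \<Rightarrow> real \<Rightarrow> 'a::metric_space set \<Rightarrow> ennreal" where
  "hausdorff_premeasure k \<delta> A =
    (INF U \<in> {U :: nat \<Rightarrow> 'a set. A \<subseteq> (\<Union>i. U i) \<and> (\<forall>i. bounded (U i) \<and> diameter (U i) \<le> \<delta>)}.
      \<Sum>i. if U i = {} then 0 else ennreal (unit_ball_vol (real k) * (diameter (U i) / 2) ^ k))"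

definition hausdorff_measure :: "nat \<Rightarrow> 'a::metric_space set \<Rightarrow> ennreal" where
  "hausdorff_measure k A = (SUP \<delta>\<in>{0<..}. hausdorff_premeasure k \<delta> A)"

definition hausdorff_AE_on :: "nat \<Rightarrow> 'a::metric_space set \<Rightarrow> ('a \<Rightarrow> bool) \<Rightarrow> bool" where
  "hausdorff_AE_on k S P \<longleftrightarrow> hausdorff_measure k {x \<in> S. \<not> P x} = 0"


section \<open>Measure-preserving self-maps\<close>

definition measure_preserving_map :: "'a measure \<Rightarrow> ('a \<Rightarrow> 'a) \<Rightarrow> bool" where
  "measure_preserving_map \<mu> f \<longleftrightarrow>
     f \<in> \<mu> \<rightarrow>\<^sub>M \<mu> \<and> (\<forall>A\<in>sets \<mu>. emeasure \<mu> (f -` A \<inter> space \<mu>) = emeasure \<mu> A)"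


section \<open>Configurations of two species of hard spheres\<close>

text \<open>
  The particles of the first species are indexed by \<open>'n1\<close>, those of the second one by \<open>'n2\<close>
  (so \<open>N\<^sub>1 = CARD('n1)\<close>, \<open>N\<^sub>2 = CARD('n2)\<close>, both positive since types are inhabited); all particles
  together are indexed by the sum type.  The linear orders on \<open>'n1\<close> and \<open>'n2\<close> play the role of the
  order on \<open>{1..N}\<close>.  A configuration consists of all positions and all velocities; as a product of
  Euclidean spaces this is the Euclidean space of dimension \<open>2d(N\<^sub>1 + N\<^sub>2)\<close>.
\<close>

type_synonym ('d, 'n1, 'n2) config =
  "((real, 'd) vec, 'n1 + 'n2) vec \<times> ((real, 'd) vec, 'n1 + 'n2) vec"

abbreviation pos :: "('d::finite, 'n1::finite, 'n2::finite) config \<Rightarrow> 'n1 + 'n2 \<Rightarrow> real ^ 'd" where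
  "pos Z p \<equiv> fst Z $ p"

abbreviation vel :: "('d::finite, 'n1::finite, 'n2::finite) config \<Rightarrow> 'n1 + 'n2 \<Rightarrow> real ^ 'd" where
  "vel Z p \<equiv> snd Z $ p"

definition per_species :: "real \<Rightarrow> real \<Rightarrow> 'n1 + 'n2 \<Rightarrow> real" where
  "per_species a\<^sub>1 a\<^sub>2 p = (case p of Inl _ \<Rightarrow> a\<^sub>1 | Inr _ \<Rightarrow> a\<^sub>2)"

definition contact_distance :: "real \<Rightarrow> real \<Rightarrow> 'n1 + 'n2 \<Rightarrow> 'n1 + 'n2 \<Rightarrow> real" where
  "contact_distance \<epsilon>\<^sub>1 \<epsilon>\<^sub>2 p q = (per_species \<epsilon>\<^sub>1 \<epsilon>\<^sub>2 p + per_species \<epsilon>\<^sub>1 \<epsilon>\<^sub>2 q) / 2"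

text \<open>The disjoint union of the index sets \<open>I\<^sup>(\<^sup>\<alpha>\<^sup>,\<^sup>\<beta>\<^sup>)\<close> over the pairs of species \<open>\<alpha> \<le> \<beta>\<close>.\<close>

definition particle_pairs :: "(('n1::linorder + 'n2::linorder) \<times> ('n1 + 'n2)) set" where
  "particle_pairs =
     {(Inl i, Inl j) | i j. i < j} \<union> {(Inl i, Inr j) | i j. True} \<union> {(Inr i, Inr j) | i j. i < j}"

definition phase_space ::
  "real \<Rightarrow> real \<Rightarrow> ('d::finite, 'n1::{finite,linorder}, 'n2::{finite,linorder}) config set" where
  "phase_space \<epsilon>\<^sub>1 \<epsilon>\<^sub>2 =
     {Z. \<forall>(p, q) \<in> particle_pairs. norm (pos Z p - pos Z q) \<ge> contact_distance \<epsilon>\<^sub>1 \<epsilon>\<^sub>2 p q}"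

definition energy ::
  "real \<Rightarrow> real \<Rightarrow> ('d::finite, 'n1::finite, 'n2::finite) config \<Rightarrow> real" where
  "energy M\<^sub>1 M\<^sub>2 Z = (\<Sum>p\<in>UNIV. per_species M\<^sub>1 M\<^sub>2 p * (norm (vel Z p))\<^sup>2)"


section \<open>Collisions\<close>

definition collision_surface ::
  "real \<Rightarrow> real \<Rightarrow> 'n1 + 'n2 \<Rightarrow> 'n1 + 'n2 \<Rightarrow>
   ('d::finite, 'n1::{finite,linorder}, 'n2::{finite,linorder}) config set" where
  "collision_surface \<epsilon>\<^sub>1 \<epsilon>\<^sub>2 p q =
     {Z \<in> phase_space \<epsilon>\<^sub>1 \<epsilon>\<^sub>2. norm (pos Z p - pos Z q) = contact_distance \<epsilon>\<^sub>1 \<epsilon>\<^sub>2 p q}"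

definition simple_collision_surface ::
  "real \<Rightarrow> real \<Rightarrow> 'n1 + 'n2 \<Rightarrow> 'n1 + 'n2 \<Rightarrow>
   ('d::finite, 'n1::{finite,linorder}, 'n2::{finite,linorder}) config set" where
  "simple_collision_surface \<epsilon>\<^sub>1 \<epsilon>\<^sub>2 p q =
     {Z \<in> frontier (phase_space \<epsilon>\<^sub>1 \<epsilon>\<^sub>2). Z \<in> collision_surface \<epsilon>\<^sub>1 \<epsilon>\<^sub>2 p q \<and>
        (\<forall>(p', q') \<in> particle_pairs. (p', q') \<noteq> (p, q) \<longrightarrow> Z \<notin> collision_surface \<epsilon>\<^sub>1 \<epsilon>\<^sub>2 p' q')}"

definition grazing ::
  "'n1 + 'n2 \<Rightarrow> 'n1 + 'n2 \<Rightarrow> ('d::finite, 'n1::finite, 'n2::finite) config \<Rightarrow> bool" where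
  "grazing p q Z \<longleftrightarrow> (pos Z p - pos Z q) \<bullet> (vel Z p - vel Z q) = 0"

definition simple_nongrazing_boundary ::
  "real \<Rightarrow> real \<Rightarrow> ('d::finite, 'n1::{finite,linorder}, 'n2::{finite,linorder}) config set" where
  "simple_nongrazing_boundary \<epsilon>\<^sub>1 \<epsilon>\<^sub>2 =
     (\<Union>(p, q) \<in> particle_pairs. {Z \<in> simple_collision_surface \<epsilon>\<^sub>1 \<epsilon>\<^sub>2 p q. \<not> grazing p q Z})"

definition impact_at ::
  "real \<Rightarrow> real \<Rightarrow> 'n1 + 'n2 \<Rightarrow> 'n1 + 'n2 \<Rightarrow>
   ('d::finite, 'n1::finite, 'n2::finite) config \<Rightarrow> ('d, 'n1, 'n2) config" where
  "impact_at M\<^sub>1 M\<^sub>2 p q Z =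
     (let m = per_species M\<^sub>1 M\<^sub>2;
          n = (pos Z p - pos Z q) /\<^sub>R norm (pos Z p - pos Z q);
          c = (vel Z p - vel Z q) \<bullet> n
      in (fst Z,
          \<chi> r. if r = p then vel Z p - (2 * m q / (m p + m q) * c) *\<^sub>R n
               else if r = q then vel Z q + (2 * m p / (m p + m q) * c) *\<^sub>R n
               else vel Z r))"

text \<open>
  The impact operator.  On \<^const>\<open>simple_nongrazing_boundary\<close> the colliding pair is unique; elsewhere
  the value is irrelevant.
\<close>

definition impact ::
  "real \<Rightarrow> real \<Rightarrow> real \<Rightarrow> real \<Rightarrow>
   ('d::finite, 'n1::{finite,linorder}, 'n2::{finite,linorder}) config \<Rightarrow> ('d, 'n1, 'n2) config" where
  "impact M\<^sub>1 M\<^sub>2 \<epsilon>\<^sub>1 \<epsilon>\<^sub>2 Z =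
     (let (p, q) = (THE (p, q). (p, q) \<in> particle_pairs \<and> Z \<in> simple_collision_surface \<epsilon>\<^sub>1 \<epsilon>\<^sub>2 p q)
      in impact_at M\<^sub>1 M\<^sub>2 p q Z)"


section \<open>Hard-sphere dynamics\<close>

text \<open>
  A global trajectory of the elastic hard-sphere dynamics starting at \<open>Z\<close>: free motion in the
  interior, and at every time at which the boundary is met, the trajectory arrives (left limit) at a
  simple non-grazing collision \<open>Z'\<close> and leaves (right limit) with the velocities updated by the
  impact operator.  At the collision time itself the value may be either the pre- or the
  post-collisional configuration, so that no one-sided continuity convention is imposed.
\<close>

definition hard_sphere_trajectory ::
  "real \<Rightarrow> real \<Rightarrow> real \<Rightarrow> real \<Rightarrow>
   ('d::finite, 'n1::{finite,linorder}, 'n2::{finite,linorder}) config \<Rightarrow>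
   (real \<Rightarrow> ('d, 'n1, 'n2) config) \<Rightarrow> bool" where
  "hard_sphere_trajectory M\<^sub>1 M\<^sub>2 \<epsilon>\<^sub>1 \<epsilon>\<^sub>2 Z \<gamma> \<longleftrightarrow>
     \<gamma> 0 = Z \<and>
     (\<forall>t. \<gamma> t \<in> phase_space \<epsilon>\<^sub>1 \<epsilon>\<^sub>2) \<and>
     (\<forall>t. \<gamma> t \<in> interior (phase_space \<epsilon>\<^sub>1 \<epsilon>\<^sub>2) \<longrightarrow>
        (\<forall>p. ((\<lambda>s. pos (\<gamma> s) p) has_vector_derivative vel (\<gamma> t) p) (at t) \<and>
             ((\<lambda>s. vel (\<gamma> s) p) has_vector_derivative 0) (at t))) \<and>
     (\<forall>t. \<gamma> t \<in> frontier (phase_space \<epsilon>\<^sub>1 \<epsilon>\<^sub>2) \<longrightarrow>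
        (\<exists>Z' \<in> simple_nongrazing_boundary \<epsilon>\<^sub>1 \<epsilon>\<^sub>2.
           (\<gamma> \<longlongrightarrow> Z') (at_left t) \<and>
           (\<gamma> \<longlongrightarrow> impact M\<^sub>1 M\<^sub>2 \<epsilon>\<^sub>1 \<epsilon>\<^sub>2 Z') (at_right t) \<and>
           \<gamma> t \<in> {Z', impact M\<^sub>1 M\<^sub>2 \<epsilon>\<^sub>1 \<epsilon>\<^sub>2 Z'}))"

end

theory Submission
  imports Defs
begin

text \<open>
  The configurations form a billiard in the position space with one cylindrical scatterer for each pair of
  particles. A single scatterer has an explicit flow, conjugate to the free motion by the map that replaces
  the part of a line after its collision by the outgoing line. That map preserves Lebesgue measure: it
  commutes with the free motion, and at the moment of contact its derivative is block triangular with the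
  same reflection twice on the diagonal.

  A trajectory is a concatenation of such two-body flows. During a time step of length \<open>\<delta>\<close> this only fails
  for configurations that are within \<open>O(\<delta>)\<close> of two scatterers at once, a set of measure \<open>O(\<delta>\<^sup>2)\<close> in bounded
  regions of phase space. Since each step preserves the measure, the exceptional set of \<open>t / \<delta>\<close> steps
  has measure \<open>O(t \<delta>)\<close>, which tends to zero.
\<close>

section \<open>Measure-preserving maps of Euclidean spaces\<close>

text \<open>Counting steps also rules out infinitely many collisions in finite time: within one step
  a single scatterer is active, and the relative motion, a line outside a ball, meets it at most
  once. A state that survives \<open>n\<close> steps of length \<open>t / n\<close> therefore has at
  most \<open>n\<close> collisions up to time \<open>t\<close>. Contact states need a convention,
  since each carries an incoming and an outgoing velocity. Keeping only the outgoing one turns every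
  two-body flow into a group action, and determinism holds in both directions of time. Each time map
  then has its inverse in the same family, so one inequality between measures suffices. The
  conserved energy enters as a speed \<open>e\<close>. It turns closeness during a step into a
  condition on the state at the start of the step, and it bounds the growth of the region that
  \<open>n\<close> steps can visit. The impact identity is built into the final maps: an incoming
  contact state is replaced by its outgoing counterpart before it moves. This changes the maps on a
  null set only, and the identity then holds at every point of the simple non-grazing boundary, so
  that no Hausdorff measure has to be estimated.\<close>

declare emeasure_completion [simp del]

text \<open>Images instead of preimages: this is the form in which the change of variables formula
  comes, and it restricts to subsets, so that maps defined by cases can be treated piece by
  piece.\<close>

definition measure_preserving_on :: "('a::euclidean_space \<Rightarrow> 'b::euclidean_space) \<Rightarrow> 'a set \<Rightarrow> bool" where
  "measure_preserving_on f S \<longleftrightarrow>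
     (\<forall>A\<subseteq>S. A \<in> sets lebesgue \<longrightarrow>
        f ` A \<in> sets lebesgue \<and> emeasure lebesgue (f ` A) = emeasure lebesgue A)"

lemma measure_preserving_onI:
  assumes "\<And>A. A \<subseteq> S \<Longrightarrow> A \<in> sets lebesgue \<Longrightarrow> f ` A \<in> sets lebesgue"
    and "\<And>A. A \<subseteq> S \<Longrightarrow> A \<in> sets lebesgue \<Longrightarrow> emeasure lebesgue (f ` A) = emeasure lebesgue A"
  shows "measure_preserving_on f S"
  unfolding measure_preserving_on_def using assms by blast

lemma measure_preserving_onD:
  assumes "measure_preserving_on f S" "A \<subseteq> S" "A \<in> sets lebesgue"
  shows "f ` A \<in> sets lebesgue" "emeasure lebesgue (f ` A) = emeasure lebesgue A"
  using assms unfolding measure_preserving_on_def by blast+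

lemma measure_preserving_on_subset:
  "measure_preserving_on f S \<Longrightarrow> T \<subseteq> S \<Longrightarrow> measure_preserving_on f T"
  unfolding measure_preserving_on_def by blast

lemma measure_preserving_on_cong:
  assumes "measure_preserving_on f S" "\<And>x. x \<in> S \<Longrightarrow> f x = g x"
  shows "measure_preserving_on g S"
proof -
  have "g ` A = f ` A" if "A \<subseteq> S" for A
    using assms(2) that by (intro image_cong) auto
  then show ?thesis
    using assms(1) by (simp add: measure_preserving_on_def)
qed

lemma measure_preserving_on_id: "measure_preserving_on (\<lambda>x. x) S"
  by (simp add: measure_preserving_on_def)

lemma measure_preserving_on_compose:
  assumes "measure_preserving_on f S" "measure_preserving_on g T" "f ` S \<subseteq> T"
  shows "measure_preserving_on (\<lambda>x. g (f x)) S"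
proof (rule measure_preserving_onI)
  fix A assume A: "A \<subseteq> S" "A \<in> sets lebesgue"
  have "f ` A \<subseteq> T"
    using A assms(3) by blast
  moreover have "(\<lambda>x. g (f x)) ` A = g ` f ` A"
    by auto
  ultimately show "(\<lambda>x. g (f x)) ` A \<in> sets lebesgue"
    "emeasure lebesgue ((\<lambda>x. g (f x)) ` A) = emeasure lebesgue A"
    using measure_preserving_onD[OF assms(1) A] measure_preserving_onD[OF assms(2)] by simp_all
qed

text \<open>Injectivity across both pieces keeps their images disjoint, so the measures add up. Maps
  glued from several formulas, such as \<open>collide\<close> or \<open>Phi\<close>, are handled in
  this way.\<close>

lemma measure_preserving_on_Un:
  assumes f: "measure_preserving_on f S" "measure_preserving_on f T"
    and S: "S \<in> sets lebesgue" and inj: "inj_on f (S \<union> T)"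
  shows "measure_preserving_on f (S \<union> T)"
proof (rule measure_preserving_onI)
  fix A assume A: "A \<subseteq> S \<union> T" "A \<in> sets lebesgue"
  have m: "A \<inter> S \<in> sets lebesgue" "A - S \<in> sets lebesgue" and sub: "A - S \<subseteq> T"
    using A S by auto
  have eq: "A = (A \<inter> S) \<union> (A - S)"
    by auto
  have im: "f ` A = f ` (A \<inter> S) \<union> f ` (A - S)"
    by auto
  note 1 = measure_preserving_onD[OF f(1) _ m(1)] and 2 = measure_preserving_onD[OF f(2) sub m(2)]
  show "f ` A \<in> sets lebesgue"
    unfolding im using 1 2 by auto
  have "f ` (A \<inter> S) \<inter> f ` (A - S) = {}"
    using inj A(1) by (auto dest!: inj_onD simp: subset_iff)
  then have "emeasure lebesgue (f ` A) = emeasure lebesgue (f ` (A \<inter> S)) + emeasure lebesgue (f ` (A - S))"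
    unfolding im using 1 2 by (intro plus_emeasure[symmetric]) auto
  also have "\<dots> = emeasure lebesgue (A \<inter> S) + emeasure lebesgue (A - S)"
    using 1 2 by simp
  also have "\<dots> = emeasure lebesgue A"
    using m by (subst plus_emeasure) (auto intro!: arg_cong[where f="emeasure lebesgue"])
  finally show "emeasure lebesgue (f ` A) = emeasure lebesgue A" .
qed

lemma measure_preserving_on_UN:
  assumes "finite I" "\<And>i. i \<in> I \<Longrightarrow> measure_preserving_on f (S i)"
    and "\<And>i. i \<in> I \<Longrightarrow> S i \<in> sets lebesgue" "inj_on f (\<Union>i\<in>I. S i)"
  shows "measure_preserving_on f (\<Union>i\<in>I. S i)"
  using assms
proof (induction I rule: finite_induct)
  case empty
  then show ?case by (simp add: measure_preserving_on_def)
next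
  case (insert i I)
  have "inj_on f (\<Union>i\<in>I. S i)"
    using insert.prems(3) by (rule inj_on_subset) auto
  then have "measure_preserving_on f (\<Union>i\<in>I. S i)"
    using insert by auto
  then show ?case
    using insert.prems by (auto intro!: measure_preserving_on_Un)
qed

text \<open>The change of variables formula is applied to sets of finite measure; exhausting a set
  by balls and passing to the limit along the increasing images covers the rest.\<close>

lemma measure_preserving_on_measure:
  fixes f :: "'a::euclidean_space \<Rightarrow> 'b::euclidean_space"
  assumes S: "S \<in> sets lebesgue"
    and f: "\<And>A. A \<subseteq> S \<Longrightarrow> A \<in> lmeasurable \<Longrightarrow>
              f ` A \<in> lmeasurable \<and> measure lebesgue (f ` A) = measure lebesgue A"
  shows "measure_preserving_on f S"
proof -
  have "f ` A \<in> sets lebesgue \<and> emeasure lebesgue (f ` A) = emeasure lebesgue A"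
    if A: "A \<subseteq> S" "A \<in> sets lebesgue" for A
  proof -
    define B where "B n = A \<inter> cball 0 (real n)" for n
    have B: "B n \<in> lmeasurable" "B n \<subseteq> S" for n
      using A by (auto simp: B_def intro!: bounded_set_imp_lmeasurable bounded_Int)
    have eqA: "A = (\<Union>n. B n)"
      by (auto simp: B_def) (meson real_arch_simple)
    have im: "f ` A = (\<Union>n. f ` B n)"
      by (subst eqA) auto
    have incB: "incseq B"
      by (auto simp: incseq_def B_def)
    have inc: "incseq (\<lambda>n. f ` B n)"
      using incB by (fastforce simp: incseq_def)
    have ms: "f ` B n \<in> lmeasurable" for n
      using f[OF B(2) B(1)] by simp
    have eq: "emeasure lebesgue (f ` B n) = emeasure lebesgue (B n)" for n
      using f[OF B(2) B(1)] by (simp add: emeasure_eq_measure2[OF ms] emeasure_eq_measure2[OF B(1)])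
    have "f ` A \<in> sets lebesgue"
      unfolding im using fmeasurableD[OF ms] by (intro sets.countable_UN) blast
    moreover have "emeasure lebesgue (f ` A) = (SUP n. emeasure lebesgue (f ` B n))"
      unfolding im using fmeasurableD[OF ms] inc by (intro SUP_emeasure_incseq[symmetric]) blast+
    moreover have "emeasure lebesgue A = (SUP n. emeasure lebesgue (B n))"
      using fmeasurableD[OF B(1)] incB by (subst eqA, intro SUP_emeasure_incseq[symmetric]) blast+
    ultimately show ?thesis
      using eq by simp
  qed
  then show ?thesis
    unfolding measure_preserving_on_def by blast
qed

text \<open>
  Coordinates indexed by a well-ordered finite type, which the change of variables theorem of
  the library requires.
\<close>

typedef (overloaded) 'a coord = "{..<DIM('a::euclidean_space)}"
  by (rule exI[of _ 0]) simp

setup_lifting type_definition_coord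

instantiation coord :: (euclidean_space) wellorder
begin

lift_definition less_eq_coord :: "'a coord \<Rightarrow> 'a coord \<Rightarrow> bool" is "(\<le>)" .
lift_definition less_coord :: "'a coord \<Rightarrow> 'a coord \<Rightarrow> bool" is "(<)" .

instance
proof
  fix P :: "'a coord \<Rightarrow> bool" and a :: "'a coord"
  assume *: "\<And>x. (\<And>y. y < x \<Longrightarrow> P y) \<Longrightarrow> P x"
  show "P a"
  proof (induction "Rep_coord a" arbitrary: a rule: less_induct)
    case less
    then show ?case
      by (auto simp: less_coord.rep_eq intro: *)
  qed
qed (auto simp: less_eq_coord.rep_eq less_coord.rep_eq Rep_coord_inject)

end

lemma bij_Rep_coord: "bij_betw Rep_coord (UNIV :: 'a::euclidean_space coord set) {..<DIM('a)}"
  using type_definition.Rep_range[OF type_definition_coord]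
  by (auto simp: bij_betw_def inj_on_def Rep_coord_inject)

instance coord :: (euclidean_space) finite
  using bij_betw_finite[OF bij_Rep_coord] by intro_classes auto

definition coord_basis :: "'a::euclidean_space coord \<Rightarrow> 'a" where
  "coord_basis = (SOME f. bij_betw f UNIV Basis)"

lemma bij_coord_basis: "bij_betw coord_basis UNIV (Basis :: 'a::euclidean_space set)"
proof -
  obtain h :: "nat \<Rightarrow> 'a" where "bij_betw h {..<DIM('a)} Basis"
    using ex_bij_betw_nat_finite[OF finite_Basis] by (auto simp: atLeast0LessThan)
  then have "bij_betw (h \<circ> Rep_coord) (UNIV :: 'a coord set) Basis"
    using bij_betw_trans[OF bij_Rep_coord[where 'a='a]] by blast
  then show ?thesis
    unfolding coord_basis_def by (rule someI[of "\<lambda>f. bij_betw f UNIV Basis"])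
qed

definition of_coords :: "real ^ 'a coord \<Rightarrow> 'a::euclidean_space" where
  "of_coords x = (\<Sum>i\<in>UNIV. x $ i *\<^sub>R coord_basis i)"

definition to_coords :: "'a::euclidean_space \<Rightarrow> real ^ 'a coord" where
  "to_coords y = (\<chi> i. y \<bullet> coord_basis i)"

lemma coord_basis_in: "coord_basis i \<in> Basis"
  using bij_coord_basis by (auto simp: bij_betw_def)

lemma inner_coord_basis: "coord_basis i \<bullet> coord_basis j = (if i = j then 1 else 0)"
  using bij_coord_basis coord_basis_in[of i] coord_basis_in[of j]
  by (auto simp: inner_Basis bij_betw_def inj_on_def)

lemma to_of_coords [simp]: "to_coords (of_coords x) = x"
  by (simp add: to_coords_def of_coords_def inner_sum_left inner_coord_basis vec_eq_iff if_distrib cong: if_cong)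

lemma of_to_coords [simp]: "of_coords (to_coords y) = y"
proof -
  have "(\<Sum>i\<in>UNIV. (y \<bullet> coord_basis i) *\<^sub>R coord_basis i) = (\<Sum>b\<in>Basis. (y \<bullet> b) *\<^sub>R b)"
    by (rule sum.reindex_bij_betw[OF bij_coord_basis])
  then show ?thesis
    by (simp add: to_coords_def of_coords_def euclidean_representation)
qed

lemma linear_of_coords: "linear of_coords"
  by (rule linearI) (simp_all add: of_coords_def algebra_simps sum.distrib scaleR_right.sum)

lemma linear_to_coords: "linear to_coords"
  by (rule linearI) (simp_all add: to_coords_def vec_eq_iff algebra_simps)

lemma bounded_linear_of_coords: "bounded_linear of_coords"
  and bounded_linear_to_coords: "bounded_linear to_coords"
  using linear_of_coords linear_to_coords by (simp_all only: linear_conv_bounded_linear)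

lemma image_of_coords: "of_coords ` S = to_coords -` S"
  by (auto simp: image_iff) (metis of_to_coords)

text \<open>It is enough to compare boxes. The preimage of a box is the box of its coordinate
  bounds, and reindexing the basis identifies the products of the side lengths.\<close>

lemma distr_of_coords: "distr lborel borel of_coords = (lborel :: 'a::euclidean_space measure)"
proof (rule lborel_eqI[symmetric])
  have meas: "(of_coords :: _ \<Rightarrow> 'a) \<in> borel_measurable lborel"
    by (simp add: borel_measurable_continuous_onI linear_continuous_on bounded_linear_of_coords)
  show "sets (distr lborel borel (of_coords :: _ \<Rightarrow> 'a)) = sets borel"
    by simp
  fix l u :: 'a
  assume le: "\<And>b. b \<in> Basis \<Longrightarrow> l \<bullet> b \<le> u \<bullet> b"
  have inner: "of_coords x \<bullet> coord_basis i = x $ i" for i and x :: "real ^ 'a coord"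
    using to_of_coords[of x] by (simp add: to_coords_def vec_eq_iff)
  have B: "(\<forall>b\<in>Basis. P b) \<longleftrightarrow> (\<forall>i. P (coord_basis i))" for P :: "'a \<Rightarrow> bool"
    using bij_coord_basis[where 'a='a] by (auto simp: bij_betw_def) (metis (no_types) imageE)
  have vim: "of_coords -` box l u = box (to_coords l) (to_coords u)"
    by (auto simp: mem_box_cart mem_box inner B to_coords_def)
  have "emeasure (distr lborel borel of_coords) (box l u) = emeasure lborel (box (to_coords l) (to_coords u))"
    using meas by (simp add: emeasure_distr vim)
  also have "\<dots> = ennreal (\<Prod>b\<in>Basis. (to_coords u - to_coords l) \<bullet> b)"
    by (intro emeasure_lborel_box) (auto simp: Basis_vec_def inner_axis to_coords_def le coord_basis_in)
  also have "(\<Prod>b\<in>Basis. (to_coords u - to_coords l) \<bullet> b)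
      = (\<Prod>b\<in>(\<lambda>i. axis i (1::real)) ` UNIV. (to_coords u - to_coords l) \<bullet> b)"
    by (auto simp: Basis_vec_def intro!: prod.cong)
  also have "\<dots> = (\<Prod>i\<in>UNIV. (u - l) \<bullet> coord_basis i)"
    by (subst prod.reindex) (auto simp: inj_on_def axis_eq_axis inner_axis to_coords_def inner_diff_left)
  also have "\<dots> = (\<Prod>b\<in>Basis. (u - l) \<bullet> b)"
    by (rule prod.reindex_bij_betw[OF bij_coord_basis])
  finally show "emeasure (distr lborel borel of_coords) (box l u) = ennreal (\<Prod>b\<in>Basis. (u - l) \<bullet> b)" .
qed

lemma DIM_coord: "CARD('a coord) = DIM('a::euclidean_space)"
  using bij_betw_same_card[OF bij_coord_basis[where 'a='a]] by simp

text \<open>Borel sets are covered by \<open>distr_of_coords\<close>. A Lebesgue set differs from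
  one by a negligible set, whose image under a linear map between spaces of equal dimension is again
  negligible.\<close>

lemma measure_preserving_of_coords: "measure_preserving_on of_coords S"
proof (rule measure_preserving_onI)
  fix A :: "(real ^ 'a coord) set" assume A: "A \<in> sets lebesgue"
  have diff: "of_coords differentiable_on T" for T :: "(real ^ 'a coord) set"
    using bounded_linear_of_coords by (rule bounded_linear_imp_differentiable_on)
  show "of_coords ` A \<in> sets lebesgue"
    by (intro differentiable_image_in_sets_lebesgue A diff) (simp add: DIM_coord)
  obtain C N where C: "C \<in> sets borel" "negligible N" "C \<union> N = A"
    using sets_lebesgue_almost_borel[OF A] by metis
  have meas: "of_coords \<in> borel_measurable (lborel :: (real ^ 'a coord) measure)"
    "to_coords \<in> borel_measurable (borel :: 'a measure)"
    by (simp_all add: borel_measurable_continuous_onI linear_continuous_on bounded_linear_of_coords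
        bounded_linear_to_coords)
  have bo: "of_coords ` C \<in> sets borel"
    unfolding image_of_coords using measurable_sets[OF meas(2) C(1)] by simp
  have neg: "negligible (of_coords ` N)"
    using C(2) diff by (intro negligible_differentiable_image_negligible) (simp_all add: DIM_coord)
  have "emeasure lebesgue (of_coords ` C) = emeasure (distr lborel borel of_coords) (of_coords ` C)"
    using bo by (simp add: distr_of_coords emeasure_completion)
  also have "\<dots> = emeasure lborel C"
    using bo meas by (subst emeasure_distr) (auto simp: image_of_coords vimage_def)
  finally have eq: "emeasure lebesgue (of_coords ` C) = emeasure lebesgue C"
    using C by (simp add: emeasure_completion)
  have "emeasure lebesgue (of_coords ` A) = emeasure lebesgue (of_coords ` C \<union> of_coords ` N)"
    using C(3) by (metis image_Un)
  also have "\<dots> = emeasure lebesgue (of_coords ` C)"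
    using neg bo by (intro emeasure_Un_null_set) (auto simp: negligible_iff_null_sets)
  also have "\<dots> = emeasure lebesgue (C \<union> N)"
    using C eq by (subst emeasure_Un_null_set) (auto simp: negligible_iff_null_sets)
  finally show "emeasure lebesgue (of_coords ` A) = emeasure lebesgue A"
    using C(3) by simp
qed

lemma measure_preserving_to_coords: "measure_preserving_on to_coords S"
proof (rule measure_preserving_onI)
  fix A :: "'a set" assume A: "A \<in> sets lebesgue"
  have diff: "to_coords differentiable_on A"
    using bounded_linear_to_coords by (rule bounded_linear_imp_differentiable_on)
  show *: "to_coords ` A \<in> sets lebesgue"
    by (intro differentiable_image_in_sets_lebesgue A diff) (simp add: DIM_coord)
  have "of_coords ` to_coords ` A = A"
    by (simp add: image_image)
  then show "emeasure lebesgue (to_coords ` A) = emeasure lebesgue A"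
    using measure_preserving_onD(2)[OF measure_preserving_of_coords subset_refl *] by simp
qed

section \<open>Jacobians of linear maps and change of variables\<close>

definition jacobian :: "('a::euclidean_space \<Rightarrow> 'a) \<Rightarrow> real" where
  "jacobian f = \<bar>det (matrix (\<lambda>x. to_coords (f (of_coords x))))\<bar>"

lemma linear_conj_coords: "linear f \<Longrightarrow> linear (\<lambda>x. to_coords (f (of_coords x)))"
  using linear_compose[OF linear_compose[OF linear_of_coords] linear_to_coords] by (simp add: o_def)

lemma jacobian_compose:
  fixes f g :: "'a::euclidean_space \<Rightarrow> 'a"
  assumes "linear f" "linear g"
  shows "jacobian (\<lambda>x. g (f x)) = jacobian g * jacobian f"
proof -
  have "matrix (\<lambda>x. to_coords (g (f (of_coords x))))
      = matrix (\<lambda>x. to_coords (g (of_coords x))) ** matrix (\<lambda>x. to_coords (f (of_coords x)))"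
    using matrix_compose[OF linear_conj_coords[OF assms(1)] linear_conj_coords[OF assms(2)]]
    by (simp add: o_def)
  then show ?thesis
    by (simp add: jacobian_def det_mul abs_mult)
qed

lemma jacobian_id: "jacobian (\<lambda>x. x) = 1"
  by (simp add: jacobian_def matrix_id_mat_1[unfolded id_def] det_I)

lemma jacobian_nonneg: "jacobian f \<ge> 0"
  by (simp add: jacobian_def)

lemma jacobian_involution:
  assumes "linear f" "\<And>x. f (f x) = x"
  shows "jacobian f = 1"
proof -
  have "jacobian f * jacobian f = 1"
    using jacobian_compose[OF assms(1,1)] assms(2) by (simp add: jacobian_id)
  then show ?thesis
    using jacobian_nonneg[of f] by (metis abs_of_nonneg power2_eq_square real_sqrt_abs real_sqrt_one)
qed

text \<open>Conjugation with \<open>k\<close> inverts \<open>f\<close>, so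
  \<open>f \<circ> k\<close> is an involution and has Jacobian 1, as has \<open>k\<close>. Free
  motion and shears are of this kind, with \<open>k\<close> the reversal of velocities; no matrix
  has to be written down.\<close>

lemma jacobian_reversible:
  assumes "linear f" "linear k" "\<And>x. k (k x) = x" "\<And>x. f (k (f (k x))) = x"
  shows "jacobian f = 1"
proof -
  have fk: "linear (\<lambda>x. f (k x))"
    using linear_compose[OF assms(2,1)] by (simp add: o_def)
  have "jacobian (\<lambda>x. f (k x)) = 1"
    by (rule jacobian_involution[OF fk]) (simp add: assms)
  then show ?thesis
    using jacobian_compose[OF assms(2,1)] jacobian_involution[OF assms(2,3)] by simp
qed

text \<open>Conjugation with the coordinate isomorphism, which preserves measure in both directions,
  reduces this to the change of variables formula on \<open>real ^ 'a coord\<close>.\<close>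

lemma measure_preserving_on_jacobian:
  fixes f :: "'a::euclidean_space \<Rightarrow> 'a"
  assumes S: "S \<in> sets lebesgue"
    and der: "\<And>x. x \<in> S \<Longrightarrow> (f has_derivative f' x) (at x)"
    and jac: "\<And>x. x \<in> S \<Longrightarrow> jacobian (f' x) = 1"
    and inj: "inj_on f S"
  shows "measure_preserving_on f S"
proof -
  define g where "g x = to_coords (f (of_coords x))" for x
  define g' where "g' x v = to_coords (f' (of_coords x) (of_coords v))" for x v
  have T: "to_coords ` S \<in> sets lebesgue"
    using measure_preserving_onD(1)[OF measure_preserving_to_coords subset_refl S] .
  have derg: "(g has_derivative g' x) (at x)" if "x \<in> to_coords ` S" for x
  proof -
    have x: "of_coords x \<in> S"
      using that by auto
    have 1: "((\<lambda>x. f (of_coords x)) has_derivative (\<lambda>v. f' (of_coords x) (of_coords v))) (at x)"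
      by (rule has_derivative_compose[OF bounded_linear.has_derivative[OF bounded_linear_of_coords has_derivative_ident] der[OF x]])
    show ?thesis
      unfolding g_def g'_def by (rule bounded_linear.has_derivative[OF bounded_linear_to_coords 1])
  qed
  have det: "\<bar>det (matrix (g' x))\<bar> = 1" if "x \<in> to_coords ` S" for x
    using jac[of "of_coords x"] that by (auto simp: jacobian_def g'_def[abs_def])
  have injg: "inj_on g (to_coords ` S)"
    using inj by (auto simp: inj_on_def g_def) (metis of_to_coords)
  have "measure_preserving_on g (to_coords ` S)"
  proof (rule measure_preserving_on_measure[OF T])
    fix A :: "(real ^ 'a coord) set"
    assume A: "A \<subseteq> to_coords ` S" "A \<in> lmeasurable"
    have d: "(g has_derivative g' x) (at x within A)" if "x \<in> A" for x
      using derg A that has_derivative_at_withinI by blast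
    have i: "inj_on g A"
      using injg A(1) by (rule inj_on_subset)
    have "((\<lambda>x. \<bar>det (matrix (g' x))\<bar>) integrable_on A) \<longleftrightarrow> (\<lambda>x. 1::real) integrable_on A"
      using det A by (intro integrable_cong) auto
    then have int: "(\<lambda>x. \<bar>det (matrix (g' x))\<bar>) integrable_on A"
      using A(2) lmeasurable_iff_integrable_on by blast
    have "integral A (\<lambda>x. \<bar>det (matrix (g' x))\<bar>) = integral A (\<lambda>x. 1)"
      using det A by (intro integral_cong) auto
    then show "g ` A \<in> lmeasurable \<and> measure lebesgue (g ` A) = measure lebesgue A"
      using A(2) int measure_differentiable_image_eq[OF _ d i int] measurable_differentiable_image_eq[OF _ d i]
      by (simp add: lmeasure_integral fmeasurableD)
  qed
  then have "measure_preserving_on (\<lambda>x. g (to_coords x)) S"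
    by (intro measure_preserving_on_compose[OF measure_preserving_to_coords]) auto
  then have "measure_preserving_on (\<lambda>x. of_coords (g (to_coords x))) S"
    by (rule measure_preserving_on_compose[OF _ measure_preserving_of_coords]) auto
  then show ?thesis
    by (rule measure_preserving_on_cong) (simp add: g_def)
qed

lemma measure_preserving_on_linear:
  fixes f :: "'a::euclidean_space \<Rightarrow> 'a"
  assumes "linear f" "jacobian f = 1" "inj f"
  shows "measure_preserving_on f S"
proof -
  have "(f has_derivative f) (at x)" for x
    using assms(1) by (simp add: bounded_linear_imp_has_derivative linear_conv_bounded_linear)
  then have "measure_preserving_on f UNIV"
    using assms by (intro measure_preserving_on_jacobian[where f'="\<lambda>_. f"]) auto
  then show ?thesis
    by (rule measure_preserving_on_subset) simp
qed

section \<open>A single cylindrical scatterer\<close>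

definition drift :: "real \<Rightarrow> 'a::real_vector \<times> 'a \<Rightarrow> 'a \<times> 'a" where
  "drift t Z = (fst Z + t *\<^sub>R snd Z, snd Z)"

definition flip :: "'a::real_vector \<times> 'a \<Rightarrow> 'a \<times> 'a" where
  "flip Z = (fst Z, - snd Z)"

lemma fst_drift [simp]: "fst (drift t Z) = fst Z + t *\<^sub>R snd Z"
  and snd_drift [simp]: "snd (drift t Z) = snd Z"
  by (simp_all add: drift_def)

lemma drift_0 [simp]: "drift 0 Z = Z"
  by (simp add: drift_def)

lemma drift_drift [simp]: "drift s (drift t Z) = drift (s + t) Z"
  by (simp add: drift_def algebra_simps)

lemma flip_flip [simp]: "flip (flip Z) = Z"
  by (simp add: flip_def)

lemma fst_flip [simp]: "fst (flip Z) = fst Z"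
  and snd_flip [simp]: "snd (flip Z) = - snd Z"
  by (simp_all add: flip_def)

lemma flip_drift: "flip (drift t Z) = drift (- t) (flip Z)"
  by (simp add: flip_def drift_def)

lemma linear_drift: "linear (drift t)"
  by (rule linearI) (simp_all add: drift_def algebra_simps)

lemma linear_flip: "linear flip"
  by (rule linearI) (simp_all add: flip_def)

lemma jacobian_drift: "jacobian (drift t :: 'a::euclidean_space \<times> 'a \<Rightarrow> _) = 1"
  by (rule jacobian_reversible[OF linear_drift linear_flip]) (simp_all add: flip_drift)

lemma inj_drift: "inj (drift t)"
  by (rule inj_on_inverseI[where g="drift (- t)"]) simp

lemma inj_flip: "inj flip"
  by (rule inj_on_inverseI[where g=flip]) simp

lemma measure_preserving_drift: "measure_preserving_on (drift t :: 'a::euclidean_space \<times> 'a \<Rightarrow> _) S"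
  by (rule measure_preserving_on_linear[OF linear_drift jacobian_drift inj_drift])

lemma measure_preserving_flip: "measure_preserving_on (flip :: 'a::euclidean_space \<times> 'a \<Rightarrow> _) S"
  by (rule measure_preserving_on_linear[OF linear_flip jacobian_involution[OF linear_flip] inj_flip]) simp

text \<open>
  One cylindrical scatterer \<open>norm (l X) < r\<close> in the position space \<open>'a\<close>.  For a pair of
  particles \<open>p, q\<close>, \<open>l\<close> is the difference of their positions and \<open>j w\<close> moves them
  apart by \<open>2 w\<close>, the shares being weighted by the masses; \<open>e\<close> stands for a conserved
  speed.
\<close>

locale cylinder =
  fixes l :: "'a::euclidean_space \<Rightarrow> 'b::euclidean_space" and j :: "'b \<Rightarrow> 'a"
    and r :: real and e :: "'a \<Rightarrow> real"
  assumes linear_l: "linear l" and linear_j: "linear j" and l_j: "l (j w) = 2 *\<^sub>R w"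
    and r_pos: "r > 0"
    and e_reflect: "norm n = 1 \<Longrightarrow> e (V - (l V \<bullet> n) *\<^sub>R j n) = e V"
    and norm_le_e: "norm V \<le> e V"
begin

definition rel :: "'a \<times> 'a \<Rightarrow> 'b" where "rel Z = l (fst Z)"
definition rvel :: "'a \<times> 'a \<Rightarrow> 'b" where "rvel Z = l (snd Z)"

text \<open>A quarter of the discriminant of the quadratic equation
  \<open>norm (rel Z + t *\<^sub>R rvel Z) = r\<close> (after squaring) for the time
  \<open>t\<close>. It is positive when the full line, past and future, crosses the scatterer
  transversally.\<close>

definition disc :: "'a \<times> 'a \<Rightarrow> real" where
  "disc Z = (rel Z \<bullet> rvel Z)\<^sup>2 - (rvel Z \<bullet> rvel Z) * (rel Z \<bullet> rel Z - r\<^sup>2)"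

definition hit :: "'a \<times> 'a \<Rightarrow> bool" where "hit Z \<longleftrightarrow> disc Z > 0"

text \<open>The earlier root, at which the line enters the scatterer; it is negative when this
  moment lies in the past.\<close>

definition hit_time :: "'a \<times> 'a \<Rightarrow> real" where
  "hit_time Z = (- (rel Z \<bullet> rvel Z) - sqrt (disc Z)) / (rvel Z \<bullet> rvel Z)"

text \<open>For \<open>norm w = r\<close> this is the elastic reflection in the contact direction:
  \<open>r\<^sup>2\<close> normalises \<open>w\<close>, and the factor 2 in \<open>l_j\<close>
  reverses the normal relative velocity.\<close>

definition mirror :: "'b \<Rightarrow> 'a \<Rightarrow> 'a" where
  "mirror w V = V - ((l V \<bullet> w) / r\<^sup>2) *\<^sub>R j w"

text \<open>
  Both the incoming and the outgoing line of a collision are parametrised by time; \<open>scatter\<close>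
  maps a point of the former to the point of the latter at the same time, as if the collision had
  already happened.
\<close>

definition contact :: "'a \<times> 'a \<Rightarrow> 'b" where "contact Z = rel Z + hit_time Z *\<^sub>R rvel Z"

definition scatter :: "'a \<times> 'a \<Rightarrow> 'a \<times> 'a" where
  "scatter Z = (let V = mirror (contact Z) (snd Z) in (fst Z + hit_time Z *\<^sub>R (snd Z - V), V))"

lemmas l_simps = linear_add[OF linear_l] linear_diff[OF linear_l] linear_cmul[OF linear_l] linear_neg[OF linear_l]
lemmas j_simps = linear_add[OF linear_j] linear_diff[OF linear_j] linear_cmul[OF linear_j] linear_neg[OF linear_j]

lemma rel_drift [simp]: "rel (drift t Z) = rel Z + t *\<^sub>R rvel Z"
  by (simp add: rel_def rvel_def l_simps)

lemma rvel_drift [simp]: "rvel (drift t Z) = rvel Z"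
  by (simp add: rvel_def)

lemma rel_flip [simp]: "rel (flip Z) = rel Z"
  by (simp add: rel_def)

lemma rvel_flip [simp]: "rvel (flip Z) = - rvel Z"
  by (simp add: rvel_def l_simps)

lemma disc_drift [simp]: "disc (drift t Z) = disc Z"
  by (simp add: disc_def algebra_simps power2_eq_square inner_commute)

lemma disc_flip [simp]: "disc (flip Z) = disc Z"
  by (simp add: disc_def)

lemma hit_drift [simp]: "hit (drift t Z) = hit Z"
  and hit_flip [simp]: "hit (flip Z) = hit Z"
  by (simp_all add: hit_def)

lemma rvel_pos: "hit Z \<Longrightarrow> rvel Z \<bullet> rvel Z > 0"
  by (cases "rvel Z = 0") (auto simp: hit_def disc_def)

lemma contact_inner_rvel:
  assumes "hit Z"
  shows "contact Z \<bullet> rvel Z = - sqrt (disc Z)"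
  using rvel_pos[OF assms] by (simp add: contact_def hit_time_def inner_add_left)

lemma contact_inner_rvel_neg: "hit Z \<Longrightarrow> contact Z \<bullet> rvel Z < 0"
  by (simp add: contact_inner_rvel) (simp add: hit_def)

text \<open>\<open>disc\<close> is constant along the line. At the moment of contact its first term
  already equals \<open>disc Z\<close> by \<open>contact_inner_rvel\<close>, so the second one
  vanishes.\<close>

lemma contact_inner_contact:
  assumes "hit Z"
  shows "contact Z \<bullet> contact Z = r\<^sup>2"
proof -
  have "(rvel Z \<bullet> rvel Z) * (contact Z \<bullet> contact Z - r\<^sup>2) = (contact Z \<bullet> rvel Z)\<^sup>2 - disc Z"
    using disc_drift[of "hit_time Z" Z, unfolded disc_def[of "drift _ _"]]
    by (simp add: contact_def[symmetric])
  also have "\<dots> = 0"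
    using assms by (simp add: contact_inner_rvel hit_def)
  finally show ?thesis
    using rvel_pos[OF assms] by simp
qed

lemma norm_contact: "hit Z \<Longrightarrow> norm (contact Z) = r"
  using r_pos by (simp add: norm_eq_sqrt_inner contact_inner_contact)

text \<open>Moving inwards on the sphere singles out the earlier root, so hit times can be
  identified without solving the quadratic equation.\<close>

lemma hit_time_eqI:
  assumes "norm (rel (drift s Z)) = r" "rel (drift s Z) \<bullet> rvel Z < 0"
  shows "hit Z" "hit_time Z = s"
proof -
  have r2: "rel (drift s Z) \<bullet> rel (drift s Z) = r\<^sup>2"
    using assms(1) by (metis dot_square_norm)
  have D: "disc Z = (rel (drift s Z) \<bullet> rvel Z)\<^sup>2"
    using disc_drift[of s Z, unfolded disc_def[of "drift _ _"]] r2 by simp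
  then show h: "hit Z"
    using assms(2) by (simp add: hit_def)
  have "sqrt (disc Z) = - (rel (drift s Z) \<bullet> rvel Z)"
    using D assms(2) by (simp add: real_sqrt_abs)
  then show "hit_time Z = s"
    using rvel_pos[OF h] by (simp add: hit_time_def inner_add_left field_simps)
qed

lemma hit_time_drift [simp]: "hit Z \<Longrightarrow> hit_time (drift s Z) = hit_time Z - s"
  using rvel_pos[of Z] by (simp add: hit_time_def inner_add_left field_simps)

lemma contact_drift [simp]: "hit Z \<Longrightarrow> contact (drift s Z) = contact Z"
  by (simp add: contact_def algebra_simps)

lemma scatter_drift: "hit Z \<Longrightarrow> scatter (drift s Z) = drift s (scatter Z)"
  by (simp add: scatter_def Let_def drift_def[of _ "(_, _)"] algebra_simps)

lemma linear_mirror: "linear (mirror w)"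
  by (rule linearI) (simp_all add: mirror_def l_simps algebra_simps add_divide_distrib)

lemma l_mirror: "l (mirror w V) = l V - (2 * (l V \<bullet> w) / r\<^sup>2) *\<^sub>R w"
  by (simp add: mirror_def l_simps l_j)

lemma mirror_mirror:
  assumes "norm w = r"
  shows "mirror w (mirror w V) = V"
proof -
  have "w \<bullet> w = r\<^sup>2"
    using assms by (metis dot_square_norm)
  then have "l (mirror w V) \<bullet> w = - (l V \<bullet> w)"
    using r_pos by (simp add: l_mirror inner_diff_left)
  then show ?thesis
    by (simp add: mirror_def[of w "mirror w V"]) (simp add: mirror_def)
qed

lemma mirror_inner: "norm w = r \<Longrightarrow> w \<bullet> l (mirror w V) = - (w \<bullet> l V)"
  using r_pos dot_square_norm[of w] by (simp add: l_mirror inner_diff_right inner_commute)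

lemma e_mirror: 
  assumes "norm w = r"
  shows "e (mirror w V) = e V"
proof -
  have "mirror w V = V - (l V \<bullet> (w /\<^sub>R r)) *\<^sub>R j (w /\<^sub>R r)"
    by (simp add: mirror_def j_simps power2_eq_square divide_inverse algebra_simps)
  moreover have "norm (w /\<^sub>R r) = 1"
    using assms r_pos by simp
  ultimately show ?thesis
    using e_reflect by metis
qed

lemma scatter_contact:
  assumes "hit Z"
  shows "rel (drift (hit_time Z) (scatter Z)) = contact Z"
    "contact Z \<bullet> rvel (scatter Z) = - (contact Z \<bullet> rvel Z)"
  using mirror_inner[OF norm_contact[OF assms], of "snd Z"]
  by (simp_all add: scatter_def Let_def rel_def rvel_def contact_def l_simps algebra_simps)

text \<open>Time reversal: the reversed outgoing line meets the sphere at the same point, at the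
  opposite time, and the involution \<open>mirror\<close> sends it back along the reversed incoming
  line.\<close>

lemma flip_scatter_flip:
  assumes "hit Z"
  shows "hit (scatter Z)" "hit_time (flip (scatter Z)) = - hit_time Z"
    "contact (flip (scatter Z)) = contact Z" "flip (scatter (flip (scatter Z))) = Z"
proof -
  let ?Y = "flip (scatter Z)"
  have c: "rel (drift (- hit_time Z) ?Y) = contact Z"
    using scatter_contact(1)[OF assms] by simp
  have "norm (rel (drift (- hit_time Z) ?Y)) = r" "rel (drift (- hit_time Z) ?Y) \<bullet> rvel ?Y < 0"
    unfolding c using norm_contact[OF assms] scatter_contact(2)[OF assms] contact_inner_rvel_neg[OF assms]
    by simp_all
  note h = hit_time_eqI[OF this]
  show "hit (scatter Z)" "hit_time ?Y = - hit_time Z"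
    using h by simp_all
  show cc: "contact ?Y = contact Z"
    using c h(2) by (simp add: contact_def)
  have "mirror (contact Z) (- mirror (contact Z) (snd Z)) = - snd Z"
    using mirror_mirror[OF norm_contact[OF assms]] by (simp add: linear_neg[OF linear_mirror])
  then show "flip (scatter ?Y) = Z"
    by (simp add: scatter_def[of ?Y] Let_def cc h(2))
      (simp add: scatter_def Let_def flip_def algebra_simps)
qed

definition gather :: "'a \<times> 'a \<Rightarrow> 'a \<times> 'a" where "gather Z = flip (scatter (flip Z))"

lemma gather_scatter: "hit Z \<Longrightarrow> gather (scatter Z) = Z"
  by (simp add: gather_def flip_scatter_flip)

lemma hit_gather: "hit Z \<Longrightarrow> hit (gather Z)"
  by (simp add: gather_def flip_scatter_flip)

lemma scatter_gather: "hit Z \<Longrightarrow> scatter (gather Z) = Z"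
  using flip_scatter_flip(4)[of "flip Z"] by (simp add: gather_def) (metis flip_flip)

lemma inj_on_scatter: "inj_on scatter {Z. hit Z}"
  by (rule inj_on_inverseI[where g=gather]) (simp add: gather_scatter)

lemma e_scatter: "hit Z \<Longrightarrow> e (snd (scatter Z)) = e (snd Z)"
  by (simp add: scatter_def Let_def e_mirror norm_contact)

end

section \<open>The derivative of the scattering map\<close>

context cylinder
begin

lemma has_derivative_rel: "(rel has_derivative (\<lambda>d. l (fst d))) (at Z)"
  and has_derivative_rvel: "(rvel has_derivative (\<lambda>d. l (snd d))) (at Z)"
proof -
  have bl: "bounded_linear l"
    using linear_l by (simp add: linear_conv_bounded_linear)
  show "(rel has_derivative (\<lambda>d. l (fst d))) (at Z)" "(rvel has_derivative (\<lambda>d. l (snd d))) (at Z)"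
    unfolding rel_def rvel_def
    by (auto intro!: bounded_linear_imp_has_derivative bounded_linear_compose[OF bl] bounded_linear_fst bounded_linear_snd)
qed

text \<open>At contact \<open>disc\<close> is the square of \<open>rel Z \<bullet> rvel Z\<close>,
  which removes the root. Velocity variations drop out because no time is left for them to act; this
  is the origin of the zero block in the derivative of \<open>scatter\<close>.\<close>

lemma has_derivative_hit_time:
  assumes "norm (rel Z) = r" "rel Z \<bullet> rvel Z < 0"
  shows "(hit_time has_derivative (\<lambda>d. - (rel Z \<bullet> l (fst d)) / (rel Z \<bullet> rvel Z))) (at Z)"
proof -
  have h: "hit Z" "hit_time Z = 0"
    using hit_time_eqI[of 0 Z] assms by simp_all
  have x2: "rel Z \<bullet> rel Z = r\<^sup>2"
    using assms(1) by (metis dot_square_norm)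
  have D: "disc Z = (rel Z \<bullet> rvel Z)\<^sup>2"
    by (simp add: disc_def x2)
  have sD: "sqrt (disc Z) = - (rel Z \<bullet> rvel Z)"
    using assms(2) by (simp add: D)
  have c: "rvel Z \<bullet> rvel Z \<noteq> 0"
    using rvel_pos[OF h(1)] by simp
  define B where "B d = rel Z \<bullet> l (snd d) + l (fst d) \<bullet> rvel Z" for d
  define D' where "D' d = 2 * (rel Z \<bullet> rvel Z) * B d - (rvel Z \<bullet> rvel Z) * (2 * (rel Z \<bullet> l (fst d)))" for d
  have derB: "((\<lambda>Z. rel Z \<bullet> rvel Z) has_derivative B) (at Z)"
    unfolding B_def[abs_def]
    by (rule has_derivative_eq_rhs[OF has_derivative_inner[OF has_derivative_rel has_derivative_rvel]]) auto
  have derC: "((\<lambda>Z. rvel Z \<bullet> rvel Z) has_derivative (\<lambda>d. 2 * (rvel Z \<bullet> l (snd d)))) (at Z)"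
    by (rule has_derivative_eq_rhs[OF has_derivative_inner[OF has_derivative_rvel has_derivative_rvel]])
      (auto simp: inner_commute)
  have derA: "((\<lambda>Z. rel Z \<bullet> rel Z) has_derivative (\<lambda>d. 2 * (rel Z \<bullet> l (fst d)))) (at Z)"
    by (rule has_derivative_eq_rhs[OF has_derivative_inner[OF has_derivative_rel has_derivative_rel]])
      (auto simp: inner_commute)
  have derD: "(disc has_derivative D') (at Z)"
    unfolding disc_def[abs_def] D'_def[abs_def]
    by (rule derA derB derC derivative_eq_intros refl)+ (simp add: x2 mult_ac)
  have "((\<lambda>Z. sqrt (disc Z)) has_derivative (\<lambda>d. D' d * (inverse (sqrt (disc Z)) / 2))) (at Z)"
    using h(1) by (intro has_derivative_real_sqrt derD) (simp add: hit_def)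
  then have derS: "((\<lambda>Z. - (rel Z \<bullet> rvel Z) - sqrt (disc Z)) has_derivative
      (\<lambda>d. - B d - D' d * (inverse (sqrt (disc Z)) / 2))) (at Z)"
    by (intro has_derivative_diff has_derivative_minus derB)
  show ?thesis
    unfolding hit_time_def[abs_def]
    by (rule has_derivative_eq_rhs[OF has_derivative_divide'[OF derS derC c]])
      (use assms(2) c in \<open>auto simp: fun_eq_iff sD D'_def field_simps\<close>)
qed

lemma scatter_eq:
  "scatter Z = (let q = (rvel Z \<bullet> contact Z) / r\<^sup>2
     in (fst Z + (hit_time Z * q) *\<^sub>R j (contact Z), snd Z - q *\<^sub>R j (contact Z)))"
  by (simp add: scatter_def mirror_def Let_def rvel_def)

text \<open>The derivative of the hit time has \<open>x \<bullet> v\<close> in its denominator, the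
  velocity jump \<open>q\<close> has it as a factor. They cancel, and positions turn out to
  transform by the same mirror as velocities. All remaining terms involve the variation of the
  position alone and are collected in \<open>K\<close>.\<close>

lemma has_derivative_scatter_contact:
  assumes "norm (rel Z) = r" "rel Z \<bullet> rvel Z < 0"
  shows "\<exists>K. linear K \<and>
    (scatter has_derivative (\<lambda>d. (mirror (rel Z) (fst d), mirror (rel Z) (snd d) + K (fst d)))) (at Z)"
proof -
  define x where "x = rel Z"
  define v where "v = rvel Z"
  have h: "hit_time Z = 0"
    using hit_time_eqI[of 0 Z] assms by simp
  have c: "contact Z = x"
    by (simp add: contact_def h x_def)
  define T where "T d = - (x \<bullet> l (fst d)) / (x \<bullet> v)" for d :: "'a \<times> 'a"
  define C where "C d = l (fst d) + T d *\<^sub>R v" for d :: "'a \<times> 'a"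
  define Q where "Q d = (l (snd d) \<bullet> x + v \<bullet> C d) / r\<^sup>2" for d :: "'a \<times> 'a"
  define q where "q = (v \<bullet> x) / r\<^sup>2"
  define K where "K X = - ((v \<bullet> C (X, 0)) / r\<^sup>2) *\<^sub>R j x - q *\<^sub>R j (C (X, 0))" for X
  have derT: "(hit_time has_derivative T) (at Z)"
    unfolding T_def[abs_def] x_def v_def by (rule has_derivative_hit_time[OF assms])
  have derC: "(contact has_derivative C) (at Z)"
    unfolding contact_def[abs_def] C_def[abs_def]
    by (rule derivative_eq_intros has_derivative_rel has_derivative_rvel derT refl)+ (simp add: h v_def)
  have "((\<lambda>Z. (rvel Z \<bullet> contact Z) / r\<^sup>2) has_derivative Q) (at Z)"
    unfolding Q_def[abs_def]
    by (rule derivative_eq_intros has_derivative_rvel derC refl)+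
      (use r_pos in \<open>auto simp: c v_def power2_eq_square field_simps inner_commute\<close>)
  note derQ = this
  have bj: "bounded_linear j"
    using linear_j by (simp add: linear_conv_bounded_linear)
  have derJ: "((\<lambda>Z. j (contact Z)) has_derivative (\<lambda>d. j (C d))) (at Z)"
    by (rule bounded_linear.has_derivative[OF bj derC])
  have der1: "((\<lambda>Z. fst Z + (hit_time Z * ((rvel Z \<bullet> contact Z) / r\<^sup>2)) *\<^sub>R j (contact Z))
      has_derivative (\<lambda>d. fst d + (T d * q) *\<^sub>R j x)) (at Z)"
    by (rule derivative_eq_intros derQ derJ derT refl)+ (simp add: h c q_def v_def)
  have der2: "((\<lambda>Z. snd Z - ((rvel Z \<bullet> contact Z) / r\<^sup>2) *\<^sub>R j (contact Z))
      has_derivative (\<lambda>d. snd d - (q *\<^sub>R j (C d) + Q d *\<^sub>R j x))) (at Z)"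
    by (rule derivative_eq_intros derQ derJ refl)+ (simp add: c q_def v_def)
  have der: "(scatter has_derivative (\<lambda>d. (fst d + (T d * q) *\<^sub>R j x, snd d - (q *\<^sub>R j (C d) + Q d *\<^sub>R j x)))) (at Z)"
    unfolding scatter_eq[abs_def] Let_def by (rule has_derivative_Pair[OF der1 der2])
  have linT: "T (X + Y, 0) = T (X, 0) + T (Y, 0)" "T (k *\<^sub>R X, 0) = k * T (X, 0)" for X Y k
    by (simp_all add: T_def l_simps inner_add_right add_divide_distrib diff_divide_distrib)
  have linC: "C (X + Y, 0) = C (X, 0) + C (Y, 0)" "C (k *\<^sub>R X, 0) = k *\<^sub>R C (X, 0)" for X Y k
    by (simp_all add: C_def linT l_simps algebra_simps)
  have "linear K"
    by (rule linearI) (simp_all add: K_def linC j_simps inner_add_right add_divide_distrib algebra_simps)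
  moreover have "(\<lambda>d. (fst d + (T d * q) *\<^sub>R j x, snd d - (q *\<^sub>R j (C d) + Q d *\<^sub>R j x)))
      = (\<lambda>d. (mirror x (fst d), mirror x (snd d) + K (fst d)))"
  proof (rule ext)
    fix d :: "'a \<times> 'a"
    have 1: "T d * q = - ((l (fst d) \<bullet> x) / r\<^sup>2)"
      using assms(2) by (simp add: T_def q_def x_def v_def inner_commute field_simps)
    have 2: "C d = C (fst d, 0)"
      by (simp add: C_def T_def)
    have 3: "Q d = (l (snd d) \<bullet> x) / r\<^sup>2 + (v \<bullet> C (fst d, 0)) / r\<^sup>2"
      by (simp add: Q_def 2[symmetric] add_divide_distrib)
    show "(fst d + (T d * q) *\<^sub>R j x, snd d - (q *\<^sub>R j (C d) + Q d *\<^sub>R j x))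
      = (mirror x (fst d), mirror x (snd d) + K (fst d))"
      unfolding 1 3 2 by (simp add: mirror_def K_def algebra_simps)
  qed
  ultimately show ?thesis
    using der unfolding x_def by auto
qed

text \<open>The map is the involution reflecting both components, followed by the shear
  \<open>S\<close>, which reversing velocities inverts. The \<open>mirror w\<close> inside
  \<open>S\<close> undoes the reflection of the position that has already taken place.\<close>

lemma jacobian_reflect_shear:
  assumes "norm w = r" "linear K"
  shows "jacobian (\<lambda>d. (mirror w (fst d), mirror w (snd d) + K (fst d))) = 1"
proof -
  have lin: "linear (\<lambda>d. (mirror w (fst d), mirror w (snd d)))"
    by (rule linearI) (simp_all add: linear_add[OF linear_mirror] linear_cmul[OF linear_mirror])
  define S where "S d = (fst d, snd d + K (mirror w (fst d)))" for d
  have linS: "linear S"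
    by (rule linearI)
      (simp_all add: S_def linear_add[OF linear_mirror] linear_cmul[OF linear_mirror]
        linear_add[OF assms(2)] linear_cmul[OF assms(2)] algebra_simps)
  have "jacobian S = 1"
    by (rule jacobian_reversible[OF linS linear_flip]) (simp_all add: S_def flip_def)
  moreover have "jacobian (\<lambda>d. (mirror w (fst d), mirror w (snd d))) = 1"
    by (rule jacobian_involution[OF lin]) (simp add: mirror_mirror[OF assms(1)])
  moreover have "(\<lambda>d. (mirror w (fst d), mirror w (snd d) + K (fst d)))
      = (\<lambda>d. S (mirror w (fst d), mirror w (snd d)))"
    by (simp add: S_def mirror_mirror[OF assms(1)])
  ultimately show ?thesis
    using jacobian_compose[OF lin linS] by simp
qed

lemma continuous_on_rel: "continuous_on S rel" and continuous_on_rvel: "continuous_on S rvel"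
  by (meson has_derivative_continuous has_derivative_rel has_derivative_rvel continuous_at_imp_continuous_on)+

lemma continuous_on_disc: "continuous_on S disc"
  unfolding disc_def[abs_def] by (intro continuous_intros continuous_on_rel continuous_on_rvel)

lemma open_hit: "open {Z. hit Z}"
  unfolding hit_def by (intro open_Collect_less continuous_intros continuous_on_disc)

text \<open>
  The scattering map commutes with the drift, so its Jacobian is constant along lines and can be
  read off at the moment of contact, where it is block triangular with the same reflection twice
  on the diagonal.
\<close>

lemma measure_preserving_scatter: "measure_preserving_on scatter {Z. hit Z}"
proof -
  have "\<exists>L. (scatter has_derivative L) (at Z) \<and> jacobian L = 1" if Z: "hit Z" for Z
  proof -
    define s where "s = hit_time Z"
    have rs: "rel (drift s Z) = contact Z"
      by (simp add: contact_def s_def)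
    have "norm (rel (drift s Z)) = r" "rel (drift s Z) \<bullet> rvel (drift s Z) < 0"
      unfolding rs using norm_contact[OF Z] contact_inner_rvel_neg[OF Z] by simp_all
    from has_derivative_scatter_contact[OF this] obtain K
      where K: "linear K" and der: "(scatter has_derivative
        (\<lambda>d. (mirror (contact Z) (fst d), mirror (contact Z) (snd d) + K (fst d)))) (at (drift s Z))"
      unfolding rs by blast
    define L where "L d = (mirror (contact Z) (fst d), mirror (contact Z) (snd d) + K (fst d))" for d
    have der: "(scatter has_derivative L) (at (drift s Z))"
      using der by (simp add: L_def[abs_def])
    have linL: "linear L"
      using der by (simp add: has_derivative_linear)
    have bd: "(drift t has_derivative drift t) (at Y)" for t and Y :: "'a \<times> 'a"
      by (intro bounded_linear_imp_has_derivative) (simp add: linear_drift linear_linear)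
    have "((\<lambda>Y. drift (- s) (scatter (drift s Y))) has_derivative (\<lambda>d. drift (- s) (L (drift s d)))) (at Z)"
      by (rule has_derivative_compose[OF has_derivative_compose[OF bd der] bd])
    then have "(scatter has_derivative (\<lambda>d. drift (- s) (L (drift s d)))) (at Z)"
      by (rule has_derivative_transform_within_open[OF _ open_hit]) (use Z in \<open>auto simp: scatter_drift\<close>)
    moreover have "jacobian (\<lambda>d. drift (- s) (L (drift s d))) = 1"
    proof -
      have "jacobian L = 1"
        unfolding L_def[abs_def] by (rule jacobian_reflect_shear[OF norm_contact[OF Z] K])
      moreover have "linear (\<lambda>d. L (drift s d))"
        using linear_compose[OF linear_drift linL] by (simp add: o_def)
      ultimately show ?thesis
        using jacobian_compose[of "\<lambda>d. L (drift s d)" "drift (- s)", OF _ linear_drift]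
          jacobian_compose[of "drift s" L, OF linear_drift linL] jacobian_drift
        by (metis mult_1)
    qed
    ultimately show ?thesis
      by blast
  qed
  then obtain L where "\<And>Z. hit Z \<Longrightarrow> (scatter has_derivative L Z) (at Z)" "\<And>Z. hit Z \<Longrightarrow> jacobian (L Z) = 1"
    by metis
  then show ?thesis
    using open_hit inj_on_scatter by (intro measure_preserving_on_jacobian[where f'=L]) auto
qed

lemma measure_preserving_gather: "measure_preserving_on gather {Z. hit Z}"
proof -
  have "measure_preserving_on (\<lambda>Z. scatter (flip Z)) {Z. hit Z}"
    by (rule measure_preserving_on_compose[OF measure_preserving_flip measure_preserving_scatter]) auto
  then have "measure_preserving_on (\<lambda>Z. flip (scatter (flip Z))) {Z. hit Z}"
    by (rule measure_preserving_on_compose[OF _ measure_preserving_flip subset_UNIV])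
  then show ?thesis
    by (simp add: gather_def[abs_def])
qed

end

section \<open>The two-body flow\<close>

context cylinder
begin

text \<open>At contact only the outgoing state is kept, so that \<open>flow\<close> below is a group action.\<close>

definition legal :: "'a \<times> 'a \<Rightarrow> bool" where
  "legal Z \<longleftrightarrow> (norm (rel Z) > r \<or> norm (rel Z) = r \<and> rel Z \<bullet> rvel Z > 0) \<and> (disc Z = 0 \<longrightarrow> rvel Z = 0)"

text \<open>A trajectory is encoded by its incoming line, continued straight through the scatterer;
  \<open>collide\<close> reads off the actual state. The non-strict inequality puts the moment of
  contact on the outgoing side.\<close>

definition collide :: "'a \<times> 'a \<Rightarrow> 'a \<times> 'a" where
  "collide Z = (if hit Z \<and> hit_time Z \<le> 0 then scatter Z else Z)"

definition uncollide :: "'a \<times> 'a \<Rightarrow> 'a \<times> 'a" where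
  "uncollide Z = (if hit Z \<and> rel Z \<bullet> rvel Z > 0 then gather Z else Z)"

definition flow :: "real \<Rightarrow> 'a \<times> 'a \<Rightarrow> 'a \<times> 'a" where
  "flow t Z = collide (drift t (uncollide Z))"

lemma outside_iff: "norm (rel Z) > r \<longleftrightarrow> rel Z \<bullet> rel Z > r\<^sup>2"
  using r_pos by (metis dot_square_norm norm_ge_zero abs_of_nonneg abs_square_less_1 order_less_imp_le power2_less_imp_less power_strict_mono pos2)

lemma rel_eq: "rel Z = contact Z - hit_time Z *\<^sub>R rvel Z"
  by (simp add: contact_def)

lemma before_hit:
  assumes "hit Z" "hit_time Z > 0"
  shows "norm (rel Z) > r" "rel Z \<bullet> rvel Z < 0"
proof -
  let ?t = "hit_time Z"
  have c: "contact Z \<bullet> rvel Z < 0" "contact Z \<bullet> contact Z = r\<^sup>2" "rvel Z \<bullet> rvel Z > 0"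
    using assms contact_inner_rvel_neg contact_inner_contact rvel_pos by auto
  have "rel Z \<bullet> rvel Z = contact Z \<bullet> rvel Z - ?t * (rvel Z \<bullet> rvel Z)"
    by (subst rel_eq) (simp add: inner_diff_left)
  then show "rel Z \<bullet> rvel Z < 0"
    using c assms(2) mult_pos_pos[OF assms(2) c(3)] by linarith
  have "rel Z \<bullet> rel Z = r\<^sup>2 - 2 * ?t * (contact Z \<bullet> rvel Z) + ?t\<^sup>2 * (rvel Z \<bullet> rvel Z)"
    by (subst (1 2) rel_eq) (simp add: inner_diff_left inner_diff_right inner_commute c power2_eq_square algebra_simps)
  moreover have "?t * (contact Z \<bullet> rvel Z) < 0" "?t\<^sup>2 * (rvel Z \<bullet> rvel Z) > 0"
    using c assms by (auto simp: mult_pos_neg)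
  ultimately show "norm (rel Z) > r"
    unfolding outside_iff by linarith
qed

text \<open>A vanishing inner product with nonzero relative velocity marks the point of the line
  nearest to the axis. If that point is not inside the scatterer, the line does not cross
  it.\<close>

lemma hit_not_tangential:
  assumes "hit Z" "norm (rel Z) \<ge> r"
  shows "rel Z \<bullet> rvel Z \<noteq> 0"
proof
  assume 0: "rel Z \<bullet> rvel Z = 0"
  have "rel Z \<bullet> rel Z \<ge> r\<^sup>2"
    using assms(2) r_pos by (metis dot_square_norm less_eq_real_def power_mono)
  then have "(rvel Z \<bullet> rvel Z) * (rel Z \<bullet> rel Z - r\<^sup>2) \<ge> 0"
    by (intro mult_nonneg_nonneg) auto
  then show False
    using assms(1) 0 by (simp add: hit_def disc_def)
qed

text \<open>Outside the sphere \<open>disc Z\<close> is smaller than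
  \<open>(rel Z \<bullet> rvel Z)\<^sup>2\<close>, so its root cannot outweigh the positive first
  term of the numerator.\<close>

lemma hit_time_pos:
  assumes "hit Z" "norm (rel Z) > r" "rel Z \<bullet> rvel Z < 0"
  shows "hit_time Z > 0"
proof -
  have "(rvel Z \<bullet> rvel Z) * (rel Z \<bullet> rel Z - r\<^sup>2) > 0"
    using assms(2) rvel_pos[OF assms(1)] by (simp add: outside_iff)
  then have "disc Z < (rel Z \<bullet> rvel Z)\<^sup>2"
    by (simp add: disc_def)
  then have "sqrt (disc Z) < \<bar>rel Z \<bullet> rvel Z\<bar>"
    by (metis real_sqrt_abs real_sqrt_less_iff)
  then show ?thesis
    using rvel_pos[OF assms(1)] assms(3) by (simp add: hit_time_def)
qed

lemma hit_time_flip_nonneg: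
  assumes "legal Z" "rel Z \<bullet> rvel Z > 0" "hit Z"
  shows "hit_time (flip Z) \<ge> 0"
proof (cases "norm (rel Z) = r")
  case True
  then have "hit_time (flip Z) = 0"
    using assms(2) by (intro hit_time_eqI) auto
  then show ?thesis by simp
next
  case False
  then have "hit_time (flip Z) > 0"
    using assms by (intro hit_time_pos) (auto simp: legal_def)
  then show ?thesis by simp
qed

text \<open>Time reversal of \<open>before_hit\<close>, except at the moment of contact, which is
  read off from \<open>scatter_contact\<close>.\<close>

lemma after_hit:
  assumes "hit Z" "hit_time Z \<le> 0"
  shows "rel (scatter Z) \<bullet> rvel (scatter Z) > 0"
    "norm (rel (scatter Z)) \<ge> r" "hit_time Z < 0 \<Longrightarrow> norm (rel (scatter Z)) > r"
proof -
  have neg: "norm (rel (scatter Z)) > r \<and> rel (scatter Z) \<bullet> rvel (scatter Z) > 0" if "hit_time Z < 0"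
    using before_hit[of "flip (scatter Z)"] flip_scatter_flip[OF assms(1)] that by simp
  have zero: "rel (scatter Z) = contact Z" if "hit_time Z = 0"
    using scatter_contact(1)[OF assms(1)] that by simp
  show "norm (rel (scatter Z)) > r" if "hit_time Z < 0"
    using neg that by blast
  show "rel (scatter Z) \<bullet> rvel (scatter Z) > 0"
    using neg zero assms(2) scatter_contact(2)[OF assms(1)] contact_inner_rvel_neg[OF assms(1)]
    by (cases "hit_time Z = 0") auto
  show "norm (rel (scatter Z)) \<ge> r"
    using neg zero assms(2) norm_contact[OF assms(1)] by (cases "hit_time Z = 0") auto
qed

lemma hit_collide [simp]: "hit (collide Z) = hit Z"
  by (simp add: collide_def flip_scatter_flip)

lemma hit_uncollide [simp]: "hit (uncollide Z) = hit Z"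
  by (simp add: uncollide_def hit_gather)

text \<open>The sign of \<open>rel Z \<bullet> rvel Z\<close> reveals what \<open>collide\<close>
  has done: it is positive after a collision and negative while one is still ahead. Legality does
  not enter, so the composition law \<open>flow_flow\<close> is unconditional.\<close>

lemma uncollide_collide: "uncollide (collide Z) = Z"
proof (cases "hit Z \<and> hit_time Z \<le> 0")
  case True
  then show ?thesis
    using after_hit(1)[of Z] by (simp add: collide_def uncollide_def flip_scatter_flip gather_scatter)
next
  case False
  then show ?thesis
    using before_hit(2)[of Z] by (auto simp: collide_def uncollide_def)
qed

lemma legal_collide: "hit Z \<Longrightarrow> legal (collide Z)"
  using after_hit[of Z] before_hit[of Z] flip_scatter_flip(1)[of Z]
  by (auto simp: collide_def legal_def hit_def less_le)

lemma hit_time_gather: "hit Z \<Longrightarrow> hit_time (gather Z) = - hit_time (flip Z)"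
  using flip_scatter_flip(2)[of "flip Z"] by (simp add: gather_def)

lemma collide_uncollide:
  assumes "legal Z"
  shows "collide (uncollide Z) = Z"
proof (cases "hit Z \<and> rel Z \<bullet> rvel Z > 0")
  case True
  then show ?thesis
    using hit_time_flip_nonneg[OF assms]
    by (simp add: collide_def uncollide_def hit_gather scatter_gather hit_time_gather)
next
  case False
  then have "hit_time Z > 0" if "hit Z"
    using assms that hit_not_tangential[OF that] by (intro hit_time_pos) (auto simp: legal_def)
  then show ?thesis
    using False by (auto simp: collide_def uncollide_def)
qed

text \<open>For a legal state without a hit either \<open>disc\<close> is negative, which keeps the
  whole line outside, or the relative position does not change at all.\<close>

lemma legal_not_hit:
  assumes "legal Z" "\<not> hit Z"
  shows "legal (drift t Z)" "norm (rel (drift t Z)) > r"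
proof -
  show *: "norm (rel (drift t Z)) > r"
  proof (cases "rvel Z = 0")
    case True
    then show ?thesis
      using assms(1) by (simp add: legal_def)
  next
    case False
    then have "disc (drift t Z) < 0"
      using assms by (auto simp: legal_def hit_def)
    then have "(rvel Z \<bullet> rvel Z) * (rel (drift t Z) \<bullet> rel (drift t Z) - r\<^sup>2) > 0"
      unfolding disc_def[of "drift t Z"] rvel_drift
      using zero_le_power2[of "rel (drift t Z) \<bullet> rvel Z"] by linarith
    moreover have "rvel Z \<bullet> rvel Z > 0"
      using False by simp
    ultimately show ?thesis
      unfolding outside_iff using zero_less_mult_pos by force
  qed
  then show "legal (drift t Z)"
    using assms(1) by (simp add: legal_def)
qed

lemma flow_not_hit: "\<not> hit Z \<Longrightarrow> flow t Z = drift t Z"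
  by (simp add: flow_def collide_def uncollide_def)

lemma flow_0: "legal Z \<Longrightarrow> flow 0 Z = Z"
  by (simp add: flow_def collide_uncollide)

lemma flow_flow: "flow s (flow t Z) = flow (s + t) Z"
  by (simp add: flow_def uncollide_collide)

lemma legal_flow:
  assumes "legal Z"
  shows "legal (flow t Z)"
proof (cases "hit Z")
  case True
  then show ?thesis by (simp add: flow_def legal_collide)
next
  case False
  then show ?thesis
    using legal_not_hit[OF assms False] by (simp add: flow_not_hit)
qed

lemma inj_on_flow: "inj_on (flow t) {Z. legal Z}"
  by (rule inj_on_inverseI[where g="flow (- t)"]) (simp add: flow_flow flow_0)

lemma e_gather: "hit Z \<Longrightarrow> e (snd (gather Z)) = e (snd Z)"
  using e_scatter[of "gather Z"] by (simp add: hit_gather scatter_gather)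

lemma e_flow: "e (snd (flow t Z)) = e (snd Z)"
  by (simp add: flow_def collide_def uncollide_def e_scatter e_gather hit_gather)

lemma uncollide_cases:
  assumes "legal Z" "hit Z"
  obtains (before) "rel Z \<bullet> rvel Z < 0" "uncollide Z = Z" "hit_time Z > 0"
  | (after) "rel Z \<bullet> rvel Z > 0" "uncollide Z = gather Z" "hit_time (gather Z) \<le> 0"
proof (cases "rel Z \<bullet> rvel Z > 0")
  case True
  then show ?thesis
    using after hit_time_flip_nonneg[OF assms(1)] assms(2) by (simp add: uncollide_def hit_time_gather)
next
  case False
  then have "hit_time Z > 0" "rel Z \<bullet> rvel Z < 0"
    using assms hit_not_tangential[OF assms(2)] hit_time_pos[OF assms(2)] by (auto simp: legal_def)
  then show ?thesis
    using before by (simp add: uncollide_def)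
qed

lemma rel_drift_hit_time: "rel (drift (hit_time Z) Z) = contact Z"
  by (simp add: contact_def)

lemma contact_gather:
  assumes "hit Z"
  shows "rel (drift (hit_time (gather Z)) Z) = contact (gather Z)"
  using scatter_contact(1)[OF hit_gather[OF assms]] by (simp add: scatter_gather[OF assms])

lemma flow_eq_drift:
  assumes Z: "legal Z" and free: "\<And>s. s \<in> closed_segment 0 t \<Longrightarrow> norm (rel (drift s Z)) > r"
  shows "flow t Z = drift t Z"
proof (cases "hit Z")
  case False
  then show ?thesis by (rule flow_not_hit)
next
  case True
  from Z True show ?thesis
  proof (cases rule: uncollide_cases)
    case before
    have "hit_time Z \<notin> closed_segment 0 t"
      using free[of "hit_time Z"] norm_contact[OF True] by (auto simp: rel_drift_hit_time simp del: rel_drift)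
    then have "hit_time Z > t"
      using before by (auto simp: closed_segment_eq_real_ivl split: if_splits)
    then show ?thesis
      using True before by (simp add: flow_def collide_def)
  next
    case after
    have "hit_time (gather Z) \<notin> closed_segment 0 t"
      using free[of "hit_time (gather Z)"] norm_contact[OF hit_gather[OF True]]
      by (auto simp: contact_gather[OF True] simp del: rel_drift)
    then have "hit_time (gather Z) < t"
      using after by (auto simp: closed_segment_eq_real_ivl split: if_splits)
    then show ?thesis
      using True after by (simp add: flow_def collide_def hit_gather scatter_drift scatter_gather)
  qed
qed

text \<open>Up to and including the first contact the positions are those of free motion, although
  at contact the velocity may already have jumped. Positions are all that the other scatterers
  see.\<close>

lemma first_contact:
  assumes Z: "legal Z"
  obtains (free) "\<And>s. s \<in> closed_segment 0 t \<Longrightarrow> norm (rel (drift s Z)) > r"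
  | (contact) c where "c \<in> closed_segment 0 t" "norm (rel (drift c Z)) = r"
      "\<And>s. s \<in> closed_segment 0 c \<Longrightarrow> fst (flow s Z) = fst (drift s Z)"
proof (cases "hit Z")
  case False
  then show ?thesis using free legal_not_hit(2)[OF Z False] by blast
next
  case True
  from Z True show ?thesis
  proof (cases rule: uncollide_cases)
    case before
    have fl: "flow s Z = drift s Z \<and> norm (rel (drift s Z)) > r" if "s < hit_time Z" for s
      using that True before before_hit(1)[of "drift s Z"] by (simp add: flow_def collide_def)
    show ?thesis
    proof (cases "hit_time Z \<le> t")
      case le: True
      \<comment> \<open>At contact the remaining hit time is 0, so \<open>scatter\<close> changes
        the velocity but not the position.\<close>
      have "fst (flow (hit_time Z) Z) = fst (drift (hit_time Z) Z)"
        using True before by (simp add: flow_def collide_def) (simp add: scatter_def Let_def)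
      then have "fst (flow s Z) = fst (drift s Z)" if "s \<in> closed_segment 0 (hit_time Z)" for s
        using that before fl[of s] by (cases "s = hit_time Z") (auto simp: closed_segment_eq_real_ivl)
      moreover have "norm (rel (drift (hit_time Z) Z)) = r"
        unfolding rel_drift_hit_time by (rule norm_contact[OF True])
      ultimately show ?thesis
        using contact[of "hit_time Z"] le before by (auto simp: closed_segment_eq_real_ivl)
    next
      case False
      then have "norm (rel (drift s Z)) > r" if "s \<in> closed_segment 0 t" for s
        using that fl[of s] before by (auto simp: closed_segment_eq_real_ivl split: if_splits)
      then show ?thesis
        by (rule free)
    qed
  next
    case after
    define c where "c = hit_time (gather Z)"
    have fl: "flow s Z = drift s Z \<and> (c < s \<longrightarrow> norm (rel (drift s Z)) > r)" if "c \<le> s" for s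
      using that True after after_hit(3)[of "drift s (gather Z)"]
      by (simp add: flow_def collide_def c_def hit_gather scatter_drift scatter_gather)
    have "norm (rel (drift c Z)) = r"
      unfolding c_def contact_gather[OF True] by (rule norm_contact[OF hit_gather[OF True]])
    moreover have "fst (flow s Z) = fst (drift s Z)" if "s \<in> closed_segment 0 c" for s
      using that fl[of s] after by (auto simp: closed_segment_eq_real_ivl c_def split: if_splits)
    ultimately show ?thesis
    proof (cases "c \<in> closed_segment 0 t")
      case False
      then have "norm (rel (drift s Z)) > r" if "s \<in> closed_segment 0 t" for s
        using that fl[of s] after by (auto simp: closed_segment_eq_real_ivl c_def split: if_splits)
      then show ?thesis
        by (rule free)
    qed (rule contact)
  qed
qed

text \<open>The path is a broken line with at most one kink, and both of its velocities have the
  same \<open>e\<close>, which dominates their norms.\<close>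

lemma flow_displacement:
  assumes Z: "legal Z"
  shows "norm (fst (flow t Z) - fst Z) \<le> \<bar>t\<bar> * e (snd Z)"
proof -
  have e0: "e V \<ge> 0" for V
    using norm_le_e[of V] norm_ge_zero[of V] by linarith
  have bound: "norm (a *\<^sub>R U + b *\<^sub>R W) \<le> \<bar>t\<bar> * e (snd Z)"
    if "e U = e (snd Z)" "e W = e (snd Z)" "\<bar>a\<bar> + \<bar>b\<bar> \<le> \<bar>t\<bar>" for a b U W
  proof -
    have "norm (a *\<^sub>R U + b *\<^sub>R W) \<le> \<bar>a\<bar> * norm U + \<bar>b\<bar> * norm W"
      by (rule order_trans[OF norm_triangle_ineq]) simp
    also have "\<dots> \<le> \<bar>a\<bar> * e (snd Z) + \<bar>b\<bar> * e (snd Z)"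
      using norm_le_e[of U] norm_le_e[of W] that by (intro add_mono mult_left_mono) auto
    also have "\<dots> = (\<bar>a\<bar> + \<bar>b\<bar>) * e (snd Z)"
      by (simp add: algebra_simps)
    also have "\<dots> \<le> \<bar>t\<bar> * e (snd Z)"
      using that e0 by (intro mult_right_mono) auto
    finally show ?thesis .
  qed
  have free: ?thesis if "flow t Z = drift t Z"
    using bound[of "snd Z" "snd Z" t 0] that by simp
  show ?thesis
  proof (cases "hit Z")
    case False
    then show ?thesis by (intro free flow_not_hit)
  next
    case True
    from Z True show ?thesis
    proof (cases rule: uncollide_cases)
      case before
      show ?thesis
      proof (cases "hit_time Z \<le> t")
        case le: True
        have "fst (flow t Z) - fst Z = hit_time Z *\<^sub>R snd Z + (t - hit_time Z) *\<^sub>R snd (scatter Z)"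
          using le True before
          by (simp add: flow_def collide_def scatter_drift) (simp add: scatter_def Let_def algebra_simps)
        then show ?thesis
          using bound[of "snd Z" "snd (scatter Z)" "hit_time Z" "t - hit_time Z"] e_scatter[OF True] le before
          by simp
      next
        case False
        then show ?thesis
          using True before by (intro free) (simp add: flow_def collide_def)
      qed
    next
      case after
      note h = hit_gather[OF True]
      define c where "c = hit_time (gather Z)"
      show ?thesis
      proof (cases "c \<le> t")
        case le: True
        then show ?thesis
          using True after
          by (intro free) (simp add: flow_def collide_def c_def h scatter_drift scatter_gather)
      next
        case False
        have "fst Z = fst (scatter (gather Z))" "snd Z = snd (scatter (gather Z))"
          using scatter_gather[OF True] by simp_all
        then have "fst Z = fst (gather Z) + c *\<^sub>R (snd (gather Z) - snd Z)"
          by (simp add: scatter_def[of "gather Z"] Let_def c_def)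
        then have "fst (flow t Z) - fst Z = (t - c) *\<^sub>R snd (gather Z) + c *\<^sub>R snd Z"
          using False True after h by (simp add: flow_def collide_def c_def algebra_simps)
        then show ?thesis
          using bound[of "snd (gather Z)" "snd Z" "t - c" c] e_gather[OF True] False after by (simp add: c_def)
      qed
    qed
  qed
qed

text \<open>Supplies the one-sided limits at a collision: just before contact the path lies on the
  line with the mirrored velocity.\<close>

lemma flow_at_contact:
  assumes "legal Z" "norm (rel Z) = r"
  shows "t \<ge> 0 \<Longrightarrow> flow t Z = drift t Z"
    and "t < 0 \<Longrightarrow> flow t Z = drift t (fst Z, mirror (rel Z) (snd Z))"
proof -
  have out: "rel Z \<bullet> rvel Z > 0"
    using assms by (simp add: legal_def)
  have f: "hit (flip Z)" "hit_time (flip Z) = 0"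
    using hit_time_eqI[of 0 "flip Z"] assms(2) out by simp_all
  then have h: "hit Z"
    by simp
  have t0: "hit_time (gather Z) = 0"
    using hit_time_gather[OF h] f by simp
  have g: "gather Z = (fst Z, mirror (rel Z) (snd Z))"
    by (simp add: gather_def scatter_def Let_def contact_def f(2) flip_def[of "(_, _)"] linear_neg[OF linear_mirror])
  have u: "uncollide Z = gather Z"
    using out h by (simp add: uncollide_def)
  show "flow t Z = drift t Z" if "t \<ge> 0"
    using that h by (simp add: flow_def u collide_def hit_gather t0 scatter_drift scatter_gather)
  show "flow t Z = drift t (fst Z, mirror (rel Z) (snd Z))" if "t < 0"
    using that h by (simp add: flow_def u collide_def hit_gather t0 g[symmetric])
qed

section \<open>Measurability and volume preservation of the two-body flow\<close>

lemma measurable_rel [measurable]: "rel \<in> borel_measurable borel"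
  and measurable_rvel [measurable]: "rvel \<in> borel_measurable borel"
  and measurable_disc [measurable]: "disc \<in> borel_measurable borel"
  by (intro borel_measurable_continuous_onI continuous_on_rel continuous_on_rvel continuous_on_disc)+

lemma measurable_hit_time [measurable]: "hit_time \<in> borel_measurable borel"
  unfolding hit_time_def[abs_def] by measurable

lemma sets_legal [measurable]: "{Z. legal Z} \<in> sets borel"
  unfolding legal_def by measurable

lemma measure_preserving_collide: "measure_preserving_on collide {Z. hit Z}"
proof -
  have "measure_preserving_on collide ({Z. hit Z \<and> hit_time Z \<le> 0} \<union> {Z. hit Z \<and> \<not> hit_time Z \<le> 0})"
  proof (rule measure_preserving_on_Un)
    show "measure_preserving_on collide {Z. hit Z \<and> hit_time Z \<le> 0}"
      by (rule measure_preserving_on_cong[OF measure_preserving_on_subset[OF measure_preserving_scatter]])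
        (auto simp: collide_def)
    show "measure_preserving_on collide {Z. hit Z \<and> \<not> hit_time Z \<le> 0}"
      by (rule measure_preserving_on_cong[OF measure_preserving_on_id]) (auto simp: collide_def)
    have "{Z. hit Z \<and> hit_time Z \<le> 0} \<in> sets borel"
      unfolding hit_def by measurable
    then show "{Z. hit Z \<and> hit_time Z \<le> 0} \<in> sets lebesgue"
      by simp
    show "inj_on collide ({Z. hit Z \<and> hit_time Z \<le> 0} \<union> {Z. hit Z \<and> \<not> hit_time Z \<le> 0})"
      by (rule inj_on_inverseI[where g=uncollide]) (simp add: uncollide_collide)
  qed
  then show ?thesis
    by (rule measure_preserving_on_subset) auto
qed

lemma measure_preserving_uncollide: "measure_preserving_on uncollide {Z. legal Z \<and> hit Z}"
proof -
  let ?A = "{Z. (legal Z \<and> hit Z) \<and> rel Z \<bullet> rvel Z > 0}" and ?B = "{Z. (legal Z \<and> hit Z) \<and> \<not> rel Z \<bullet> rvel Z > 0}"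
  have "measure_preserving_on uncollide (?A \<union> ?B)"
  proof (rule measure_preserving_on_Un)
    show "measure_preserving_on uncollide ?A"
      by (rule measure_preserving_on_cong[OF measure_preserving_on_subset[OF measure_preserving_gather]])
        (auto simp: uncollide_def)
    show "measure_preserving_on uncollide ?B"
      by (rule measure_preserving_on_cong[OF measure_preserving_on_id]) (auto simp: uncollide_def)
    have "?A \<in> sets borel"
      unfolding hit_def legal_def by measurable
    then show "?A \<in> sets lebesgue"
      by simp
    show "inj_on uncollide (?A \<union> ?B)"
      by (rule inj_on_inverseI[where g=collide]) (auto simp: collide_uncollide)
  qed
  then show ?thesis
    by (rule measure_preserving_on_subset) auto
qed

lemma measure_preserving_flow: "measure_preserving_on (flow t) {Z. legal Z}"
proof -
  have "measure_preserving_on (\<lambda>Z. drift t (uncollide Z)) {Z. legal Z \<and> hit Z}"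
    by (rule measure_preserving_on_compose[OF measure_preserving_uncollide measure_preserving_drift subset_UNIV])
  then have "measure_preserving_on (\<lambda>Z. collide (drift t (uncollide Z))) {Z. legal Z \<and> hit Z}"
    by (rule measure_preserving_on_compose[OF _ measure_preserving_collide]) auto
  then have 1: "measure_preserving_on (flow t) {Z. legal Z \<and> hit Z}"
    by (simp add: flow_def[abs_def])
  have 2: "measure_preserving_on (flow t) {Z. legal Z \<and> \<not> hit Z}"
    by (rule measure_preserving_on_cong[OF measure_preserving_drift]) (auto simp: flow_not_hit)
  have "{Z. legal Z \<and> hit Z} \<in> sets borel"
    unfolding hit_def legal_def by measurable
  then have "measure_preserving_on (flow t) ({Z. legal Z \<and> hit Z} \<union> {Z. legal Z \<and> \<not> hit Z})"
    by (intro measure_preserving_on_Un 1 2 inj_on_subset[OF inj_on_flow]) auto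
  then show ?thesis
    by (rule measure_preserving_on_subset) auto
qed

end

section \<open>Several scatterers\<close>

text \<open>\<open>independent\<close> makes simultaneous contact with two scatterers a condition of
  codimension two: one relative position can be shifted while the other stays fixed.
  \<open>norm_l\<close> converts displacements in the position space into changes of distance from a
  scatterer.\<close>

locale billiard =
  fixes P :: "'i set" and l :: "'i \<Rightarrow> 'a::euclidean_space \<Rightarrow> 'b::euclidean_space"
    and j :: "'i \<Rightarrow> 'b \<Rightarrow> 'a" and r :: "'i \<Rightarrow> real" and e :: "'a \<Rightarrow> real"
  assumes finite_P: "finite P" and P_nonempty: "P \<noteq> {}"
    and cylinder: "i \<in> P \<Longrightarrow> cylinder (l i) (j i) (r i) e"
    and independent: "i \<in> P \<Longrightarrow> k \<in> P \<Longrightarrow> i \<noteq> k \<Longrightarrow>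
      \<exists>h. linear h \<and> (\<forall>y. l i (h y) = y) \<and> (\<forall>y. l k (h y) = 0)"
    and norm_l: "i \<in> P \<Longrightarrow> norm (l i X) \<le> 2 * norm X"
    and continuous_e: "continuous_on UNIV e"
begin

abbreviation flow :: "'i \<Rightarrow> real \<Rightarrow> 'a \<times> 'a \<Rightarrow> 'a \<times> 'a" where
  "flow i \<equiv> cylinder.flow (l i) (j i) (r i)"

abbreviation legal :: "'i \<Rightarrow> 'a \<times> 'a \<Rightarrow> bool" where
  "legal i \<equiv> cylinder.legal (l i) (r i)"

text \<open>The time \<open>s\<close> may have either sign. The strict inequality, demanded at the
  endpoints as well, excludes simultaneous contacts.\<close>

definition seg :: "'i \<Rightarrow> 'a \<times> 'a \<Rightarrow> real \<Rightarrow> bool" where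
  "seg i Z s \<longleftrightarrow> i \<in> P \<and> legal i Z \<and>
     (\<forall>u\<in>closed_segment 0 s. \<forall>k\<in>P - {i}. norm (l k (fst (flow i u Z))) > r k)"

lemma seg_0: "seg i Z s \<Longrightarrow> flow i 0 Z = Z"
  by (simp add: seg_def cylinder.flow_0[OF cylinder])

lemma flow_flow: "i \<in> P \<Longrightarrow> flow i s (flow i t Z) = flow i (s + t) Z"
  by (rule cylinder.flow_flow[OF cylinder])

lemma seg_subset: "seg i Z s \<Longrightarrow> u \<in> closed_segment 0 s \<Longrightarrow> seg i Z u"
  unfolding seg_def using subset_closed_segment[of 0 u 0 s] by auto

lemma seg_shift:
  assumes "seg i Z s" "u \<in> closed_segment 0 s"
  shows "seg i (flow i u Z) (s - u)"
proof -
  have "u + w \<in> closed_segment 0 s" if "w \<in> closed_segment 0 (s - u)" for w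
    using that assms(2) by (auto simp: closed_segment_eq_real_ivl split: if_splits)
  then show ?thesis
    using assms by (auto simp: seg_def flow_flow cylinder.legal_flow[OF cylinder] add.commute)
qed

lemma seg_reverse:
  assumes "seg i Z s"
  shows "seg i (flow i s Z) (- s)" "flow i (- s) (flow i s Z) = Z"
proof -
  have "w + s \<in> closed_segment 0 s" if "w \<in> closed_segment 0 (- s)" for w
    using that by (auto simp: closed_segment_eq_real_ivl split: if_splits)
  then show "seg i (flow i s Z) (- s)"
    using assms by (auto simp: seg_def flow_flow cylinder.legal_flow[OF cylinder])
  show "flow i (- s) (flow i s Z) = Z"
    using assms seg_0[OF assms] by (simp add: seg_def flow_flow)
qed

text \<open>During a time \<open>h\<close> the position moves by at most
  \<open>h * e (snd Z)\<close>, hence a relative position by at most twice as much.\<close>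

lemma seg_margin:
  assumes "i \<in> P" "legal i Z" "\<bar>s\<bar> \<le> h"
    and "\<And>k. k \<in> P - {i} \<Longrightarrow> norm (l k (fst Z)) > r k + 2 * (h * e (snd Z))"
  shows "seg i Z s"
  unfolding seg_def
proof (intro conjI ballI assms)
  fix u k assume u: "u \<in> closed_segment 0 s" and k: "k \<in> P - {i}"
  interpret k: cylinder "l k" "j k" "r k" e
    using k cylinder by blast
  have "\<bar>u\<bar> \<le> h"
    using u assms(3) by (auto simp: closed_segment_eq_real_ivl split: if_splits)
  moreover have "e (snd Z) \<ge> 0"
    using k.norm_le_e[of "snd Z"] norm_ge_zero order_trans by blast
  ultimately have "\<bar>u\<bar> * e (snd Z) \<le> h * e (snd Z)"
    by (intro mult_right_mono)
  then have "norm (fst (flow i u Z) - fst Z) \<le> h * e (snd Z)"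
    using cylinder.flow_displacement[OF cylinder[OF assms(1)] assms(2), of u] by linarith
  then have "norm (l k (fst (flow i u Z)) - l k (fst Z)) \<le> 2 * (h * e (snd Z))"
    using norm_l[of k "fst (flow i u Z) - fst Z"] k by (simp add: k.l_simps)
  moreover have "norm (l k (fst Z)) \<le> norm (l k (fst (flow i u Z))) + norm (l k (fst (flow i u Z)) - l k (fst Z))"
    by (metis norm_minus_commute norm_triangle_sub)
  ultimately show "norm (l k (fst (flow i u Z))) > r k"
    using assms(4)[OF k] by linarith
qed

text \<open>
  If two scatterers can both serve as the only active one, then neither is met: at the earlier of the
  two first contacts, the trajectory of the other one would touch a forbidden scatterer.
\<close>

lemma seg_agree:
  assumes i: "seg i Z s" and k: "seg k Z s"
  shows "flow i s Z = flow k s Z"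
proof (cases "i = k")
  case False
  interpret i: cylinder "l i" "j i" "r i" e
    using i cylinder by (simp add: seg_def)
  interpret k: cylinder "l k" "j k" "r k" e
    using k cylinder by (simp add: seg_def)
  have li: "legal i Z" and lk: "legal k Z"
    using i k by (simp_all add: seg_def)
  have ik: False if "c \<in> closed_segment 0 s" "norm (i.rel (drift c Z)) = r i"
    "fst (flow k c Z) = fst (drift c Z)" for c
  proof -
    have "norm (l i (fst (flow k c Z))) > r i"
      using k i that(1) False unfolding seg_def by blast
    then show False
      using that(2,3) by (simp add: i.rel_def)
  qed
  have ki: False if "c \<in> closed_segment 0 s" "norm (k.rel (drift c Z)) = r k"
    "fst (flow i c Z) = fst (drift c Z)" for c
  proof -
    have "norm (l k (fst (flow i c Z))) > r k"
      using k i that(1) False unfolding seg_def by blast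
    then show False
      using that(2,3) by (simp add: k.rel_def)
  qed
  have sub: "closed_segment 0 c \<subseteq> closed_segment 0 s" if "c \<in> closed_segment 0 s" for c
    using that by (simp add: subset_closed_segment)
  show ?thesis
  proof (cases rule: i.first_contact[OF li, of s])
    case free_i: 1
    have fi: "flow i c Z = drift c Z" if "c \<in> closed_segment 0 s" for c
      using free_i sub[OF that] by (intro i.flow_eq_drift[OF li]) blast
    show ?thesis
    proof (cases rule: k.first_contact[OF lk, of s])
      case 1
      then have "flow k s Z = drift s Z"
        by (intro k.flow_eq_drift[OF lk])
      then show ?thesis
        using fi[of s] by simp
    next
      case (2 c)
      then show ?thesis
        using ki fi by auto
    qed
  next
    case contact_i: (2 c)
    show ?thesis
    proof (cases rule: k.first_contact[OF lk, of s])
      case 1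
      then have "flow k c Z = drift c Z"
        using sub[OF contact_i(1)] by (intro k.flow_eq_drift[OF lk]) blast
      then have False
        by (intro ik[OF contact_i(1,2)]) simp
      then show ?thesis ..
    next
      case (2 c')
      \<comment> \<open>Both contact times lie on the same side of 0, so one of them comes
        first.\<close>
      have "c \<in> closed_segment 0 c' \<or> c' \<in> closed_segment 0 c"
        using contact_i(1) 2(1) by (auto simp: closed_segment_eq_real_ivl split: if_splits)
      then show ?thesis
        using 2 contact_i ik ki by blast
    qed
  qed
qed simp

section \<open>Trajectories as concatenations of two-body segments\<close>

inductive reach :: "real \<Rightarrow> real \<Rightarrow> 'a \<times> 'a \<Rightarrow> 'a \<times> 'a \<Rightarrow> bool" for \<sigma> where
  refl: "reach \<sigma> 0 Z Z"
| step: "seg i Z (\<sigma> * s) \<Longrightarrow> 0 \<le> s \<Longrightarrow> reach \<sigma> t (flow i (\<sigma> * s) Z) W \<Longrightarrow> reach \<sigma> (s + t) Z W"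

lemma reach_nonneg: "reach \<sigma> t Z W \<Longrightarrow> 0 \<le> t"
  by (induction rule: reach.induct) auto

lemma reach_trans: "reach \<sigma> s Z Y \<Longrightarrow> reach \<sigma> t Y W \<Longrightarrow> reach \<sigma> (s + t) Z W"
  by (induction rule: reach.induct) (auto simp: add.assoc intro: reach.step)

lemma reach_single: "seg i Z (\<sigma> * s) \<Longrightarrow> 0 \<le> s \<Longrightarrow> reach \<sigma> s Z (flow i (\<sigma> * s) Z)"
  using reach.step[OF _ _ reach.refl] by fastforce

lemma reach_reverse: "reach \<sigma> t Z W \<Longrightarrow> reach (- \<sigma>) t W Z"
proof (induction rule: reach.induct)
  case (step i Z s t W)
  have "reach (- \<sigma>) s (flow i (\<sigma> * s) Z) Z"
    using reach_single[of i "flow i (\<sigma> * s) Z" "- \<sigma>" s] seg_reverse[OF step.hyps(1)] step.hyps(2) by simp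
  then show ?case
    using reach_trans[OF step.IH] by (simp add: add.commute)
qed (rule reach.refl)

lemma reach_0:
  assumes "reach \<sigma> 0 Z W"
  shows "W = Z"
proof -
  have "t = 0 \<Longrightarrow> W = Z" if "reach \<sigma> t Z W" for t
    using that
  proof (induction rule: reach.induct)
    case (step i Z s t W)
    then have "s = 0" "t = 0"
      using reach_nonneg[OF step.hyps(3)] by auto
    then show ?case
      using step seg_0[OF step.hyps(1)] by simp
  qed simp
  then show ?thesis
    using assms by blast
qed

lemma closed_segment_mult:
  fixes \<sigma> :: real
  shows "0 \<le> s \<Longrightarrow> s \<le> t \<Longrightarrow> \<sigma> * s \<in> closed_segment 0 (\<sigma> * t)"
  by (cases "\<sigma> \<ge> 0")
    (auto simp: closed_segment_eq_real_ivl mult_left_mono mult_left_mono_neg mult_nonneg_nonneg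
      mult_nonpos_nonneg zero_le_mult_iff)

text \<open>Determinism: a segment from \<open>Z\<close> that lasts no longer than a concatenation
  is an initial piece of it. By \<open>seg_agree\<close> it coincides with the first link as long as
  both last; cutting off the shorter one leaves the same problem for the remainder.\<close>

lemma reach_after_seg:
  "reach \<sigma> t Z W \<Longrightarrow> seg i Z (\<sigma> * s) \<Longrightarrow> 0 \<le> s \<Longrightarrow> s \<le> t \<Longrightarrow> reach \<sigma> (t - s) (flow i (\<sigma> * s) Z) W"
proof (induction arbitrary: s rule: reach.induct)
  case (refl Z)
  then show ?case
    using seg_0[of i Z] by (auto intro: reach.refl)
next
  case (step k Z s1 t W)
  show ?case
  proof (cases "s \<le> s1")
    case True
    note c = closed_segment_mult[OF step.prems(2) True, of \<sigma>]
    have "flow i (\<sigma> * s) Z = flow k (\<sigma> * s) Z"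
      by (rule seg_agree[OF step.prems(1) seg_subset[OF step.hyps(1) c]])
    moreover have "seg k (flow k (\<sigma> * s) Z) (\<sigma> * (s1 - s))"
      using seg_shift[OF step.hyps(1) c] by (simp add: algebra_simps)
    moreover have "flow k (\<sigma> * (s1 - s)) (flow k (\<sigma> * s) Z) = flow k (\<sigma> * s1) Z"
      using step.hyps(1) by (simp add: seg_def flow_flow algebra_simps)
    ultimately show ?thesis
      using reach.step[of k "flow k (\<sigma> * s) Z" \<sigma> "s1 - s" t W] step.hyps(3) True by (simp add: algebra_simps)
  next
    case False
    then have c: "\<sigma> * s1 \<in> closed_segment 0 (\<sigma> * s)"
      using step.hyps(2) by (intro closed_segment_mult) auto
    have eq: "flow k (\<sigma> * s1) Z = flow i (\<sigma> * s1) Z"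
      by (rule seg_agree[OF step.hyps(1) seg_subset[OF step.prems(1) c]])
    have "seg i (flow k (\<sigma> * s1) Z) (\<sigma> * (s - s1))"
      using seg_shift[OF step.prems(1) c] by (simp add: eq algebra_simps)
    moreover have "flow i (\<sigma> * (s - s1)) (flow k (\<sigma> * s1) Z) = flow i (\<sigma> * s) Z"
      using step.prems(1) by (simp add: seg_def eq flow_flow algebra_simps)
    ultimately show ?thesis
      using step.IH[of "s - s1"] False step.prems(3) by (simp add: algebra_simps)
  qed
qed

lemma reach_le: "reach \<sigma> s Z Y \<Longrightarrow> reach \<sigma> t Z W \<Longrightarrow> s \<le> t \<Longrightarrow> reach \<sigma> (t - s) Y W"
proof (induction arbitrary: t rule: reach.induct)
  case (step i Z s1 s Y)
  have "reach \<sigma> (t - s1) (flow i (\<sigma> * s1) Z) W"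
    using step.hyps step.prems reach_nonneg[OF step.hyps(3)] by (intro reach_after_seg) auto
  then show ?case
    using step.IH[of "t - s1"] step.prems(2) by (simp add: algebra_simps)
qed simp

text \<open>\<open>reach\<close> keeps direction and duration apart, so that one induction over
  non-negative durations serves both directions of time; here they are joined into a signed
  time.\<close>

definition moves :: "real \<Rightarrow> 'a \<times> 'a \<Rightarrow> 'a \<times> 'a \<Rightarrow> bool" where
  "moves t Z W \<longleftrightarrow> reach (if 0 \<le> t then 1 else - 1) \<bar>t\<bar> Z W"

lemma movesI:
  assumes "\<sigma> \<in> {1, -1}" "reach \<sigma> t Z W"
  shows "moves (\<sigma> * t) Z W"
  using assms reach_nonneg[OF assms(2)] reach_0[of "-1" Z W] reach.refl[of 1 Z]
  by (cases "t = 0") (auto simp: moves_def)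

lemma movesE:
  assumes "moves t Z W"
  obtains \<sigma> u where "\<sigma> \<in> {1, -1}" "t = \<sigma> * u" "reach \<sigma> u Z W"
  using assms that[of 1 t] that[of "-1" "- t"] by (auto simp: moves_def split: if_splits)

text \<open>The single source of uniqueness (equal times), reversal (return to \<open>Z\<close>) and
  composition. For equal directions the shorter concatenation is cut off the longer one, for
  opposite directions one of them is reversed and the two are joined.\<close>

lemma moves_diff:
  assumes "moves s Z Y" "moves t Z W"
  shows "moves (t - s) Y W"
proof -
  obtain \<sigma> u where u: "\<sigma> \<in> {1, -1}" "s = \<sigma> * u" "reach \<sigma> u Z Y"
    using assms(1) by (rule movesE)
  obtain \<tau> w where w: "\<tau> \<in> {1, -1}" "t = \<tau> * w" "reach \<tau> w Z W"
    using assms(2) by (rule movesE)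
  show ?thesis
  proof (cases "\<sigma> = \<tau>")
    case True
    show ?thesis
    proof (cases "u \<le> w")
      case le: True
      then have "moves (\<sigma> * (w - u)) Y W"
        using True u w by (intro movesI reach_le[of _ u Z]) auto
      then show ?thesis
        using True u w by (simp add: algebra_simps)
    next
      case False
      then have "reach (- \<sigma>) (u - w) Y W"
        using True u w by (intro reach_reverse reach_le[of _ w Z]) auto
      then have "moves (- \<sigma> * (u - w)) Y W"
        using u by (intro movesI) auto
      then show ?thesis
        using True u w by (simp add: algebra_simps)
    qed
  next
    case False
    then have "reach \<tau> (u + w) Y W"
      using u w reach_reverse[OF u(3)] by (intro reach_trans[of _ u Y Z]) auto
    then have "moves (\<tau> * (u + w)) Y W"
      using w by (intro movesI)
    moreover have "\<tau> * (u + w) = t - s"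
      using False u w by auto
    ultimately show ?thesis
      by simp
  qed
qed

lemma moves_0: "moves 0 Z Z"
  by (simp add: moves_def reach.refl)

lemma moves_0_iff: "moves 0 Z W \<longleftrightarrow> W = Z"
  by (auto simp: moves_def reach.refl dest: reach_0)

lemma moves_unique: "moves t Z W \<Longrightarrow> moves t Z W' \<Longrightarrow> W = W'"
  using moves_diff[of t Z W t W'] by (simp add: moves_0_iff)

lemma moves_reverse: "moves t Z W \<Longrightarrow> moves (- t) W Z"
  using moves_diff[OF _ moves_0] by fastforce

lemma moves_trans: "moves s Z Y \<Longrightarrow> moves t Y W \<Longrightarrow> moves (s + t) Z W"
  using moves_diff[OF moves_reverse[of s Z Y], of t W] by (simp add: add.commute)

lemma moves_seg:
  assumes "seg i Z s"
  shows "moves s Z (flow i s Z)"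
proof (cases "0 \<le> s")
  case True
  then show ?thesis
    using reach_single[of i Z 1 s] assms by (simp add: moves_def)
next
  case False
  then show ?thesis
    using reach_single[of i Z "-1" "- s"] assms by (simp add: moves_def)
qed

lemma e_moves: "moves t Z W \<Longrightarrow> e (snd W) = e (snd Z)"
proof -
  have "e (snd W) = e (snd Z)" if "reach \<sigma> t Z W" for \<sigma> t
    using that
    by (induction rule: reach.induct) (auto simp: seg_def cylinder.e_flow[OF cylinder])
  then show "moves t Z W \<Longrightarrow> e (snd W) = e (snd Z)"
    by (auto simp: moves_def)
qed

section \<open>States with a global trajectory and their flow\<close>

definition global :: "('a \<times> 'a) set" where
  "global = {Z. \<forall>t. \<exists>W. moves t Z W}"

definition Phi :: "real \<Rightarrow> 'a \<times> 'a \<Rightarrow> 'a \<times> 'a" where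
  "Phi t Z = (THE W. moves t Z W)"

lemma Phi_eqI: "moves t Z W \<Longrightarrow> Phi t Z = W"
  unfolding Phi_def using moves_unique by blast

lemma moves_Phi: "Z \<in> global \<Longrightarrow> moves t Z (Phi t Z)"
  unfolding global_def using Phi_eqI by blast

lemma Phi_global:
  assumes "Z \<in> global"
  shows "Phi t Z \<in> global"
proof -
  have "moves s (Phi t Z) (Phi (s + t) Z)" for s
    using moves_diff[OF moves_Phi[OF assms, of t] moves_Phi[OF assms, of "s + t"]] by simp
  then show ?thesis
    unfolding global_def by blast
qed

lemma Phi_0: "Phi 0 Z = Z"
  by (rule Phi_eqI[OF moves_0])

lemma Phi_Phi:
  assumes "Z \<in> global"
  shows "Phi s (Phi t Z) = Phi (s + t) Z"
  using moves_trans[OF moves_Phi[OF assms] moves_Phi[OF Phi_global[OF assms]]]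
  by (metis Phi_eqI add.commute)

lemma e_Phi: "Z \<in> global \<Longrightarrow> e (snd (Phi t Z)) = e (snd Z)"
  by (rule e_moves[OF moves_Phi])

lemma global_seg:
  assumes "Z \<in> global"
  obtains i where "seg i Z 0"
proof -
  \<comment> \<open>A positive duration is needed here, since the empty concatenation of duration 0
    contains no segment.\<close>
  have "moves 1 Z (Phi 1 Z)"
    by (rule moves_Phi[OF assms])
  then have "reach 1 1 Z (Phi 1 Z)"
    by (simp add: moves_def)
  then show ?thesis
    by (cases rule: reach.cases) (auto intro: that seg_subset)
qed

lemma global_outside:
  assumes "Z \<in> global" "k \<in> P"
  shows "norm (l k (fst Z)) \<ge> r k"
proof -
  obtain i where i: "seg i Z 0"
    using assms(1) by (rule global_seg)
  then show ?thesis
  proof (cases "i = k")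
    case True
    interpret k: cylinder "l k" "j k" "r k" e
      using assms(2) by (rule cylinder)
    have "k.legal Z"
      using i True by (simp add: seg_def)
    then show ?thesis
      by (auto simp: k.legal_def k.rel_def)
  next
    case False
    then show ?thesis
      using i assms(2) seg_0[OF i] by (auto simp: seg_def intro: less_imp_le)
  qed
qed

text \<open>The inactive scatterers have a positive distance from the state and the speed is
  bounded, so the active scatterer remains the only candidate for a short time in both
  directions.\<close>

lemma global_local_flow:
  assumes "Z \<in> global"
  obtains i h where "i \<in> P" "legal i Z" "\<And>k. k \<in> P - {i} \<Longrightarrow> norm (l k (fst Z)) > r k"
    "h > 0" "\<And>t. \<bar>t\<bar> \<le> h \<Longrightarrow> Phi t Z = flow i t Z"
proof -
  obtain i where i: "seg i Z 0"
    using assms(1) by (rule global_seg)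
  have k: "norm (l k (fst Z)) > r k" if "k \<in> P - {i}" for k
    using that i seg_0[OF i] by (auto simp: seg_def)
  \<comment> \<open>The inserted 1 keeps the minimum meaningful when there is only one
    scatterer.\<close>
  define m where "m = Min (insert 1 ((\<lambda>k. norm (l k (fst Z)) - r k) ` (P - {i})))"
  have fin: "finite (insert 1 ((\<lambda>k. norm (l k (fst Z)) - r k) ` (P - {i})))"
    using finite_P by simp
  have m: "m > 0"
    unfolding m_def using k fin by (subst Min_gr_iff) auto
  have mk: "m \<le> norm (l k (fst Z)) - r k" if "k \<in> P - {i}" for k
    unfolding m_def using that fin by (intro Min_le) auto
  interpret i: cylinder "l i" "j i" "r i" e
    using i cylinder by (simp add: seg_def)
  have e0: "e (snd Z) \<ge> 0"
    using i.norm_le_e[of "snd Z"] norm_ge_zero order_trans by blast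
  \<comment> \<open>Distances change by at most \<open>2 * (h * e (snd Z))\<close>, which this
    choice keeps below half of the margin \<open>m\<close>; the summand 1 covers vanishing
    speed.\<close>
  define h where "h = m / (4 * (e (snd Z) + 1))"
  have h: "h > 0"
    using m e0 by (simp add: h_def)
  have "2 * (h * e (snd Z)) \<le> 2 * (h * (e (snd Z) + 1))"
    using h by simp
  also have "\<dots> = m / 2"
    using e0 by (simp add: h_def field_simps)
  finally have "r k + 2 * (h * e (snd Z)) < norm (l k (fst Z))" if "k \<in> P - {i}" for k
    using mk[OF that] m by linarith
  then have "seg i Z t" if "\<bar>t\<bar> \<le> h" for t
    using that i by (intro seg_margin[of i Z t h]) (auto simp: seg_def)
  then have "Phi t Z = flow i t Z" if "\<bar>t\<bar> \<le> h" for t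
    using that by (intro Phi_eqI moves_seg)
  then show ?thesis
    using that[of i h] i h k by (auto simp: seg_def)
qed

end

section \<open>Near-double contacts\<close>

lemma nn_integral_lborel_translate:
  assumes [measurable]: "f \<in> borel_measurable (borel :: 'a::euclidean_space measure)"
  shows "(\<integral>\<^sup>+z. f (c + z) \<partial>lborel) = (\<integral>\<^sup>+z. f z \<partial>lborel)"
proof -
  have "(\<integral>\<^sup>+z. f z \<partial>lborel) = (\<integral>\<^sup>+z. f z \<partial>distr lborel borel ((+) c))"
    by (simp add: lborel_distr_plus)
  also have "\<dots> = (\<integral>\<^sup>+z. f (c + z) \<partial>lborel)"
    by (rule nn_integral_distr) auto
  finally show ?thesis ..
qed

text \<open>
  Averaging over the translations \<open>z \<mapsto> z + h y\<close> with \<open>y\<close> in the unit ball replaces a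
  decomposition of the space into the range of \<open>h\<close> and a complement.
\<close>

lemma emeasure_shell_average:
  fixes h :: "'b::euclidean_space \<Rightarrow> 'c::euclidean_space" and l :: "'c \<Rightarrow> 'b"
  assumes h: "continuous_on UNIV h" and l: "continuous_on UNIV l"
    and lh: "\<And>z y. l (z + h y) = l z + y"
    and S: "S \<in> sets borel" and T: "T \<in> sets borel"
    and ST: "\<And>z y. norm y \<le> 1 \<Longrightarrow> z + h y \<in> S \<Longrightarrow> z \<in> T"
  shows "emeasure lborel (cball 0 1 :: 'b set) * emeasure lborel {z \<in> S. a \<le> norm (l z) \<and> norm (l z) \<le> b}
    \<le> emeasure lborel {y::'b. a \<le> norm y \<and> norm y \<le> b} * emeasure lborel T"
proof -
  have [measurable]: "h \<in> borel_measurable borel" "l \<in> borel_measurable borel" "S \<in> sets borel" "T \<in> sets borel"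
    using h l S T by (auto intro: borel_measurable_continuous_onI)
  define S' where "S' = {z \<in> S. a \<le> norm (l z) \<and> norm (l z) \<le> b}"
  define H where "H = {y::'b. a \<le> norm y \<and> norm y \<le> b}"
  define B where "B = (cball 0 1 :: 'b set)"
  have S'm [measurable]: "S' \<in> sets borel"
    unfolding S'_def by measurable
  have Hm [measurable]: "H \<in> sets borel"
    unfolding H_def by measurable
  have Bm [measurable]: "B \<in> sets borel"
    unfolding B_def by simp
  have "emeasure lborel B * emeasure lborel S' = (\<integral>\<^sup>+y. emeasure lborel S' * indicator B y \<partial>lborel)"
    by (subst nn_integral_cmult_indicator) (simp_all add: mult.commute)
  also have "\<dots> = (\<integral>\<^sup>+y. (\<integral>\<^sup>+z. indicator B y * indicator S' (z + h y) \<partial>lborel) \<partial>lborel)"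
  proof (rule nn_integral_cong)
    fix y
    have "(\<integral>\<^sup>+z. indicator B y * indicator S' (z + h y) \<partial>lborel)
        = indicator B y * (\<integral>\<^sup>+z. indicator S' (h y + z) \<partial>lborel)"
      by (simp add: nn_integral_cmult add.commute)
    then show "emeasure lborel S' * indicator B y = (\<integral>\<^sup>+z. indicator B y * indicator S' (z + h y) \<partial>lborel)"
      by (simp add: nn_integral_lborel_translate mult.commute)
  qed
  also have "\<dots> = (\<integral>\<^sup>+z. (\<integral>\<^sup>+y. indicator B y * indicator S' (z + h y) \<partial>lborel) \<partial>lborel)"
    by (rule lborel_pair.Fubini') measurable
  \<comment> \<open>The shift by \<open>h y\<close> adds \<open>y\<close> to \<open>l z\<close>, so
    for fixed \<open>z\<close> the admissible \<open>y\<close> lie in the shell translated by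
    \<open>- l z\<close>.\<close>
  also have "\<dots> \<le> (\<integral>\<^sup>+z. (\<integral>\<^sup>+y. indicator T z * indicator H (l z + y) \<partial>lborel) \<partial>lborel)"
    by (intro nn_integral_mono)
      (auto simp: indicator_def S'_def H_def B_def lh split: if_splits dest: ST)
  also have "\<dots> = (\<integral>\<^sup>+z. emeasure lborel H * indicator T z \<partial>lborel)"
    by (intro nn_integral_cong) (simp add: nn_integral_cmult nn_integral_lborel_translate mult.commute)
  also have "\<dots> = emeasure lborel H * emeasure lborel T"
    by (simp add: nn_integral_cmult_indicator)
  finally show ?thesis
    by (simp add: S'_def H_def B_def)
qed

lemma power_diff_le:
  fixes a b :: real
  assumes "0 \<le> a" "a \<le> b"
  shows "b ^ n - a ^ n \<le> real n * b ^ (n - 1) * (b - a)"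
proof (induction n)
  case (Suc n)
  have "b ^ Suc n - a ^ Suc n = b * (b ^ n - a ^ n) + a ^ n * (b - a)"
    by (simp add: algebra_simps)
  also have "\<dots> \<le> b * (real n * b ^ (n - 1) * (b - a)) + b ^ n * (b - a)"
    using assms Suc by (intro add_mono mult_left_mono mult_right_mono power_mono) auto
  also have "\<dots> = real (Suc n) * b ^ (Suc n - 1) * (b - a)"
    by (cases n) (simp_all add: algebra_simps)
  finally show ?case .
qed simp

lemma emeasure_shell_le:
  assumes "0 < a"
  obtains C where "C \<ge> 0"
    "\<And>\<eta>. 0 \<le> \<eta> \<Longrightarrow> \<eta> \<le> 1 \<Longrightarrow>
      emeasure lborel {y::'b::euclidean_space. a \<le> norm y \<and> norm y \<le> a + \<eta>} \<le> ennreal (C * \<eta>)"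
proof -
  define v where "v = unit_ball_vol (real DIM('b))"
  have v: "v \<ge> 0"
    by (simp add: v_def)
  \<comment> \<open>A bound for the derivative of the volume of a ball with respect to its radius,
    valid up to radius \<open>a + 1\<close>.\<close>
  define C where "C = v * (real DIM('b) * (a + 1) ^ (DIM('b) - 1))"
  have "emeasure lborel {y::'b. a \<le> norm y \<and> norm y \<le> a + \<eta>} \<le> ennreal (C * \<eta>)" if \<eta>: "0 \<le> \<eta>" "\<eta> \<le> 1" for \<eta>
  proof -
    have "emeasure lborel {y::'b. a \<le> norm y \<and> norm y \<le> a + \<eta>} = emeasure lborel (cball 0 (a + \<eta>) - ball 0 a :: 'b set)"
      by (rule arg_cong[where f="emeasure lborel"]) auto
    also have "\<dots> = emeasure lborel (cball 0 (a + \<eta>) :: 'b set) - emeasure lborel (ball 0 a :: 'b set)"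
      using \<eta> by (intro emeasure_Diff) (auto simp: emeasure_ball assms less_imp_le)
    also have "\<dots> = ennreal (v * (a + \<eta>) ^ DIM('b)) - ennreal (v * a ^ DIM('b))"
      using assms \<eta> by (simp add: emeasure_ball emeasure_cball v_def)
    also have "\<dots> = ennreal (v * ((a + \<eta>) ^ DIM('b) - a ^ DIM('b)))"
      using assms \<eta> v by (subst ennreal_minus) (auto simp: algebra_simps)
    also have "\<dots> \<le> ennreal (C * \<eta>)"
    proof (rule ennreal_leI)
      have "(a + \<eta>) ^ DIM('b) - a ^ DIM('b) \<le> real DIM('b) * (a + \<eta>) ^ (DIM('b) - 1) * \<eta>"
        using power_diff_le[of a "a + \<eta>" "DIM('b)"] assms \<eta> by simp
      also have "\<dots> \<le> real DIM('b) * (a + 1) ^ (DIM('b) - 1) * \<eta>"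
        using assms \<eta> by (intro mult_right_mono mult_left_mono power_mono) auto
      finally show "v * ((a + \<eta>) ^ DIM('b) - a ^ DIM('b)) \<le> C * \<eta>"
        using v by (auto simp: C_def mult.assoc intro!: mult_left_mono)
    qed
    finally show ?thesis .
  qed
  moreover have "C \<ge> 0"
    using v assms by (simp add: C_def)
  ultimately show ?thesis
    using that by blast
qed

lemma ennreal_mult_le_imp_le:
  assumes "ennreal v * X \<le> ennreal c" "v > 0" "c \<ge> 0"
  shows "X \<le> ennreal (c / v)"
proof -
  have "X = ennreal (1 / v) * (ennreal v * X)"
    using assms(2) by (simp add: mult.assoc[symmetric] ennreal_mult[symmetric])
  also have "\<dots> \<le> ennreal (1 / v) * ennreal c"
    by (rule mult_left_mono[OF assms(1)]) simp
  also have "\<dots> = ennreal (c / v)"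
    using assms by (simp add: ennreal_mult[symmetric])
  finally show ?thesis .
qed

text \<open>Averaging is applied twice. Shifts along \<open>h\<^sub>1\<close> change the first
  relative position and leave the second one alone, so they gain a factor \<open>\<eta>\<close> from
  the first shell while the second shell persists in a slightly larger region; shifts along
  \<open>h\<^sub>2\<close> then gain the second factor.\<close>

lemma emeasure_double_shell_le:
  fixes l\<^sub>1 l\<^sub>2 :: "'a::euclidean_space \<Rightarrow> 'b::euclidean_space"
  assumes l: "linear l\<^sub>1" "linear l\<^sub>2" and h: "linear h\<^sub>1" "linear h\<^sub>2"
    and l1h: "\<And>y. l\<^sub>1 (h\<^sub>1 y) = y" "\<And>y. l\<^sub>2 (h\<^sub>1 y) = 0" and l2h: "\<And>y. l\<^sub>2 (h\<^sub>2 y) = y"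
    and r: "0 < r\<^sub>1" "0 < r\<^sub>2"
  obtains C where "C \<ge> 0"
    "\<And>\<eta>. 0 \<le> \<eta> \<Longrightarrow> \<eta> \<le> 1 \<Longrightarrow>
      emeasure lborel {Z :: 'a \<times> 'a. norm (fst Z) \<le> R \<and> norm (snd Z) \<le> V \<and>
        r\<^sub>1 \<le> norm (l\<^sub>1 (fst Z)) \<and> norm (l\<^sub>1 (fst Z)) \<le> r\<^sub>1 + \<eta> \<and>
        r\<^sub>2 \<le> norm (l\<^sub>2 (fst Z)) \<and> norm (l\<^sub>2 (fst Z)) \<le> r\<^sub>2 + \<eta>} \<le> ennreal (C * \<eta>\<^sup>2)"
proof -
  have cont: "continuous_on S f" if "linear f" for S and f :: "'c::euclidean_space \<Rightarrow> 'd::euclidean_space"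
    using that by (simp add: linear_continuous_on linear_linear)
  have [measurable]: "l\<^sub>1 \<in> borel_measurable borel" "l\<^sub>2 \<in> borel_measurable borel"
    using cont l by (auto intro: borel_measurable_continuous_onI)
  have [measurable]: "fst \<in> borel_measurable (borel :: ('a \<times> 'a) measure)"
    "snd \<in> borel_measurable (borel :: ('a \<times> 'a) measure)"
    by (intro borel_measurable_continuous_onI continuous_intros)+
  obtain m\<^sub>1 where m1: "\<And>y. norm (h\<^sub>1 y) \<le> m\<^sub>1 * norm y" "m\<^sub>1 > 0"
    using linear_bounded_pos[OF h(1)] by blast
  obtain m\<^sub>2 where m2: "\<And>y. norm (h\<^sub>2 y) \<le> m\<^sub>2 * norm y" "m\<^sub>2 > 0"
    using linear_bounded_pos[OF h(2)] by blast
  obtain C\<^sub>1 where C1: "C\<^sub>1 \<ge> 0" "\<And>\<eta>. 0 \<le> \<eta> \<Longrightarrow> \<eta> \<le> 1 \<Longrightarrow>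
      emeasure lborel {y::'b. r\<^sub>1 \<le> norm y \<and> norm y \<le> r\<^sub>1 + \<eta>} \<le> ennreal (C\<^sub>1 * \<eta>)"
    using emeasure_shell_le[OF r(1)] by metis
  obtain C\<^sub>2 where C2: "C\<^sub>2 \<ge> 0" "\<And>\<eta>. 0 \<le> \<eta> \<Longrightarrow> \<eta> \<le> 1 \<Longrightarrow>
      emeasure lborel {y::'b. r\<^sub>2 \<le> norm y \<and> norm y \<le> r\<^sub>2 + \<eta>} \<le> ennreal (C\<^sub>2 * \<eta>)"
    using emeasure_shell_le[OF r(2)] by metis
  define v where "v = unit_ball_vol (real DIM('b))"
  have v: "v > 0" "emeasure lborel (cball 0 1 :: 'b set) = ennreal v"
    by (simp_all add: v_def emeasure_cball)
  \<comment> \<open>The bounds on the position leave room for one unit shift along each of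
    \<open>h\<^sub>1\<close> and \<open>h\<^sub>2\<close>.\<close>
  define T where "T = {Z :: 'a \<times> 'a. norm (fst Z) \<le> (R + m\<^sub>1) + m\<^sub>2 \<and> norm (snd Z) \<le> V}"
  have Tm [measurable]: "T \<in> sets borel"
    unfolding T_def by measurable
  have "T \<subseteq> cball 0 ((R + m\<^sub>1) + m\<^sub>2) \<times> cball 0 V"
    by (auto simp: T_def)
  then have "bounded T"
    by (rule bounded_subset[rotated]) (simp add: bounded_Times)
  then have "emeasure lborel T < \<infinity>"
    by (rule emeasure_bounded_finite)
  then obtain M where M: "M \<ge> 0" "emeasure lborel T = ennreal M"
    by (auto simp: less_top_ennreal)
  define C where "C = C\<^sub>1 * C\<^sub>2 * M / v / v"
  show ?thesis
  proof
    show "C \<ge> 0"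
      using C1 C2 M v by (simp add: C_def)
    fix \<eta> :: real assume \<eta>: "0 \<le> \<eta>" "\<eta> \<le> 1"
    define S\<^sub>2 where "S\<^sub>2 R' = {Z \<in> {Z :: 'a \<times> 'a. norm (fst Z) \<le> R' \<and> norm (snd Z) \<le> V}.
      r\<^sub>2 \<le> norm (l\<^sub>2 (fst Z)) \<and> norm (l\<^sub>2 (fst Z)) \<le> r\<^sub>2 + \<eta>}" for R'
    have S2m [measurable]: "S\<^sub>2 R' \<in> sets borel" for R'
      unfolding S\<^sub>2_def by measurable
    have "emeasure lborel (cball 0 1 :: 'b set) * emeasure lborel (S\<^sub>2 (R + m\<^sub>1))
      \<le> emeasure lborel {y::'b. r\<^sub>2 \<le> norm y \<and> norm y \<le> r\<^sub>2 + \<eta>} * emeasure lborel T"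
      unfolding S\<^sub>2_def
    proof (rule emeasure_shell_average[where h="\<lambda>y. (h\<^sub>2 y, 0)"])
      fix z :: "'a \<times> 'a" and y :: 'b
      assume y: "norm y \<le> 1" "z + (h\<^sub>2 y, 0) \<in> {Z. norm (fst Z) \<le> R + m\<^sub>1 \<and> norm (snd Z) \<le> V}"
      have "norm (h\<^sub>2 y) \<le> m\<^sub>2"
        using m2(1)[of y] mult_left_mono[OF y(1), of m\<^sub>2] m2(2) by linarith
      then show "z \<in> T"
        using y(2) norm_triangle_ineq4[of "fst z + h\<^sub>2 y" "h\<^sub>2 y"] by (simp add: T_def)
    qed (auto intro!: continuous_intros cont[OF h(2)] continuous_on_compose2[OF cont[OF l(2)]]
        simp: linear_add[OF l(2)] l2h Tm)
    also have "\<dots> \<le> ennreal (C\<^sub>2 * \<eta>) * ennreal M"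
      unfolding M(2) by (intro mult_right_mono C2 \<eta>) simp
    also have "\<dots> = ennreal (C\<^sub>2 * \<eta> * M)"
      using C2(1) \<eta> M by (simp add: ennreal_mult)
    finally have 2: "emeasure lborel (S\<^sub>2 (R + m\<^sub>1)) \<le> ennreal (C\<^sub>2 * \<eta> * M / v)"
      unfolding v(2) using v C2(1) \<eta> M by (intro ennreal_mult_le_imp_le) auto
    have "emeasure lborel (cball 0 1 :: 'b set) * emeasure lborel {Z \<in> S\<^sub>2 R.
        r\<^sub>1 \<le> norm (l\<^sub>1 (fst Z)) \<and> norm (l\<^sub>1 (fst Z)) \<le> r\<^sub>1 + \<eta>}
      \<le> emeasure lborel {y::'b. r\<^sub>1 \<le> norm y \<and> norm y \<le> r\<^sub>1 + \<eta>} * emeasure lborel (S\<^sub>2 (R + m\<^sub>1))"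
    proof (rule emeasure_shell_average[where h="\<lambda>y. (h\<^sub>1 y, 0)"])
      fix z :: "'a \<times> 'a" and y :: 'b
      assume y: "norm y \<le> 1" "z + (h\<^sub>1 y, 0) \<in> S\<^sub>2 R"
      have "norm (h\<^sub>1 y) \<le> m\<^sub>1"
        using m1(1)[of y] mult_left_mono[OF y(1), of m\<^sub>1] m1(2) by linarith
      then show "z \<in> S\<^sub>2 (R + m\<^sub>1)"
        using y(2) norm_triangle_ineq4[of "fst z + h\<^sub>1 y" "h\<^sub>1 y"]
        by (simp add: S\<^sub>2_def linear_add[OF l(2)] l1h)
    qed (auto intro!: continuous_intros cont[OF h(1)] continuous_on_compose2[OF cont[OF l(1)]]
        simp: linear_add[OF l(1)] l1h S2m)
    also have "\<dots> \<le> ennreal (C\<^sub>1 * \<eta>) * ennreal (C\<^sub>2 * \<eta> * M / v)"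
      by (intro mult_mono C1 \<eta> 2) auto
    also have "\<dots> = ennreal (C\<^sub>1 * \<eta> * (C\<^sub>2 * \<eta> * M / v))"
      using C1(1) C2(1) \<eta> M v by (simp add: ennreal_mult[symmetric])
    finally have "emeasure lborel {Z \<in> S\<^sub>2 R. r\<^sub>1 \<le> norm (l\<^sub>1 (fst Z)) \<and> norm (l\<^sub>1 (fst Z)) \<le> r\<^sub>1 + \<eta>}
      \<le> ennreal (C\<^sub>1 * \<eta> * (C\<^sub>2 * \<eta> * M / v) / v)"
      unfolding v(2) using v C1(1) C2(1) \<eta> M by (intro ennreal_mult_le_imp_le) auto
    also have "{Z \<in> S\<^sub>2 R. r\<^sub>1 \<le> norm (l\<^sub>1 (fst Z)) \<and> norm (l\<^sub>1 (fst Z)) \<le> r\<^sub>1 + \<eta>}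
      = {Z :: 'a \<times> 'a. norm (fst Z) \<le> R \<and> norm (snd Z) \<le> V \<and>
        r\<^sub>1 \<le> norm (l\<^sub>1 (fst Z)) \<and> norm (l\<^sub>1 (fst Z)) \<le> r\<^sub>1 + \<eta> \<and>
        r\<^sub>2 \<le> norm (l\<^sub>2 (fst Z)) \<and> norm (l\<^sub>2 (fst Z)) \<le> r\<^sub>2 + \<eta>}"
      by (auto simp: S\<^sub>2_def)
    also have "C\<^sub>1 * \<eta> * (C\<^sub>2 * \<eta> * M / v) / v = C * \<eta>\<^sup>2"
      by (simp add: C_def power2_eq_square)
    finally show "emeasure lborel {Z :: 'a \<times> 'a. norm (fst Z) \<le> R \<and> norm (snd Z) \<le> V \<and>
        r\<^sub>1 \<le> norm (l\<^sub>1 (fst Z)) \<and> norm (l\<^sub>1 (fst Z)) \<le> r\<^sub>1 + \<eta> \<and>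
        r\<^sub>2 \<le> norm (l\<^sub>2 (fst Z)) \<and> norm (l\<^sub>2 (fst Z)) \<le> r\<^sub>2 + \<eta>} \<le> ennreal (C * \<eta>\<^sup>2)" .
  qed
qed

text \<open>For a set that is not closed but is exhausted by closed pieces, each of which meets
  every ray from the origin at most once.\<close>

lemma negligible_starlike_countable_union:
  assumes "\<And>n::nat. closed (S n)"
    and "\<And>n c x. 0 \<le> c \<Longrightarrow> c < 1 \<Longrightarrow> x \<in> S n \<Longrightarrow> c *\<^sub>R x \<notin> S n"
  shows "negligible (\<Union>n. S n :: 'a::euclidean_space set)"
proof (rule negligible_countable_Union)
  show "negligible T" if "T \<in> range S" for T
    using that assms(1) by (auto intro!: starlike_negligible_strong[of _ 0] dest: assms(2))
qed simp

section \<open>Almost everywhere existence\<close>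

context billiard
begin

text \<open>A condition on the initial state alone which, by \<open>seg_margin\<close>, makes
  \<open>i\<close> a possible sole active scatterer throughout a step of length
  \<open>\<delta>\<close>, in both directions of time.\<close>

definition core :: "real \<Rightarrow> 'i \<Rightarrow> ('a \<times> 'a) set" where
  "core \<delta> i = {Z. legal i Z \<and> (\<forall>k\<in>P - {i}. norm (l k (fst Z)) > r k + 2 * (\<bar>\<delta>\<bar> * e (snd Z)))}"

definition cores :: "real \<Rightarrow> ('a \<times> 'a) set" where
  "cores \<delta> = (\<Union>i\<in>P. core \<delta> i)"

text \<open>The preimage within the states that survive the step. Thus
  \<open>(pre \<delta> ^^ n) UNIV\<close> consists of the states for which \<open>n\<close>
  successive steps succeed.\<close>

definition pre :: "real \<Rightarrow> ('a \<times> 'a) set \<Rightarrow> ('a \<times> 'a) set" where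
  "pre \<delta> A = {Z \<in> cores \<delta>. Phi \<delta> Z \<in> A}"

definition table :: "('a \<times> 'a) set" where
  "table = {Z. \<forall>k\<in>P. norm (l k (fst Z)) \<ge> r k}"

definition bounded_part :: "real \<Rightarrow> real \<Rightarrow> ('a \<times> 'a) set" where
  "bounded_part V R = {Z \<in> table. e (snd Z) \<le> V \<and> norm (fst Z) \<le> R}"

lemma continuous_on_l_fst: "i \<in> P \<Longrightarrow> continuous_on UNIV (\<lambda>Z :: 'a \<times> 'a. l i (fst Z))"
  using cylinder.linear_l[OF cylinder, of i]
  by (intro continuous_on_compose2[OF linear_continuous_on[of "l i" UNIV]] continuous_intros) (auto simp: linear_linear)

lemma continuous_on_e_snd: "continuous_on UNIV (\<lambda>Z :: 'a \<times> 'a. e (snd Z))"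
  by (rule continuous_on_compose2[OF continuous_e]) (auto intro: continuous_intros)

lemma measurable_l_fst: "i \<in> P \<Longrightarrow> (\<lambda>Z :: 'a \<times> 'a. l i (fst Z)) \<in> borel_measurable borel"
  and measurable_e_snd [measurable]: "(\<lambda>Z :: 'a \<times> 'a. e (snd Z)) \<in> borel_measurable borel"
  by (intro borel_measurable_continuous_onI continuous_on_l_fst continuous_on_e_snd; assumption)+

lemma r_pos: "i \<in> P \<Longrightarrow> r i > 0"
  by (rule cylinder.r_pos[OF cylinder])

lemma seg_in_table: "seg i Z 0 \<Longrightarrow> Z \<in> table"
proof -
  assume i: "seg i Z 0"
  interpret i: cylinder "l i" "j i" "r i" e
    using i cylinder by (simp add: seg_def)
  have "i.legal Z" "\<And>k. k \<in> P - {i} \<Longrightarrow> norm (l k (fst Z)) > r k"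
    using i seg_0[OF i] by (auto simp: seg_def)
  then show "Z \<in> table"
    unfolding table_def i.legal_def i.rel_def by (fastforce intro: less_imp_le)
qed

lemma core_seg: "i \<in> P \<Longrightarrow> Z \<in> core \<delta> i \<Longrightarrow> \<bar>s\<bar> \<le> \<bar>\<delta>\<bar> \<Longrightarrow> seg i Z s"
  by (rule seg_margin[of _ _ _ "\<bar>\<delta>\<bar>"]) (auto simp: core_def)

lemma moves_core: "i \<in> P \<Longrightarrow> Z \<in> core \<delta> i \<Longrightarrow> moves \<delta> Z (flow i \<delta> Z)"
  by (rule moves_seg[OF core_seg]) auto

lemma Phi_core: "i \<in> P \<Longrightarrow> Z \<in> core \<delta> i \<Longrightarrow> Phi \<delta> Z = flow i \<delta> Z"
  by (rule Phi_eqI[OF moves_core])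

lemma moves_cores: "Z \<in> cores \<delta> \<Longrightarrow> moves \<delta> Z (Phi \<delta> Z)"
  by (auto simp: cores_def Phi_core intro: moves_core)

text \<open>Determinism backwards in time, regardless of which scatterers are active; it allows
  volume preservation to be glued over the overlapping sets \<open>core \<delta> i\<close>.\<close>

lemma inj_on_Phi_cores: "inj_on (Phi \<delta>) (cores \<delta>)"
proof (rule inj_onI)
  fix Y Z assume "Y \<in> cores \<delta>" "Z \<in> cores \<delta>" and eq: "Phi \<delta> Y = Phi \<delta> Z"
  then have "moves (- \<delta>) (Phi \<delta> Z) Y" "moves (- \<delta>) (Phi \<delta> Z) Z"
    using moves_reverse[OF moves_cores, of Y \<delta>] moves_reverse[OF moves_cores, of Z \<delta>] by metis+
  then show "Y = Z"
    by (rule moves_unique)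
qed

lemma sets_core: "i \<in> P \<Longrightarrow> core \<delta> i \<in> sets borel"
proof -
  assume i: "i \<in> P"
  have "{Z. norm (l k (fst Z)) > r k + 2 * (\<bar>\<delta>\<bar> * e (snd Z))} \<in> sets borel" if "k \<in> P" for k
    using measurable_l_fst[OF that] by measurable
  moreover have "core \<delta> i = {Z. legal i Z} \<inter>
      (\<Inter>k\<in>P - {i}. {Z. norm (l k (fst Z)) > r k + 2 * (\<bar>\<delta>\<bar> * e (snd Z))})"
    by (auto simp: core_def)
  ultimately show ?thesis
    using cylinder.sets_legal[OF cylinder[OF i]] finite_P
    by (cases "P - {i} = {}") (auto intro!: sets.Int sets.finite_INT)
qed

lemma sets_cores: "cores \<delta> \<in> sets borel"
  unfolding cores_def using finite_P sets_core by (intro sets.finite_UN) auto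

lemma measure_preserving_Phi_cores: "measure_preserving_on (Phi \<delta>) (cores \<delta>)"
  unfolding cores_def
proof (rule measure_preserving_on_UN[OF finite_P])
  fix i assume i: "i \<in> P"
  show "core \<delta> i \<in> sets lebesgue"
    using sets_core[OF i] by simp
  show "measure_preserving_on (Phi \<delta>) (core \<delta> i)"
    by (rule measure_preserving_on_cong[OF measure_preserving_on_subset[OF
            cylinder.measure_preserving_flow[OF cylinder[OF i], of \<delta>]]])
      (auto simp: core_def Phi_core[OF i])
next
  show "inj_on (Phi \<delta>) (\<Union> (core \<delta> ` P))"
    using inj_on_Phi_cores by (simp add: cores_def)
qed

text \<open>On \<open>core \<delta> i\<close> the preimage under \<open>Phi \<delta>\<close> is an
  image under the inverse flow, and images of measurable sets under a volume-preserving map are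
  measurable by \<open>measure_preserving_onD\<close>.\<close>

lemma sets_pre:
  assumes "A \<in> sets lebesgue"
  shows "pre \<delta> A \<in> sets lebesgue"
proof -
  have "pre \<delta> A = (\<Union>i\<in>P. core \<delta> i \<inter> flow i (- \<delta>) ` (A \<inter> {Z. legal i Z}))"
  proof (rule set_eqI)
    fix Z
    have "Phi \<delta> Z \<in> A \<longleftrightarrow> Z \<in> flow i (- \<delta>) ` (A \<inter> {Z. legal i Z})" if i: "i \<in> P" "Z \<in> core \<delta> i" for i
    proof -
      have Z: "legal i Z"
        using i by (simp add: core_def)
      have "Z = flow i (- \<delta>) (flow i \<delta> Z)" "legal i (flow i \<delta> Z)"
        using i Z by (simp_all add: flow_flow cylinder.flow_0[OF cylinder] cylinder.legal_flow[OF cylinder])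
      moreover have "flow i \<delta> (flow i (- \<delta>) Y) = Y" if "legal i Y" for Y
        using i that by (simp add: flow_flow cylinder.flow_0[OF cylinder])
      ultimately show ?thesis
        unfolding Phi_core[OF i] by (auto intro!: image_eqI[of Z])
    qed
    then show "Z \<in> pre \<delta> A \<longleftrightarrow> Z \<in> (\<Union>i\<in>P. core \<delta> i \<inter> flow i (- \<delta>) ` (A \<inter> {Z. legal i Z}))"
      unfolding pre_def cores_def by blast
  qed
  moreover have "core \<delta> i \<inter> flow i (- \<delta>) ` (A \<inter> {Z. legal i Z}) \<in> sets lebesgue" if i: "i \<in> P" for i
  proof (rule sets.Int)
    show "core \<delta> i \<in> sets lebesgue"
      using sets_core[OF i] by simp
    have "A \<inter> {Z. legal i Z} \<in> sets lebesgue"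
      using assms cylinder.sets_legal[OF cylinder[OF i]] by auto
    then show "flow i (- \<delta>) ` (A \<inter> {Z. legal i Z}) \<in> sets lebesgue"
      by (intro measure_preserving_onD(1)[OF cylinder.measure_preserving_flow[OF cylinder[OF i]]]) auto
  qed
  ultimately show ?thesis
    using finite_P by (auto intro!: sets.finite_UN)
qed

lemma emeasure_pre_le:
  assumes A: "A \<in> sets lebesgue"
  shows "emeasure lebesgue (pre \<delta> A) \<le> emeasure lebesgue A"
proof -
  have "pre \<delta> A \<subseteq> cores \<delta>"
    by (auto simp: pre_def)
  from measure_preserving_onD(2)[OF measure_preserving_Phi_cores this sets_pre[OF A]]
  have "emeasure lebesgue (pre \<delta> A) = emeasure lebesgue (Phi \<delta> ` pre \<delta> A)"
    by simp
  also have "\<dots> \<le> emeasure lebesgue A"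
    using A by (intro emeasure_mono) (auto simp: pre_def)
  finally show ?thesis .
qed

lemma mem_pre: "Z \<in> pre \<delta> A \<longleftrightarrow> Z \<in> cores \<delta> \<and> Phi \<delta> Z \<in> A"
  by (simp add: pre_def)

lemma pre_moves: "Z \<in> (pre \<delta> ^^ n) A \<Longrightarrow> \<exists>W\<in>A. moves (real n * \<delta>) Z W"
proof (induction n arbitrary: Z)
  case 0
  then show ?case
    by (auto intro: moves_0)
next
  case (Suc n)
  then have Z: "Z \<in> cores \<delta>" "Phi \<delta> Z \<in> (pre \<delta> ^^ n) A"
    by (simp_all add: mem_pre)
  then obtain W where W: "W \<in> A" "moves (real n * \<delta>) (Phi \<delta> Z) W"
    using Suc.IH by blast
  have "moves (real (Suc n) * \<delta>) Z W"
    using moves_trans[OF moves_cores[OF Z(1)] W(2)] by (simp add: algebra_simps)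
  then show ?case
    using W(1) by blast
qed

lemma sets_pre_funpow: "A \<in> sets lebesgue \<Longrightarrow> (pre \<delta> ^^ n) A \<in> sets lebesgue"
  by (induction n) (auto intro: sets_pre)

lemma emeasure_pre_funpow_le: "A \<in> sets lebesgue \<Longrightarrow> emeasure lebesgue ((pre \<delta> ^^ n) A) \<le> emeasure lebesgue A"
  by (induction n) (auto intro: order_trans[OF emeasure_pre_le] sets_pre_funpow)

lemma pre_funpow_Un: "(pre \<delta> ^^ n) (A \<union> B) = (pre \<delta> ^^ n) A \<union> (pre \<delta> ^^ n) B"
  by (induction n) (auto simp: mem_pre)

lemma pre_funpow_UNIV:
  assumes "Z \<in> (pre \<delta> ^^ n) UNIV" "moves (real n * \<delta>) Z W" "W \<in> A"
  shows "Z \<in> (pre \<delta> ^^ n) A"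
proof (rule ccontr)
  assume "Z \<notin> (pre \<delta> ^^ n) A"
  then have "Z \<in> (pre \<delta> ^^ n) (- A)"
    using assms(1) pre_funpow_Un[of n \<delta> A "- A"] by auto
  then obtain W' where "W' \<in> - A" "moves (real n * \<delta>) Z W'"
    using pre_moves by blast
  then show False
    using moves_unique[OF assms(2)] assms(3) by blast
qed

lemma sets_table: "table \<in> sets borel"
proof -
  have "{Z :: 'a \<times> 'a. norm (l k (fst Z)) \<ge> r k} \<in> sets borel" if "k \<in> P" for k
    using continuous_on_l_fst[OF that] by (intro borel_closed closed_Collect_le continuous_intros)
  moreover have "table = (\<Inter>k\<in>P. {Z. norm (l k (fst Z)) \<ge> r k})"
    by (auto simp: table_def)
  ultimately show ?thesis
    using finite_P P_nonempty by (auto intro!: sets.finite_INT)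
qed

lemma sets_bounded_part: "bounded_part V R \<in> sets borel"
proof -
  have [measurable]: "fst \<in> borel_measurable (borel :: ('a \<times> 'a) measure)"
    by (intro borel_measurable_continuous_onI continuous_intros)
  have "{Z :: 'a \<times> 'a. e (snd Z) \<le> V \<and> norm (fst Z) \<le> R} \<in> sets borel"
    by measurable
  moreover have "bounded_part V R = table \<inter> {Z. e (snd Z) \<le> V \<and> norm (fst Z) \<le> R}"
    by (auto simp: bounded_part_def)
  ultimately show ?thesis
    using sets_table by auto
qed

lemma Phi_bounded_part:
  assumes "Z \<in> cores \<delta>" "Z \<in> bounded_part V R"
  shows "Phi \<delta> Z \<in> bounded_part V (R + \<bar>\<delta>\<bar> * V)"
proof -
  obtain i where i: "i \<in> P" "Z \<in> core \<delta> i"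
    using assms(1) by (auto simp: cores_def)
  have seg: "seg i Z \<delta>"
    by (rule core_seg[OF i]) simp
  have "seg i (Phi \<delta> Z) 0"
    using seg_shift[OF seg, of \<delta>] by (simp add: Phi_core[OF i])
  then have "Phi \<delta> Z \<in> table"
    by (rule seg_in_table)
  moreover have "e (snd (Phi \<delta> Z)) = e (snd Z)"
    by (rule e_moves[OF moves_cores[OF assms(1)]])
  moreover have "norm (fst (Phi \<delta> Z) - fst Z) \<le> \<bar>\<delta>\<bar> * V"
  proof -
    have "norm (fst (Phi \<delta> Z) - fst Z) \<le> \<bar>\<delta>\<bar> * e (snd Z)"
      unfolding Phi_core[OF i] using i
      by (intro cylinder.flow_displacement[OF cylinder]) (auto simp: core_def)
    also have "\<dots> \<le> \<bar>\<delta>\<bar> * V"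
      using assms(2) by (intro mult_left_mono) (auto simp: bounded_part_def)
    finally show ?thesis .
  qed
  ultimately show ?thesis
    using assms(2) norm_triangle_sub[of "fst (Phi \<delta> Z)" "fst Z"] by (auto simp: bounded_part_def)
qed

lemma bounded_part_mono: "R \<le> R' \<Longrightarrow> bounded_part V R \<subseteq> bounded_part V R'"
  by (auto simp: bounded_part_def)

text \<open>A state is lost either in the first step or in a later one. The later losses form the
  preimage of the losses of the remaining steps, which taking preimages does not enlarge.
  \<open>R'\<close> contains all positions that \<open>n\<close> steps can reach from radius
  \<open>R\<close>.\<close>

lemma emeasure_not_pre_le:
  assumes "R + real n * (\<bar>\<delta>\<bar> * V) \<le> R'" "0 \<le> V"
  shows "emeasure lebesgue (bounded_part V R - (pre \<delta> ^^ n) UNIV)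
    \<le> of_nat n * emeasure lebesgue (bounded_part V R' - cores \<delta>)"
  using assms(1)
proof (induction n arbitrary: R)
  case 0
  then show ?case by simp
next
  case (Suc n)
  let ?R = "R + \<bar>\<delta>\<bar> * V"
  let ?bad = "bounded_part V R' - cores \<delta>"
  let ?rest = "bounded_part V ?R - (pre \<delta> ^^ n) UNIV"
  have m: "?bad \<in> sets lebesgue" "?rest \<in> sets lebesgue"
    using sets_bounded_part sets_cores sets_pre_funpow[of UNIV] by auto
  have "0 \<le> real (Suc n) * (\<bar>\<delta>\<bar> * V)"
    using assms(2) by simp
  then have RR: "R \<le> R'"
    using Suc.prems by linarith
  have IH: "emeasure lebesgue ?rest \<le> of_nat n * emeasure lebesgue ?bad"
    using Suc.prems by (intro Suc.IH) (simp add: algebra_simps)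
  have "bounded_part V R - (pre \<delta> ^^ Suc n) UNIV \<subseteq> ?bad \<union> pre \<delta> ?rest"
    by (auto simp: mem_pre intro: Phi_bounded_part subsetD[OF bounded_part_mono[OF RR]])
  then have "emeasure lebesgue (bounded_part V R - (pre \<delta> ^^ Suc n) UNIV)
      \<le> emeasure lebesgue (?bad \<union> pre \<delta> ?rest)"
    using m by (intro emeasure_mono sets.Un sets_pre)
  also have "\<dots> \<le> emeasure lebesgue ?bad + emeasure lebesgue (pre \<delta> ?rest)"
    using m by (intro emeasure_subadditive sets_pre)
  also have "\<dots> \<le> emeasure lebesgue ?bad + of_nat n * emeasure lebesgue ?bad"
    using emeasure_pre_le[OF m(2)] IH by (intro add_left_mono) (rule order_trans)
  also have "\<dots> = of_nat (Suc n) * emeasure lebesgue ?bad"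
    by (simp add: algebra_simps)
  finally show ?case .
qed

text \<open>Contacts and grazing lines. In the table every other state is \<open>legal\<close> for
  all scatterers.\<close>

definition degenerate :: "('a \<times> 'a) set" where
  "degenerate = {Z. \<exists>i\<in>P. norm (l i (fst Z)) = r i \<or> cylinder.disc (l i) (r i) Z = 0 \<and> l i (snd Z) \<noteq> 0}"

text \<open>
  Both conditions fail to be homogeneous, so that each ray from the origin meets either set at most once.
\<close>

lemma negligible_degenerate: "negligible degenerate"
proof -
  have "negligible {Z :: 'a \<times> 'a. norm (l i (fst Z)) = r i}" (is "negligible ?S")
    and "negligible {Z. cylinder.disc (l i) (r i) Z = 0 \<and> l i (snd Z) \<noteq> 0}" (is "negligible ?T")
    if i: "i \<in> P" for i
  proof -
    interpret i: cylinder "l i" "j i" "r i" e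
      by (rule cylinder[OF i])
    show "negligible ?S"
    proof (rule starlike_negligible_strong[of _ 0])
      show "closed ?S"
        by (intro closed_Collect_eq continuous_intros continuous_on_l_fst[OF i])
      fix c :: real and Z :: "'a \<times> 'a"
      assume "0 \<le> c" "c < 1" "0 + Z \<in> ?S"
      then show "0 + c *\<^sub>R Z \<notin> ?S"
        using i.r_pos by (simp add: i.l_simps)
    qed
    \<comment> \<open>The condition of nonzero relative velocity is not closed; lower bounds on its
      norm exhaust it by closed ones.\<close>
    define U where "U n = {Z. i.disc Z = 0 \<and> norm (i.rvel Z) \<ge> 1 / real (Suc n)}" for n
    have "negligible (\<Union>n. U n)"
    proof (rule negligible_starlike_countable_union)
      show "closed (U n)" for n
        unfolding U_def
        by (intro closed_Collect_conj closed_Collect_eq closed_Collect_le continuous_intros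
            i.continuous_on_disc i.continuous_on_rvel)
      fix n :: nat and c :: real and Z :: "'a \<times> 'a"
      assume c: "0 \<le> c" "c < 1" and Z: "Z \<in> U n"
      have v: "i.rvel Z \<noteq> 0"
        using Z by (auto simp: U_def)
      show "c *\<^sub>R Z \<notin> U n"
      proof
        assume cZ: "c *\<^sub>R Z \<in> U n"
        have sc: "i.rel (c *\<^sub>R Z) = c *\<^sub>R i.rel Z" "i.rvel (c *\<^sub>R Z) = c *\<^sub>R i.rvel Z"
          by (simp_all add: i.rel_def i.rvel_def i.l_simps)
        \<comment> \<open>\<open>disc\<close> is the sum of a part homogeneous of degree 4 and the
          term with \<open>(r i)\<^sup>2\<close>, which has degree 2. Subtracting
          \<open>c ^ 4 * i.disc Z\<close> cancels the former.\<close>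
        have "0 = i.disc (c *\<^sub>R Z) - c ^ 4 * i.disc Z"
          using Z cZ by (simp add: U_def)
        also have "\<dots> = c\<^sup>2 * (1 - c\<^sup>2) * ((i.rvel Z \<bullet> i.rvel Z) * (r i)\<^sup>2)"
          by (simp add: i.disc_def sc power2_eq_square power4_eq_xxxx algebra_simps)
        finally have "c = 0 \<or> c\<^sup>2 = 1"
          using v i.r_pos by simp
        moreover have "1 / real (Suc n) \<le> norm (c *\<^sub>R i.rvel Z)"
          using cZ unfolding U_def by (simp add: sc)
        then have "c \<noteq> 0"
          by auto
        ultimately show False
          using c by (auto simp: power2_eq_1_iff)
      qed
    qed
    moreover have "?T \<subseteq> (\<Union>n. U n)"
    proof
      fix Z assume Z: "Z \<in> ?T"
      then have "norm (i.rvel Z) > 0"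
        by (simp add: i.rvel_def)
      then obtain n where "1 / real (Suc n) < norm (i.rvel Z)"
        using nat_approx_posE by metis
      then show "Z \<in> (\<Union>n. U n)"
        using Z by (auto simp: U_def intro: less_imp_le)
    qed
    ultimately show "negligible ?T"
      by (rule negligible_subset)
  qed
  then have "negligible (\<Union>i\<in>P. {Z. norm (l i (fst Z)) = r i} \<union> {Z. cylinder.disc (l i) (r i) Z = 0 \<and> l i (snd Z) \<noteq> 0})"
    using finite_P by (intro negligible_Union) auto
  moreover have "degenerate = (\<Union>i\<in>P. {Z. norm (l i (fst Z)) = r i} \<union> {Z. cylinder.disc (l i) (r i) Z = 0 \<and> l i (snd Z) \<noteq> 0})"
    by (auto simp: degenerate_def)
  ultimately show ?thesis
    by simp
qed

text \<open>A non-degenerate configuration outside \<open>cores \<delta>\<close> is close to two scatterers at once.\<close>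

lemma emeasure_not_cores_le:
  assumes V: "V > 0"
  obtains C where "C \<ge> 0" "\<And>\<delta>. \<bar>\<delta>\<bar> * (2 * V) \<le> 1 \<Longrightarrow>
    emeasure lebesgue (bounded_part V R - cores \<delta>) \<le> ennreal (C * \<delta>\<^sup>2)"
proof -
  define shells where "shells i k \<eta> = {Z :: 'a \<times> 'a. norm (fst Z) \<le> R \<and> norm (snd Z) \<le> V \<and>
        r i \<le> norm (l i (fst Z)) \<and> norm (l i (fst Z)) \<le> r i + \<eta> \<and>
        r k \<le> norm (l k (fst Z)) \<and> norm (l k (fst Z)) \<le> r k + \<eta>}" for i k \<eta>
  define I where "I = {(i, k). i \<in> P \<and> k \<in> P \<and> i \<noteq> k}"
  have finI: "finite I"
    by (rule finite_subset[of _ "P \<times> P"]) (auto simp: I_def finite_P)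
  have "\<exists>C\<ge>0. \<forall>\<eta>. 0 \<le> \<eta> \<longrightarrow> \<eta> \<le> 1 \<longrightarrow> emeasure lborel (shells i k \<eta>) \<le> ennreal (C * \<eta>\<^sup>2)"
    if ik: "(i, k) \<in> I" for i k
  proof -
    have P: "i \<in> P" "k \<in> P" "i \<noteq> k"
      using ik by (auto simp: I_def)
    obtain h\<^sub>1 where h1: "linear h\<^sub>1" "\<And>y. l i (h\<^sub>1 y) = y" "\<And>y. l k (h\<^sub>1 y) = 0"
      using independent[OF P] by blast
    obtain h\<^sub>2 where h2: "linear h\<^sub>2" "\<And>y. l k (h\<^sub>2 y) = y"
      using independent[OF P(2,1)] P(3) by blast
    note lin = cylinder.linear_l[OF cylinder[OF P(1)]] cylinder.linear_l[OF cylinder[OF P(2)]]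
    obtain C where "C \<ge> 0"
      "\<And>\<eta>. 0 \<le> \<eta> \<Longrightarrow> \<eta> \<le> 1 \<Longrightarrow> emeasure lborel (shells i k \<eta>) \<le> ennreal (C * \<eta>\<^sup>2)"
      unfolding shells_def
      by (rule emeasure_double_shell_le[OF lin h1(1) h2(1) h1(2,3) h2(2) r_pos[OF P(1)] r_pos[OF P(2)], of R V]) blast
    then show ?thesis
      by blast
  qed
  then have "\<forall>p\<in>I. \<exists>C. C \<ge> 0 \<and> (\<forall>\<eta>. 0 \<le> \<eta> \<longrightarrow> \<eta> \<le> 1 \<longrightarrow>
      emeasure lborel (shells (fst p) (snd p) \<eta>) \<le> ennreal (C * \<eta>\<^sup>2))"
    by auto
  from bchoice[OF this] obtain c' where c': "\<forall>p\<in>I. c' p \<ge> 0 \<and> (\<forall>\<eta>. 0 \<le> \<eta> \<longrightarrow> \<eta> \<le> 1 \<longrightarrow>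
      emeasure lborel (shells (fst p) (snd p) \<eta>) \<le> ennreal (c' p * \<eta>\<^sup>2))"
    by blast
  define c where "c i k = c' (i, k)" for i k
  have c: "\<And>i k. (i, k) \<in> I \<Longrightarrow> c i k \<ge> 0"
    "\<And>i k \<eta>. (i, k) \<in> I \<Longrightarrow> 0 \<le> \<eta> \<Longrightarrow> \<eta> \<le> 1 \<Longrightarrow> emeasure lborel (shells i k \<eta>) \<le> ennreal (c i k * \<eta>\<^sup>2)"
    using c' by (fastforce simp: c_def)+
  define C where "C = (\<Sum>(i, k)\<in>I. c i k) * (2 * V)\<^sup>2"
  have C: "(\<Sum>(i, k)\<in>I. c i k) \<ge> 0"
    using c(1) by (intro sum_nonneg) auto
  show ?thesis
  proof
    show "C \<ge> 0"
      using C by (simp add: C_def)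
    fix \<delta> :: real assume \<delta>: "\<bar>\<delta>\<bar> * (2 * V) \<le> 1"
    \<comment> \<open>The largest change of a relative position during one step at speed at most
      \<open>V\<close>.\<close>
    define \<eta> where "\<eta> = \<bar>\<delta>\<bar> * (2 * V)"
    have \<eta>: "0 \<le> \<eta>" "\<eta> \<le> 1"
      using \<delta> V by (simp_all add: \<eta>_def)
    have near: "\<exists>k\<in>P - {i}. norm (l k (fst Z)) \<le> r k + \<eta>"
      if Z: "Z \<in> bounded_part V R" "Z \<notin> cores \<delta>" "Z \<notin> degenerate" and i: "i \<in> P" for Z i
    proof -
      interpret i: cylinder "l i" "j i" "r i" e
        by (rule cylinder[OF i])
      have "i.legal Z"
        using Z i unfolding i.legal_def bounded_part_def table_def degenerate_def i.rel_def i.rvel_def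
        by (auto simp: less_le)
      then obtain k where k: "k \<in> P - {i}" "norm (l k (fst Z)) \<le> r k + 2 * (\<bar>\<delta>\<bar> * e (snd Z))"
        using Z(2) i by (auto simp: cores_def core_def not_less)
      have "\<bar>\<delta>\<bar> * e (snd Z) \<le> \<bar>\<delta>\<bar> * V"
        using Z(1) by (intro mult_left_mono) (auto simp: bounded_part_def)
      then show ?thesis
        using k by (intro bexI[of _ k]) (auto simp: \<eta>_def)
    qed
    have sub: "bounded_part V R - cores \<delta> \<subseteq> degenerate \<union> (\<Union>(i, k)\<in>I. shells i k \<eta>)"
    proof
      fix Z assume Z: "Z \<in> bounded_part V R - cores \<delta>"
      show "Z \<in> degenerate \<union> (\<Union>(i, k)\<in>I. shells i k \<eta>)"
      proof (cases "Z \<in> degenerate")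
        case False
        \<comment> \<open>The starting index is arbitrary and need not be near itself: not lying in
          \<open>core \<delta> i0\<close> produces a near scatterer \<open>i\<close>, and not lying
          in \<open>core \<delta> i\<close> a second one.\<close>
        obtain i0 where i0: "i0 \<in> P"
          using P_nonempty by blast
        obtain i where i: "i \<in> P" "norm (l i (fst Z)) \<le> r i + \<eta>"
          using near[of Z i0] Z False i0 by blast
        obtain k where k: "k \<in> P - {i}" "norm (l k (fst Z)) \<le> r k + \<eta>"
          using near[of Z i] Z False i by blast
        have "norm (snd Z) \<le> V"
          using Z cylinder.norm_le_e[OF cylinder[OF i0], of "snd Z"] by (auto simp: bounded_part_def)
        then have "Z \<in> shells i k \<eta>"
          using Z i k by (auto simp: shells_def bounded_part_def table_def)
        moreover have "(i, k) \<in> I"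
          using i k by (auto simp: I_def)
        ultimately show ?thesis
          by blast
      qed simp
    qed
    have sb: "shells i k \<eta> \<in> sets borel" if "(i, k) \<in> I" for i k
    proof -
      have P: "i \<in> P" "k \<in> P"
        using that by (auto simp: I_def)
      have [measurable]: "fst \<in> borel_measurable (borel :: ('a \<times> 'a) measure)"
        "snd \<in> borel_measurable (borel :: ('a \<times> 'a) measure)"
        by (intro borel_measurable_continuous_onI continuous_intros)+
      note [measurable] = measurable_l_fst[OF P(1)] measurable_l_fst[OF P(2)]
      show ?thesis
        unfolding shells_def by measurable
    qed
    have sb': "(\<lambda>(i, k). shells i k \<eta>) ` I \<subseteq> sets lebesgue"
      using sb by auto
    have null: "degenerate \<in> null_sets lebesgue"
      using negligible_degenerate by (simp add: negligible_iff_null_sets)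
    have U: "(\<Union>(i, k)\<in>I. shells i k \<eta>) \<in> sets lebesgue"
      using sb finI by (intro sets.finite_UN) auto
    have "emeasure lebesgue (bounded_part V R - cores \<delta>) \<le> emeasure lebesgue (degenerate \<union> (\<Union>(i, k)\<in>I. shells i k \<eta>))"
      using sub null U by (intro emeasure_mono) auto
    also have "\<dots> = emeasure lebesgue (\<Union>(i, k)\<in>I. shells i k \<eta>)"
      using null U by (subst Un_commute) (rule emeasure_Un_null_set)
    also have "\<dots> \<le> (\<Sum>(i, k)\<in>I. emeasure lebesgue (shells i k \<eta>))"
      using emeasure_subadditive_finite[OF finI sb'] by (simp add: split_def)
    also have "\<dots> \<le> (\<Sum>(i, k)\<in>I. ennreal (c i k * \<eta>\<^sup>2))"
    proof (rule sum_mono, clarify)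
      fix i k assume ik: "(i, k) \<in> I"
      have "emeasure lebesgue (shells i k \<eta>) = emeasure lborel (shells i k \<eta>)"
        using sb[OF ik] by (simp add: emeasure_completion)
      then show "emeasure lebesgue (shells i k \<eta>) \<le> ennreal (c i k * \<eta>\<^sup>2)"
        using c(2)[OF ik \<eta>] by simp
    qed
    also have "\<dots> = ennreal (\<Sum>(i, k)\<in>I. c i k * \<eta>\<^sup>2)"
      using c(1) by (subst sum_ennreal[symmetric]) (auto simp: split_def)
    also have "(\<Sum>(i, k)\<in>I. c i k * \<eta>\<^sup>2) = C * \<delta>\<^sup>2"
      by (simp add: C_def \<eta>_def sum_distrib_right[symmetric] split_def power_mult_distrib)
    finally show "emeasure lebesgue (bounded_part V R - cores \<delta>) \<le> ennreal (C * \<delta>\<^sup>2)" .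
  qed
qed

lemma not_pre_tendsto_0:
  assumes V: "V > 0"
  shows "(\<lambda>n. emeasure lebesgue (bounded_part V R - (pre (t / real n) ^^ n) UNIV)) \<longlonglongrightarrow> 0"
proof -
  obtain C where C: "C \<ge> 0" "\<And>\<delta>. \<bar>\<delta>\<bar> * (2 * V) \<le> 1 \<Longrightarrow>
    emeasure lebesgue (bounded_part V (R + \<bar>t\<bar> * V) - cores \<delta>) \<le> ennreal (C * \<delta>\<^sup>2)"
    using emeasure_not_cores_le[OF V] by metis
  have "eventually (\<lambda>n. n > 0 \<and> \<bar>t\<bar> * (2 * V) \<le> real n) sequentially"
    using filterlim_real_sequentially by (intro eventually_conj eventually_gt_at_top) (simp add: filterlim_at_top)
  then have upper: "eventually (\<lambda>n. emeasure lebesgue (bounded_part V R - (pre (t / real n) ^^ n) UNIV)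
      \<le> ennreal (C * t\<^sup>2 / real n)) sequentially"
  proof eventually_elim
    case (elim n)
    have "emeasure lebesgue (bounded_part V R - (pre (t / real n) ^^ n) UNIV)
      \<le> of_nat n * emeasure lebesgue (bounded_part V (R + \<bar>t\<bar> * V) - cores (t / real n))"
      using elim V by (intro emeasure_not_pre_le) auto
    also have "\<dots> \<le> of_nat n * ennreal (C * (t / real n)\<^sup>2)"
      using elim by (intro mult_left_mono C(2)) (auto simp: field_simps)
    also have "\<dots> = ennreal (real n * (C * (t / real n)\<^sup>2))"
      using C(1) by (simp add: ennreal_mult ennreal_of_nat_eq_real_of_nat)
    also have "real n * (C * (t / real n)\<^sup>2) = C * t\<^sup>2 / real n"
      using elim by (simp add: power2_eq_square field_simps)
    finally show ?case .
  qed
  have lim: "(\<lambda>n. ennreal (C * t\<^sup>2 / real n)) \<longlonglongrightarrow> 0"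
    using tendsto_ennrealI[OF lim_const_over_n[of "C * t\<^sup>2"]] by simp
  show ?thesis
    by (rule tendsto_sandwich[OF _ upper tendsto_const lim]) (simp only: zero_le eventually_True)
qed


section \<open>Almost every state has a global trajectory\<close>

lemma table_eq_UN: "table = (\<Union>m::nat. bounded_part (real m + 1) (real m))"
proof
  show "table \<subseteq> (\<Union>m::nat. bounded_part (real m + 1) (real m))"
  proof
    fix Z assume Z: "Z \<in> table"
    obtain m :: nat where "max (e (snd Z)) (norm (fst Z)) \<le> real m"
      using real_arch_simple by blast
    then have "Z \<in> bounded_part (real m + 1) (real m)"
      using Z by (simp add: bounded_part_def)
    then show "Z \<in> (\<Union>m::nat. bounded_part (real m + 1) (real m))"
      by blast
  qed
qed (auto simp: bounded_part_def)

text \<open>A state is lost only if every subdivision of the time into equal steps fails. On a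
  bounded part this set lies in each single failure set, and their measures tend to 0.\<close>

lemma negligible_not_pre: "negligible (table - (\<Union>n\<in>{1..}. (pre (t / real n) ^^ n) UNIV))"
proof -
  have "negligible (bounded_part (real m + 1) (real m) - (\<Union>n\<in>{1..}. (pre (t / real n) ^^ n) UNIV))" for m
  proof -
    let ?K = "bounded_part (real m + 1) (real m)"
    let ?N = "?K - (\<Union>n\<in>{1..}. (pre (t / real n) ^^ n) UNIV)"
    have N: "?N \<in> sets lebesgue"
      using sets_bounded_part sets_pre_funpow[of UNIV] by (intro sets.Diff sets.countable_UN') auto
    have le: "emeasure lebesgue ?N \<le> emeasure lebesgue (?K - (pre (t / real n) ^^ n) UNIV)" if "n \<ge> 1" for n
      using that sets_bounded_part sets_pre_funpow[of UNIV] by (intro emeasure_mono sets.Diff) auto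
    have "emeasure lebesgue ?N \<le> 0"
    proof (rule LIMSEQ_le_const)
      show "(\<lambda>n. emeasure lebesgue (?K - (pre (t / real n) ^^ n) UNIV)) \<longlonglongrightarrow> 0"
        by (rule not_pre_tendsto_0) simp
      show "\<exists>n0. \<forall>n\<ge>n0. emeasure lebesgue ?N \<le> emeasure lebesgue (?K - (pre (t / real n) ^^ n) UNIV)"
        using le by blast
    qed
    then have "?N \<in> null_sets lebesgue"
      using N by (intro null_setsI) auto
    then show ?thesis
      by (simp add: negligible_iff_null_sets)
  qed
  then have "negligible (\<Union>m. bounded_part (real m + 1) (real m) - (\<Union>n\<in>{1..}. (pre (t / real n) ^^ n) UNIV))"
    by (intro negligible_Union_nat)
  then show ?thesis
    by (rule negligible_subset) (auto simp: table_eq_UN)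
qed

lemma pre_moves':
  assumes "n \<ge> 1" "Z \<in> (pre (t / real n) ^^ n) A"
  shows "\<exists>W\<in>A. moves t Z W"
  using pre_moves[OF assms(2)] assms(1) by simp

lemma reach_split: "reach \<sigma> T Z W \<Longrightarrow> 0 \<le> t \<Longrightarrow> t \<le> T \<Longrightarrow> \<exists>Y. reach \<sigma> t Z Y"
proof (induction arbitrary: t rule: reach.induct)
  case (refl Z)
  then have "t = 0"
    by simp
  then show ?case
    by (metis reach.refl)
next
  case (step i Z s T W)
  show ?case
  proof (cases "t \<le> s")
    case True
    have "reach \<sigma> t Z (flow i (\<sigma> * t) Z)"
      using step True by (intro reach_single seg_subset[OF step.hyps(1) closed_segment_mult])
    then show ?thesis ..
  next
    case False
    then obtain Y where "reach \<sigma> (t - s) (flow i (\<sigma> * s) Z) Y"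
      using step.IH[of "t - s"] step.prems by force
    then have "reach \<sigma> (s + (t - s)) Z Y"
      by (rule reach.step[OF step.hyps(1,2)])
    then have "reach \<sigma> t Z Y"
      by simp
    then show ?thesis ..
  qed
qed

text \<open>A trajectory can be cut short at any time by \<open>reach_split\<close>, so integer
  times suffice and only countably many null sets occur.\<close>

lemma globalI:
  assumes "\<And>n::nat. \<exists>W. moves (real n) Z W" "\<And>n::nat. \<exists>W. moves (- real n) Z W"
  shows "Z \<in> global"
proof -
  have "\<exists>Y. moves t Z Y" for t
  proof -
    obtain n :: nat where n: "\<bar>t\<bar> \<le> real n"
      using real_arch_simple by blast
    define \<sigma> :: real where "\<sigma> = (if 0 \<le> t then 1 else -1)"
    obtain W where "moves (\<sigma> * real n) Z W"
      using assms by (metis \<sigma>_def mult_1 mult_minus1)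
    moreover have "reach \<sigma> (real n) Z W" if "moves (\<sigma> * real n) Z W" for W
      using that by (cases "n = 0") (auto simp: moves_def \<sigma>_def moves_0_iff reach.refl dest: reach_0)
    ultimately have "\<exists>Y. reach \<sigma> \<bar>t\<bar> Z Y"
      using n by (intro reach_split[of \<sigma> "real n" Z W]) auto
    then obtain Y where "reach \<sigma> \<bar>t\<bar> Z Y" ..
    then have "moves t Z Y"
      by (simp add: moves_def \<sigma>_def)
    then show ?thesis ..
  qed
  then show ?thesis
    unfolding global_def by blast
qed

lemma global_subset_table: "global \<subseteq> table"
  using global_outside by (auto simp: table_def)

lemma negligible_not_global: "negligible (table - global)"
proof -
  define N where "N t = table - (\<Union>n\<in>{1..}. (pre (t / real n) ^^ n) UNIV)" for t
  have ex: "\<exists>W. moves t Z W" if "Z \<in> table" "Z \<notin> N t" for Z t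
    using that pre_moves'[of _ Z t UNIV] by (auto simp: N_def)
  have "table - global \<subseteq> (\<Union>n::nat. N (real n)) \<union> (\<Union>n::nat. N (- real n))"
  proof
    fix Z assume Z: "Z \<in> table - global"
    show "Z \<in> (\<Union>n::nat. N (real n)) \<union> (\<Union>n::nat. N (- real n))"
    proof (rule ccontr)
      assume "\<not> ?thesis"
      then have "Z \<in> global"
        using Z by (intro globalI ex) auto
      then show False
        using Z by simp
    qed
  qed
  moreover have "negligible ((\<Union>n::nat. N (real n)) \<union> (\<Union>n::nat. N (- real n)))"
    unfolding N_def by (intro negligible_Un negligible_Union_nat negligible_not_pre)
  ultimately show ?thesis
    by (rule negligible_subset[rotated])
qed

lemma sets_global: "global \<in> sets lebesgue"
proof -
  have "global = table - (table - global)"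
    using global_subset_table by auto
  then show ?thesis
    using sets_table negligible_imp_sets[OF negligible_not_global] by (metis sets.Diff sets_completionI_sets sets_lborel)
qed

section \<open>Volume preservation of the global flow\<close>

definition Phi_vimage :: "real \<Rightarrow> ('a \<times> 'a) set \<Rightarrow> ('a \<times> 'a) set" where
  "Phi_vimage t A = {Z \<in> global. Phi t Z \<in> A}"

lemma Phi_vimage_pre:
  assumes "n \<ge> 1" "Z \<in> global"
  shows "Z \<in> (pre (t / real n) ^^ n) A \<Longrightarrow> Phi t Z \<in> A"
    and "Z \<in> (pre (t / real n) ^^ n) UNIV \<Longrightarrow> Phi t Z \<in> A \<Longrightarrow> Z \<in> (pre (t / real n) ^^ n) A"
proof -
  show "Phi t Z \<in> A" if Z: "Z \<in> (pre (t / real n) ^^ n) A"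
  proof -
    obtain W where "W \<in> A" "moves t Z W"
      using pre_moves'[OF assms(1) Z] by blast
    then show ?thesis
      by (simp add: Phi_eqI)
  qed
  show "Z \<in> (pre (t / real n) ^^ n) A" if "Z \<in> (pre (t / real n) ^^ n) UNIV" "Phi t Z \<in> A"
    by (rule pre_funpow_UNIV[OF that(1) _ that(2)]) (use assms moves_Phi in simp)
qed

text \<open>Up to a null set the preimage is a countable union of preimages under finitely many
  steps; completeness of Lebesgue measure absorbs the difference.\<close>

lemma sets_Phi_vimage:
  assumes A: "A \<in> sets lebesgue"
  shows "Phi_vimage t A \<in> sets lebesgue"
proof -
  define U where "U = (\<Union>n\<in>{1..}. (pre (t / real n) ^^ n) A)"
  define N where "N = table - (\<Union>n\<in>{1..}. (pre (t / real n) ^^ n) UNIV)"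
  have "U \<in> sets lebesgue"
    unfolding U_def using sets_pre_funpow[OF A] by (intro sets.countable_UN') auto
  then have 1: "U \<inter> global \<in> sets lebesgue"
    using sets_global by auto
  have "negligible (Phi_vimage t A \<inter> N)"
    using negligible_not_pre by (rule negligible_subset) (auto simp: N_def)
  then have 2: "Phi_vimage t A \<inter> N \<in> sets lebesgue"
    by (rule negligible_imp_sets)
  have "Phi_vimage t A = (U \<inter> global) \<union> (Phi_vimage t A \<inter> N)"
    using Phi_vimage_pre[of _ _ t A] global_subset_table
    unfolding Phi_vimage_def U_def N_def by blast
  then show ?thesis
    using 1 2 by (metis sets.Un)
qed

text \<open>In a bounded part, a state of the preimage is either carried into \<open>A\<close> by
  \<open>n\<close> successful steps or lost. The former have measure at most that of
  \<open>A\<close> for every \<open>n\<close>, and the latter disappear in the limit.\<close>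

lemma emeasure_Phi_vimage_le:
  assumes A: "A \<in> sets lebesgue"
  shows "emeasure lebesgue (Phi_vimage t A) \<le> emeasure lebesgue A"
proof -
  define F where "F m = Phi_vimage t A \<inter> bounded_part (real m + 1) (real m)" for m
  have F: "F m \<in> sets lebesgue" for m
    unfolding F_def using sets_Phi_vimage[OF A] sets_bounded_part by auto
  have inc: "incseq F"
    by (auto simp: incseq_def F_def bounded_part_def)
  have U: "Phi_vimage t A = (\<Union>m. F m)"
    using global_subset_table table_eq_UN by (auto simp: F_def Phi_vimage_def)
  have "emeasure lebesgue (F m) \<le> emeasure lebesgue A" for m
  proof -
    let ?K = "bounded_part (real m + 1) (real m)"
    let ?e = "\<lambda>n. emeasure lebesgue (?K - (pre (t / real n) ^^ n) UNIV)"
    have K: "?K - (pre (t / real n) ^^ n) UNIV \<in> sets lebesgue" for n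
      using sets_bounded_part sets_pre_funpow[of UNIV] by auto
    have le: "emeasure lebesgue (F m) \<le> emeasure lebesgue A + ?e n" if n: "n \<ge> 1" for n
    proof -
      have "F m \<subseteq> (pre (t / real n) ^^ n) A \<union> (?K - (pre (t / real n) ^^ n) UNIV)"
        using Phi_vimage_pre(2)[OF n, of _ t A] unfolding F_def Phi_vimage_def by blast
      then have "emeasure lebesgue (F m) \<le> emeasure lebesgue ((pre (t / real n) ^^ n) A \<union> (?K - (pre (t / real n) ^^ n) UNIV))"
        using K sets_pre_funpow[OF A] by (intro emeasure_mono sets.Un)
      also have "\<dots> \<le> emeasure lebesgue ((pre (t / real n) ^^ n) A) + ?e n"
        using K sets_pre_funpow[OF A] by (intro emeasure_subadditive)
      also have "\<dots> \<le> emeasure lebesgue A + ?e n"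
        by (intro add_right_mono emeasure_pre_funpow_le A)
      finally show ?thesis .
    qed
    have "?e \<longlonglongrightarrow> 0"
      by (rule not_pre_tendsto_0) simp
    then have "(\<lambda>n. emeasure lebesgue A + ?e n) \<longlonglongrightarrow> emeasure lebesgue A + 0"
      by (intro tendsto_add tendsto_const)
    then show ?thesis
      using le by (intro LIMSEQ_le_const[of _ "emeasure lebesgue A"]) auto
  qed
  moreover have "emeasure lebesgue (Phi_vimage t A) = (SUP m. emeasure lebesgue (F m))"
    unfolding U using F inc by (intro SUP_emeasure_incseq[symmetric]) auto
  ultimately show ?thesis
    by (auto intro: SUP_least)
qed

text \<open>The reverse inequality is the same one for the inverse map.\<close>

lemma emeasure_Phi_vimage:
  assumes A: "A \<in> sets lebesgue"
  shows "emeasure lebesgue (Phi_vimage t A) = emeasure lebesgue (A \<inter> global)"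
proof (rule antisym)
  have "Phi_vimage t A = Phi_vimage t (A \<inter> global)"
    by (auto simp: Phi_vimage_def Phi_global)
  then show "emeasure lebesgue (Phi_vimage t A) \<le> emeasure lebesgue (A \<inter> global)"
    using emeasure_Phi_vimage_le[of "A \<inter> global" t] A sets_global by simp
  have "Phi_vimage (- t) (Phi_vimage t A) = A \<inter> global"
    by (auto simp: Phi_vimage_def Phi_global Phi_Phi Phi_0)
  then show "emeasure lebesgue (A \<inter> global) \<le> emeasure lebesgue (Phi_vimage t A)"
    using emeasure_Phi_vimage_le[OF sets_Phi_vimage[OF A], of "- t" t] by simp
qed

end

section \<open>The billiard table\<close>

context billiard
begin

lemma closed_table: "closed table"
proof -
  have "closed {Z :: 'a \<times> 'a. norm (l k (fst Z)) \<ge> r k}" if "k \<in> P" for k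
    by (intro closed_Collect_le continuous_intros continuous_on_l_fst[OF that])
  moreover have "table = (\<Inter>k\<in>P. {Z. norm (l k (fst Z)) \<ge> r k})"
    by (auto simp: table_def)
  ultimately show ?thesis
    by auto
qed

lemma interior_table: "interior table = {Z. \<forall>k\<in>P. norm (l k (fst Z)) > r k}"
proof
  have "open {Z :: 'a \<times> 'a. norm (l k (fst Z)) > r k}" if "k \<in> P" for k
    by (intro open_Collect_less continuous_intros continuous_on_l_fst[OF that])
  moreover have "{Z. \<forall>k\<in>P. norm (l k (fst Z)) > r k} = (\<Inter>k\<in>P. {Z :: 'a \<times> 'a. norm (l k (fst Z)) > r k})"
    by auto
  ultimately have "open {Z :: 'a \<times> 'a. \<forall>k\<in>P. norm (l k (fst Z)) > r k}"
    using finite_P by auto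
  then show "{Z. \<forall>k\<in>P. norm (l k (fst Z)) > r k} \<subseteq> interior table"
    by (intro interior_maximal) (auto simp: table_def intro: less_imp_le)
  show "interior table \<subseteq> {Z. \<forall>k\<in>P. norm (l k (fst Z)) > r k}"
  proof (intro subsetI CollectI ballI)
    fix Z k assume Z: "Z \<in> interior table" and k: "k \<in> P"
    interpret k: cylinder "l k" "j k" "r k" e
      by (rule cylinder[OF k])
    \<comment> \<open>Shrinking the positions slightly would push a state in contact into the
      scatterer, so an interior point cannot be in contact.\<close>
    have "((\<lambda>c. (c *\<^sub>R fst Z, snd Z)) \<longlongrightarrow> (1 *\<^sub>R fst Z, snd Z)) (at_left (1::real))"
      by (intro tendsto_intros)
    then have "eventually (\<lambda>c. (c *\<^sub>R fst Z, snd Z) \<in> interior table) (at_left 1)"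
      using Z by (intro topological_tendstoD) auto
    moreover have "eventually (\<lambda>c. c \<in> {0<..<1}) (at_left (1::real))"
      by (rule eventually_at_left_real) simp
    ultimately have "eventually (\<lambda>c. norm (l k (fst Z)) > r k) (at_left (1::real))"
    proof eventually_elim
      case (elim c)
      have "(c *\<^sub>R fst Z, snd Z) \<in> table"
        using elim(1) interior_subset by blast
      then have "r k \<le> c * norm (l k (fst Z))"
        using k elim(2) by (auto simp: table_def k.l_simps)
      moreover have "c * norm (l k (fst Z)) < 1 * norm (l k (fst Z))"
        using elim(2) calculation k.r_pos by (intro mult_strict_right_mono) (auto simp: zero_less_mult_iff)
      ultimately show ?case
        by simp
    qed
    then show "norm (l k (fst Z)) > r k"
      by (simp add: eventually_const_iff trivial_limit_at_left_real)
  qed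
qed

lemma frontier_table: "Z \<in> frontier table \<longleftrightarrow> Z \<in> table \<and> (\<exists>k\<in>P. norm (l k (fst Z)) = r k)"
proof -
  have "frontier table = table - {Z. \<forall>k\<in>P. norm (l k (fst Z)) > r k}"
    using closed_table by (simp add: frontier_def interior_table)
  moreover have "norm (l k (fst Z)) > r k \<longleftrightarrow> norm (l k (fst Z)) \<noteq> r k" if "Z \<in> table" "k \<in> P" for k
    using that by (auto simp: table_def less_le)
  ultimately show ?thesis
    by auto
qed

lemma Phi_near_interior:
  assumes Z: "Z \<in> global" and out: "\<And>k. k \<in> P \<Longrightarrow> norm (l k (fst (Phi t Z))) > r k"
  obtains h where "h > 0" "\<And>s. \<bar>s\<bar> \<le> h \<Longrightarrow> Phi (t + s) Z = drift s (Phi t Z)"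
proof -
  define W where "W = Phi t Z"
  obtain i h where i: "i \<in> P" "legal i W" and h: "h > 0" "\<And>s. \<bar>s\<bar> \<le> h \<Longrightarrow> Phi s W = flow i s W"
    using global_local_flow[OF Phi_global[OF Z, of t]] unfolding W_def by metis
  interpret i: cylinder "l i" "j i" "r i" e
    by (rule cylinder[OF i(1)])
  have "continuous_on UNIV (\<lambda>s. norm (i.rel (drift s W)))"
    unfolding i.rel_drift by (intro continuous_intros)
  then have "open ((\<lambda>s. norm (i.rel (drift s W))) -` {r i<..})"
    by (intro open_vimage) auto
  moreover have "0 \<in> (\<lambda>s. norm (i.rel (drift s W))) -` {r i<..}"
    using out[OF i(1)] by (simp add: W_def i.rel_def)
  ultimately obtain d where d: "d > 0" "ball 0 d \<subseteq> (\<lambda>s. norm (i.rel (drift s W))) -` {r i<..}"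
    by (meson open_contains_ball)
  have "Phi (t + s) Z = drift s (Phi t Z)" if s: "\<bar>s\<bar> \<le> min h (d / 2)" for s
  proof -
    have "norm (i.rel (drift u W)) > r i" if "u \<in> closed_segment 0 s" for u
    proof -
      have "u \<in> ball 0 d"
        using that s d(1) by (auto simp: closed_segment_eq_real_ivl split: if_splits)
      then show ?thesis
        using d(2) by blast
    qed
    then have "flow i s W = drift s W"
      by (rule i.flow_eq_drift[OF i(2)])
    then show ?thesis
      using h(2)[of s] s Phi_Phi[OF Z, of s t] by (simp add: W_def add.commute)
  qed
  then show ?thesis
    using that[of "min h (d / 2)"] h(1) d(1) by simp
qed

text \<open>Locally all inactive scatterers are at positive distance, so the one that is touched is
  the active one and its two-body flow describes both sides of the collision.\<close>

lemma Phi_near_boundary: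
  assumes Z: "Z \<in> global" and k: "k \<in> P" "norm (l k (fst (Phi t Z))) = r k"
  obtains h where
    "\<And>i. i \<in> P - {k} \<Longrightarrow> norm (l i (fst (Phi t Z))) > r i"
    "l k (fst (Phi t Z)) \<bullet> l k (snd (Phi t Z)) > 0"
    "h > 0" "\<And>s. 0 \<le> s \<Longrightarrow> s \<le> h \<Longrightarrow> Phi (t + s) Z = drift s (Phi t Z)"
    "\<And>s. - h \<le> s \<Longrightarrow> s < 0 \<Longrightarrow> Phi (t + s) Z = drift s (fst (Phi t Z),
        cylinder.mirror (l k) (j k) (r k) (l k (fst (Phi t Z))) (snd (Phi t Z)))"
proof -
  define W where "W = Phi t Z"
  obtain i h where i: "i \<in> P" "legal i W" "\<And>k. k \<in> P - {i} \<Longrightarrow> norm (l k (fst W)) > r k"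
    and h: "h > 0" "\<And>s. \<bar>s\<bar> \<le> h \<Longrightarrow> Phi s W = flow i s W"
    using global_local_flow[OF Phi_global[OF Z, of t]] unfolding W_def by metis
  have ik: "i = k"
    using i(3)[of k] k by (auto simp: W_def)
  interpret k: cylinder "l k" "j k" "r k" e
    by (rule cylinder[OF k(1)])
  have W: "k.legal W" "norm (k.rel W) = r k"
    using i k by (simp_all add: ik W_def k.rel_def)
  have "Phi (t + s) Z = flow k s W" if "\<bar>s\<bar> \<le> h" for s
    using h(2)[OF that] Phi_Phi[OF Z, of s t] by (simp add: W_def ik add.commute)
  then show ?thesis
    using that[of h] i(3) h(1) W(1) k.flow_at_contact[OF W] k(2)
    by (simp add: ik W_def k.rel_def k.rvel_def k.legal_def)
qed

end

section \<open>Hard spheres\<close>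

definition pair_diff :: "'p \<times> 'p \<Rightarrow> (real ^ 'd) ^ 'p::finite \<Rightarrow> real ^ 'd" where
  "pair_diff i X = X $ fst i - X $ snd i"

text \<open>The two shares add up to 2, so the relative velocity changes by
  \<open>2 *\<^sub>R w\<close>; weighted with the masses they are equal, so momentum is
  conserved.\<close>

definition pair_push :: "('p \<Rightarrow> real) \<Rightarrow> 'p \<times> 'p \<Rightarrow> real ^ 'd \<Rightarrow> (real ^ 'd) ^ 'p::finite" where
  "pair_push m i w = (\<chi> s. if s = fst i then (2 * m (snd i) / (m (fst i) + m (snd i))) *\<^sub>R w
     else if s = snd i then - ((2 * m (fst i) / (m (fst i) + m (snd i))) *\<^sub>R w) else 0)"

text \<open>
  The square root of the energy, normalised so that it dominates the Euclidean norm of the velocities.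
\<close>

definition speed :: "('p \<Rightarrow> real) \<Rightarrow> real \<Rightarrow> (real ^ 'd) ^ 'p::finite \<Rightarrow> real" where
  "speed m \<mu> V = sqrt ((\<Sum>p\<in>UNIV. m p * (norm (V $ p))\<^sup>2) / \<mu>)"

lemma cylinder_pair:
  fixes m :: "'p::finite \<Rightarrow> real" and p q :: 'p
  assumes m: "\<And>p. m p \<ge> \<mu>" "\<mu> > 0" and r: "r > 0" and pq: "p \<noteq> q"
  shows "cylinder (pair_diff (p, q) :: (real ^ 'd) ^ 'p \<Rightarrow> real ^ 'd) (pair_push m (p, q)) r (speed m \<mu>)"
proof (rule cylinder.intro)
  have mp: "m s > 0" for s
    using m(1)[of s] m(2) by linarith
  define a where "a = 2 * m q / (m p + m q)"
  define b where "b = 2 * m p / (m p + m q)"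
  have neq: "m p + m q \<noteq> 0"
    using mp[of p] mp[of q] by linarith
  have "a + b = (2 * m q + 2 * m p) / (m p + m q)"
    by (simp only: a_def b_def add_divide_distrib)
  also have "\<dots> = 2"
    by (subst nonzero_divide_eq_eq[OF neq]) simp
  finally have "a + b = 2" .
  moreover have "m p * a = m q * b"
    by (simp add: a_def b_def)
  ultimately have ab: "a + b = 2" "m p * a = m q * b"
    by blast+
  show "linear (pair_diff (p, q) :: (real ^ 'd) ^ 'p \<Rightarrow> real ^ 'd)"
    by (rule linearI) (simp_all add: pair_diff_def algebra_simps)
  show "linear (pair_push m (p, q) :: real ^ 'd \<Rightarrow> _)"
    by (rule linearI) (simp_all add: pair_push_def vec_eq_iff algebra_simps)
  have push: "pair_push m (p, q) w $ s = (if s = p then a *\<^sub>R w else if s = q then - (b *\<^sub>R w) else 0)"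
    for w :: "real ^ 'd" and s
    by (simp add: pair_push_def a_def b_def)
  show "pair_diff (p, q) (pair_push m (p, q) w) = 2 *\<^sub>R w" for w :: "real ^ 'd"
    using ab(1) pq by (simp add: pair_diff_def push scaleR_add_left[symmetric])
  show "r > 0"
    by (rule r)
  show "norm V \<le> speed m \<mu> V" for V :: "(real ^ 'd) ^ 'p"
  proof -
    have "(norm V)\<^sup>2 = (\<Sum>s\<in>UNIV. (norm (V $ s))\<^sup>2)"
      by (simp add: norm_vec_def L2_set_def sum_nonneg)
    also have "\<dots> \<le> (\<Sum>s\<in>UNIV. m s * (norm (V $ s))\<^sup>2 / \<mu>)"
      using m by (intro sum_mono) (simp add: field_simps mult_right_mono)
    finally show ?thesis
      by (simp add: speed_def sum_divide_distrib[symmetric] real_le_rsqrt)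
  qed
  show "speed m \<mu> (V - (pair_diff (p, q) V \<bullet> n) *\<^sub>R pair_push m (p, q) n) = speed m \<mu> V"
    if n: "norm n = 1" for V :: "(real ^ 'd) ^ 'p" and n
  proof -
    define c where "c = pair_diff (p, q) V \<bullet> n"
    define V' where "V' = V - c *\<^sub>R pair_push m (p, q) n"
    have nn: "n \<bullet> n = 1"
      using n by (simp add: dot_square_norm)
    have V': "V' $ p = V $ p - (c * a) *\<^sub>R n" "V' $ q = V $ q + (c * b) *\<^sub>R n"
      "s \<noteq> p \<Longrightarrow> s \<noteq> q \<Longrightarrow> V' $ s = V $ s" for s
      using pq by (simp_all add: V'_def push)
    have c: "c = V $ p \<bullet> n - V $ q \<bullet> n"
      by (simp add: c_def pair_diff_def inner_diff_left)
    have sq: "(norm (x + k *\<^sub>R n))\<^sup>2 = (norm x)\<^sup>2 + 2 * k * (x \<bullet> n) + k\<^sup>2" for x k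
      unfolding power2_norm_eq_inner
      by (simp add: inner_add_left inner_add_right nn inner_commute power2_eq_square algebra_simps)
    have np: "(norm (V' $ p))\<^sup>2 = (norm (V $ p))\<^sup>2 - 2 * (c * a) * (V $ p \<bullet> n) + (c * a)\<^sup>2"
      using sq[of "V $ p" "- (c * a)"] by (simp add: V')
    have nq: "(norm (V' $ q))\<^sup>2 = (norm (V $ q))\<^sup>2 + 2 * (c * b) * (V $ q \<bullet> n) + (c * b)\<^sup>2"
      using sq[of "V $ q" "c * b"] by (simp add: V')
    \<comment> \<open>Energy balance of the pair: the common value \<open>m p * a = m q * b\<close>
      factors out, and what remains is \<open>c\<^sup>2 * (a + b) - 2 * c * c\<close>, which
      vanishes since \<open>a + b = 2\<close>.\<close>
    have "m p * (norm (V' $ p))\<^sup>2 + m q * (norm (V' $ q))\<^sup>2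
        = m p * (norm (V $ p))\<^sup>2 + m q * (norm (V $ q))\<^sup>2
          + (m p * a) * (c\<^sup>2 * a - 2 * c * (V $ p \<bullet> n)) + (m q * b) * (c\<^sup>2 * b + 2 * c * (V $ q \<bullet> n))"
      unfolding np nq by (simp add: algebra_simps power2_eq_square)
    also have "\<dots> = m p * (norm (V $ p))\<^sup>2 + m q * (norm (V $ q))\<^sup>2 + (m p * a) * (c\<^sup>2 * (a + b) - 2 * c * c)"
      unfolding ab(2)[symmetric] by (subst (4) c) (simp add: algebra_simps)
    also have "\<dots> = m p * (norm (V $ p))\<^sup>2 + m q * (norm (V $ q))\<^sup>2"
      by (simp add: ab(1) power2_eq_square)
    finally have two: "m p * (norm (V' $ p))\<^sup>2 + m q * (norm (V' $ q))\<^sup>2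
      = m p * (norm (V $ p))\<^sup>2 + m q * (norm (V $ q))\<^sup>2" .
    have split: "(\<Sum>s\<in>UNIV. f s) = f p + f q + (\<Sum>s\<in>UNIV - {p, q}. f s)" for f :: "'p \<Rightarrow> real"
    proof -
      have "(\<Sum>s\<in>UNIV. f s) = (\<Sum>s\<in>UNIV - {p, q}. f s) + (\<Sum>s\<in>{p, q}. f s)"
        by (rule sum.subset_diff) auto
      then show ?thesis
        using pq by simp
    qed
    have "(\<Sum>s\<in>UNIV. m s * (norm (V' $ s))\<^sup>2) = (\<Sum>s\<in>UNIV. m s * (norm (V $ s))\<^sup>2)"
      unfolding split two by (intro arg_cong2[where f="(+)"] sum.cong refl) (auto simp: V'(3))
    then show ?thesis
      by (simp add: speed_def V'_def c_def)
  qed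
qed

lemma particle_pairs_neq: "(p, q) \<in> particle_pairs \<Longrightarrow> p \<noteq> q"
  by (auto simp: particle_pairs_def)

lemma particle_pairs_asym: "(p, q) \<in> particle_pairs \<Longrightarrow> (q, p) \<notin> particle_pairs"
  by (auto simp: particle_pairs_def)

lemma per_species_ge_min: "min a b \<le> per_species a b p"
  by (simp add: per_species_def split: sum.splits)

definition pair_dist :: "real \<Rightarrow> real \<Rightarrow> ('n1 + 'n2) \<times> ('n1 + 'n2) \<Rightarrow> real" where
  "pair_dist \<epsilon>\<^sub>1 \<epsilon>\<^sub>2 i = contact_distance \<epsilon>\<^sub>1 \<epsilon>\<^sub>2 (fst i) (snd i)"

text \<open>The \<open>itself\<close> parameters fix the types for the dimension and the particle
  labels, so that the sublocale below is formed at definite types.\<close>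

locale hard_spheres =
  fixes M\<^sub>1 M\<^sub>2 \<epsilon>\<^sub>1 \<epsilon>\<^sub>2 :: real and dim :: "'d::finite itself"
    and species\<^sub>1 :: "'n1::{finite,linorder} itself" and species\<^sub>2 :: "'n2::{finite,linorder} itself"
  assumes M1: "M\<^sub>1 > 0" and M2: "M\<^sub>2 > 0" and eps1: "\<epsilon>\<^sub>1 > 0" and eps2: "\<epsilon>\<^sub>2 > 0"
begin

lemma billiard:
  "billiard (particle_pairs :: (('n1 + 'n2) \<times> ('n1 + 'n2)) set)
     (pair_diff :: _ \<Rightarrow> (real ^ 'd) ^ ('n1 + 'n2) \<Rightarrow> real ^ 'd)
     (pair_push (per_species M\<^sub>1 M\<^sub>2)) (pair_dist \<epsilon>\<^sub>1 \<epsilon>\<^sub>2) (speed (per_species M\<^sub>1 M\<^sub>2) (min M\<^sub>1 M\<^sub>2))"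
proof (rule billiard.intro)
  show "finite (particle_pairs :: (('n1 + 'n2) \<times> ('n1 + 'n2)) set)"
    by (rule finite_subset[OF subset_UNIV]) simp
  show "(particle_pairs :: (('n1 + 'n2) \<times> ('n1 + 'n2)) set) \<noteq> {}"
    by (auto simp: particle_pairs_def)
  show "cylinder (pair_diff i :: (real ^ 'd) ^ ('n1 + 'n2) \<Rightarrow> real ^ 'd) (pair_push (per_species M\<^sub>1 M\<^sub>2) i)
      (pair_dist \<epsilon>\<^sub>1 \<epsilon>\<^sub>2 i) (speed (per_species M\<^sub>1 M\<^sub>2) (min M\<^sub>1 M\<^sub>2))" if i: "i \<in> particle_pairs" for i
  proof (cases i)
    case (Pair p q)
    have "pair_dist \<epsilon>\<^sub>1 \<epsilon>\<^sub>2 i > 0"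
      using eps1 eps2
      by (cases "fst i"; cases "snd i") (simp_all add: pair_dist_def contact_distance_def per_species_def)
    moreover have "min M\<^sub>1 M\<^sub>2 > 0" "p \<noteq> q"
      using M1 M2 particle_pairs_neq i by (auto simp: Pair)
    ultimately show ?thesis
      unfolding Pair by (intro cylinder_pair per_species_ge_min)
  qed
  show "\<exists>h. linear h \<and> (\<forall>y :: real ^ 'd. pair_diff i (h y) = y) \<and> (\<forall>y. pair_diff k (h y) = 0)"
    if "i \<in> particle_pairs" "k \<in> particle_pairs" "i \<noteq> k" for i k :: "('n1 + 'n2) \<times> ('n1 + 'n2)"
  proof -
    have neq: "fst i \<noteq> snd i"
      using particle_pairs_neq[of "fst i" "snd i"] that(1) by simp
    \<comment> \<open>Two different pairs have different underlying sets, because no pair occurs in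
      both orders. Hence some particle of \<open>i\<close> does not belong to \<open>k\<close>, and
      moving it alone realises the required shift.\<close>
    have "fst i \<notin> {fst k, snd k} \<or> snd i \<notin> {fst k, snd k}"
      using that neq particle_pairs_asym[of "fst i" "snd i"] by (auto simp: prod_eq_iff)
    then show ?thesis
    proof
      assume *: "fst i \<notin> {fst k, snd k}"
      have "linear (\<lambda>y :: real ^ 'd. (\<chi> s. if s = fst i then y else 0) :: (real ^ 'd) ^ ('n1 + 'n2))"
        by (rule linearI) (auto simp: vec_eq_iff)
      then show ?thesis
        using * neq by (intro exI[of _ "\<lambda>y. \<chi> s. if s = fst i then y else 0"]) (auto simp: pair_diff_def)
    next
      assume *: "snd i \<notin> {fst k, snd k}"
      have "linear (\<lambda>y :: real ^ 'd. (\<chi> s. if s = snd i then - y else 0) :: (real ^ 'd) ^ ('n1 + 'n2))"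
        by (rule linearI) (auto simp: vec_eq_iff)
      then show ?thesis
        using * neq by (intro exI[of _ "\<lambda>y. \<chi> s. if s = snd i then - y else 0"]) (auto simp: pair_diff_def)
    qed
  qed
  show "norm (pair_diff i X) \<le> 2 * norm X" for i and X :: "(real ^ 'd) ^ ('n1 + 'n2)"
    using norm_triangle_ineq4[of "X $ fst i" "X $ snd i"] Finite_Cartesian_Product.norm_nth_le[of X "fst i"] Finite_Cartesian_Product.norm_nth_le[of X "snd i"]
    by (simp add: pair_diff_def)
  show "continuous_on UNIV (speed (per_species M\<^sub>1 M\<^sub>2) (min M\<^sub>1 M\<^sub>2) :: (real ^ 'd) ^ ('n1 + 'n2) \<Rightarrow> real)"
    unfolding speed_def[abs_def] using M1 M2 by (intro continuous_intros) auto
qed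

sublocale billiard "particle_pairs :: (('n1 + 'n2) \<times> ('n1 + 'n2)) set"
  "pair_diff :: _ \<Rightarrow> (real ^ 'd) ^ ('n1 + 'n2) \<Rightarrow> real ^ 'd"
  "pair_push (per_species M\<^sub>1 M\<^sub>2)" "pair_dist \<epsilon>\<^sub>1 \<epsilon>\<^sub>2" "speed (per_species M\<^sub>1 M\<^sub>2) (min M\<^sub>1 M\<^sub>2)"
  by (rule billiard)

abbreviation mirror where
  "mirror i \<equiv> cylinder.mirror (pair_diff i) (pair_push (per_species M\<^sub>1 M\<^sub>2) i) (pair_dist \<epsilon>\<^sub>1 \<epsilon>\<^sub>2 i)"

lemma phase_space_eq: "phase_space \<epsilon>\<^sub>1 \<epsilon>\<^sub>2 = table"
  by (auto simp: phase_space_def table_def pair_diff_def pair_dist_def)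

lemma energy_eq: "energy M\<^sub>1 M\<^sub>2 (Z :: ('d, 'n1, 'n2) config)
    = min M\<^sub>1 M\<^sub>2 * (speed (per_species M\<^sub>1 M\<^sub>2) (min M\<^sub>1 M\<^sub>2) (snd Z))\<^sup>2"
proof -
  have "0 \<le> (\<Sum>p\<in>UNIV. per_species M\<^sub>1 M\<^sub>2 p * (norm (vel Z p))\<^sup>2)"
    using M1 M2 by (intro sum_nonneg mult_nonneg_nonneg) (auto simp: per_species_def split: sum.splits)
  then show ?thesis
    using M1 M2 by (simp add: energy_def speed_def)
qed

lemma simple_collision_iff:
  fixes Z :: "('d, 'n1, 'n2) config"
  assumes "i \<in> particle_pairs"
  shows "Z \<in> simple_collision_surface \<epsilon>\<^sub>1 \<epsilon>\<^sub>2 (fst i) (snd i) \<longleftrightarrow>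
    norm (pair_diff i (fst Z)) = pair_dist \<epsilon>\<^sub>1 \<epsilon>\<^sub>2 i \<and>
    (\<forall>k\<in>particle_pairs - {i}. norm (pair_diff k (fst Z)) > pair_dist \<epsilon>\<^sub>1 \<epsilon>\<^sub>2 k)"
proof -
  have "Z \<in> collision_surface \<epsilon>\<^sub>1 \<epsilon>\<^sub>2 (fst k) (snd k) \<longleftrightarrow>
      Z \<in> table \<and> norm (pair_diff k (fst Z)) = pair_dist \<epsilon>\<^sub>1 \<epsilon>\<^sub>2 k" for k
    by (simp add: collision_surface_def phase_space_eq pair_diff_def pair_dist_def)
  then have "Z \<in> simple_collision_surface \<epsilon>\<^sub>1 \<epsilon>\<^sub>2 (fst i) (snd i) \<longleftrightarrow>
    Z \<in> frontier table \<and> Z \<in> table \<and> norm (pair_diff i (fst Z)) = pair_dist \<epsilon>\<^sub>1 \<epsilon>\<^sub>2 i \<and>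
    (\<forall>k\<in>particle_pairs - {i}. Z \<in> table \<longrightarrow> norm (pair_diff k (fst Z)) \<noteq> pair_dist \<epsilon>\<^sub>1 \<epsilon>\<^sub>2 k)"
    unfolding simple_collision_surface_def phase_space_eq by (auto simp: split_def)
  also have "\<dots> \<longleftrightarrow> norm (pair_diff i (fst Z)) = pair_dist \<epsilon>\<^sub>1 \<epsilon>\<^sub>2 i \<and>
    (\<forall>k\<in>particle_pairs - {i}. norm (pair_diff k (fst Z)) > pair_dist \<epsilon>\<^sub>1 \<epsilon>\<^sub>2 k)"
  proof -
    have strict: "norm (pair_diff k (fst Z)) > pair_dist \<epsilon>\<^sub>1 \<epsilon>\<^sub>2 k \<longleftrightarrow> norm (pair_diff k (fst Z)) \<noteq> pair_dist \<epsilon>\<^sub>1 \<epsilon>\<^sub>2 k"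
      if "Z \<in> table" "k \<in> particle_pairs" for k
      using that unfolding table_def by (simp add: less_le eq_commute)
    have "Z \<in> table" if "norm (pair_diff i (fst Z)) = pair_dist \<epsilon>\<^sub>1 \<epsilon>\<^sub>2 i"
      "\<forall>k\<in>particle_pairs - {i}. norm (pair_diff k (fst Z)) > pair_dist \<epsilon>\<^sub>1 \<epsilon>\<^sub>2 k"
      unfolding table_def
    proof (intro CollectI ballI)
      fix k :: "('n1 + 'n2) \<times> ('n1 + 'n2)" assume "k \<in> particle_pairs"
      then show "norm (pair_diff k (fst Z)) \<ge> pair_dist \<epsilon>\<^sub>1 \<epsilon>\<^sub>2 k"
        using that by (cases "k = i") (auto intro: less_imp_le)
    qed
    then show ?thesis
      using assms strict frontier_table by blast
  qed
  finally show ?thesis .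
qed

lemma impact_eq:
  fixes Z :: "('d, 'n1, 'n2) config"
  assumes i: "i \<in> particle_pairs" and Z: "Z \<in> simple_collision_surface \<epsilon>\<^sub>1 \<epsilon>\<^sub>2 (fst i) (snd i)"
  shows "impact M\<^sub>1 M\<^sub>2 \<epsilon>\<^sub>1 \<epsilon>\<^sub>2 Z = (fst Z, mirror i (pair_diff i (fst Z)) (snd Z))"
proof -
  interpret i: cylinder "pair_diff i :: _ \<Rightarrow> real ^ 'd" "pair_push (per_species M\<^sub>1 M\<^sub>2) i" "pair_dist \<epsilon>\<^sub>1 \<epsilon>\<^sub>2 i"
    "speed (per_species M\<^sub>1 M\<^sub>2) (min M\<^sub>1 M\<^sub>2)"
    by (rule cylinder[OF i])
  have dist: "norm (pair_diff i (fst Z)) = pair_dist \<epsilon>\<^sub>1 \<epsilon>\<^sub>2 i"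
    using Z simple_collision_iff[OF i] by blast
  have "(THE (p, q). (p, q) \<in> particle_pairs \<and> Z \<in> simple_collision_surface \<epsilon>\<^sub>1 \<epsilon>\<^sub>2 p q) = i"
  proof (rule the_equality)
    show "case i of (p, q) \<Rightarrow> (p, q) \<in> particle_pairs \<and> Z \<in> simple_collision_surface \<epsilon>\<^sub>1 \<epsilon>\<^sub>2 p q"
      using i Z by (simp add: split_def)
    fix k :: "('n1 + 'n2) \<times> ('n1 + 'n2)"
    assume "case k of (p, q) \<Rightarrow> (p, q) \<in> particle_pairs \<and> Z \<in> simple_collision_surface \<epsilon>\<^sub>1 \<epsilon>\<^sub>2 p q"
    then have k: "k \<in> particle_pairs" "Z \<in> simple_collision_surface \<epsilon>\<^sub>1 \<epsilon>\<^sub>2 (fst k) (snd k)"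
      by (simp_all add: split_def)
    show "k = i"
    proof (rule ccontr)
      assume "k \<noteq> i"
      then have "norm (pair_diff k (fst Z)) > pair_dist \<epsilon>\<^sub>1 \<epsilon>\<^sub>2 k"
        using Z k(1) simple_collision_iff[OF i] by blast
      moreover have "norm (pair_diff k (fst Z)) = pair_dist \<epsilon>\<^sub>1 \<epsilon>\<^sub>2 k"
        using k simple_collision_iff[OF k(1)] by blast
      ultimately show False
        by simp
    qed
  qed
  then have "impact M\<^sub>1 M\<^sub>2 \<epsilon>\<^sub>1 \<epsilon>\<^sub>2 Z = impact_at M\<^sub>1 M\<^sub>2 (fst i) (snd i) Z"
    by (simp add: impact_def split_def)
  \<comment> \<open>The impact operator normalises the direction twice, \<open>mirror\<close>
    divides once by the square of the contact distance; at contact these agree.\<close>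
  also have "\<dots> = (fst Z, i.mirror (pair_diff i (fst Z)) (snd Z))"
    using i.r_pos dist[unfolded pair_diff_def] particle_pairs_neq[of "fst i" "snd i"] i
    by (auto simp: impact_at_def Let_def i.mirror_def pair_push_def pair_diff_def vec_eq_iff power2_eq_square divide_inverse)
  finally show ?thesis .
qed

end

context hard_spheres
begin

lemma mirror_facts:
  fixes Z :: "('d, 'n1, 'n2) config"
  assumes i: "i \<in> particle_pairs" and Z: "norm (pair_diff i (fst Z)) = pair_dist \<epsilon>\<^sub>1 \<epsilon>\<^sub>2 i"
  shows "mirror i (pair_diff i (fst Z)) (mirror i (pair_diff i (fst Z)) V) = V"
    "pair_diff i (fst Z) \<bullet> pair_diff i (mirror i (pair_diff i (fst Z)) V) = - (pair_diff i (fst Z) \<bullet> pair_diff i V)"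
  using cylinder.mirror_mirror[OF cylinder[OF i] Z] cylinder.mirror_inner[OF cylinder[OF i] Z] by auto

lemma hard_sphere_trajectory_Phi:
  fixes Z :: "('d, 'n1, 'n2) config"
  assumes Z: "Z \<in> global"
  shows "hard_sphere_trajectory M\<^sub>1 M\<^sub>2 \<epsilon>\<^sub>1 \<epsilon>\<^sub>2 Z (\<lambda>t. Phi t Z)"
  unfolding hard_sphere_trajectory_def phase_space_eq
proof (intro conjI allI impI)
  show "Phi 0 Z = Z"
    by (rule Phi_0)
  show "Phi t Z \<in> table" for t
    using Phi_global[OF Z] global_subset_table by blast
next
  fix t p assume "Phi t Z \<in> interior table"
  then obtain h where h: "h > 0" "\<And>s. \<bar>s\<bar> \<le> h \<Longrightarrow> Phi (t + s) Z = drift s (Phi t Z)"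
    using Phi_near_interior[OF Z, of t] by (auto simp: interior_table)
  have eq: "drift (s - t) (Phi t Z) = Phi s Z" if "s \<in> {t - h<..<t + h}" for s
  proof -
    have "\<bar>s - t\<bar> \<le> h"
      using that by auto
    then show ?thesis
      using h(2)[of "s - t"] by simp
  qed
  have "((\<lambda>s. pos (drift (s - t) (Phi t Z)) p) has_vector_derivative vel (Phi t Z) p) (at t)"
    by (auto intro!: derivative_eq_intros)
  then show "((\<lambda>s. pos (Phi s Z) p) has_vector_derivative vel (Phi t Z) p) (at t)"
    by (rule has_vector_derivative_transform_within_open[where S="{t - h<..<t + h}"]) (use h(1) eq in auto)
  have "((\<lambda>s. vel (drift (s - t) (Phi t Z)) p) has_vector_derivative 0) (at t)"
    by (auto intro!: derivative_eq_intros)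
  then show "((\<lambda>s. vel (Phi s Z) p) has_vector_derivative 0) (at t)"
    by (rule has_vector_derivative_transform_within_open[where S="{t - h<..<t + h}"]) (use h(1) eq in auto)
next
  fix t assume "Phi t Z \<in> frontier table"
  then obtain k where k: "k \<in> particle_pairs" "norm (pair_diff k (fst (Phi t Z))) = pair_dist \<epsilon>\<^sub>1 \<epsilon>\<^sub>2 k"
    by (auto simp: frontier_table)
  define W where "W = Phi t Z"
  \<comment> \<open>\<open>Phi\<close> holds the outgoing state at contact, so the left limit is its
    mirror image; the impact operator leads back to \<open>W\<close> because the mirror is an
    involution.\<close>
  define Z' where "Z' = (fst W, mirror k (pair_diff k (fst W)) (snd W))"
  obtain h where others: "\<And>i. i \<in> particle_pairs - {k} \<Longrightarrow> norm (pair_diff i (fst W)) > pair_dist \<epsilon>\<^sub>1 \<epsilon>\<^sub>2 i"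
    and out: "pair_diff k (fst W) \<bullet> pair_diff k (snd W) > 0"
    and h: "h > 0" "\<And>s. 0 \<le> s \<Longrightarrow> s \<le> h \<Longrightarrow> Phi (t + s) Z = drift s W"
      "\<And>s. - h \<le> s \<Longrightarrow> s < 0 \<Longrightarrow> Phi (t + s) Z = drift s Z'"
    using Phi_near_boundary[OF Z k] unfolding W_def Z'_def by blast
  have dist: "norm (pair_diff k (fst W)) = pair_dist \<epsilon>\<^sub>1 \<epsilon>\<^sub>2 k"
    using k(2) by (simp add: W_def)
  have simple: "Z' \<in> simple_collision_surface \<epsilon>\<^sub>1 \<epsilon>\<^sub>2 (fst k) (snd k)"
    using simple_collision_iff[OF k(1), of Z'] dist others by (simp add: Z'_def)
  have "pair_diff k (fst Z') \<bullet> pair_diff k (snd Z') < 0"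
    using mirror_facts(2)[OF k(1) dist] out by (simp add: Z'_def)
  then have ng: "\<not> grazing (fst k) (snd k) Z'"
    by (simp add: grazing_def pair_diff_def)
  have impact: "impact M\<^sub>1 M\<^sub>2 \<epsilon>\<^sub>1 \<epsilon>\<^sub>2 Z' = W"
    using impact_eq[OF k(1) simple] mirror_facts(1)[OF k(1) dist] by (simp add: Z'_def)
  have lim: "((\<lambda>s. drift (s - t) Y) \<longlongrightarrow> Y) (at t within S)" for Y :: "('d, 'n1, 'n2) config" and S
  proof -
    have "((\<lambda>s. (fst Y + (s - t) *\<^sub>R snd Y, snd Y)) \<longlongrightarrow> (fst Y + (t - t) *\<^sub>R snd Y, snd Y)) (at t within S)"
      by (intro tendsto_intros)
    then show ?thesis
      by (simp add: drift_def)
  qed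
  have "eventually (\<lambda>s. s \<in> {t - h<..<t}) (at_left t)"
    using h(1) by (intro eventually_at_left_real) simp
  then have "eventually (\<lambda>s. drift (s - t) Z' = Phi s Z) (at_left t)"
  proof eventually_elim
    case (elim s)
    then show ?case
      using h(3)[of "s - t"] by simp
  qed
  then have left: "((\<lambda>s. Phi s Z) \<longlongrightarrow> Z') (at_left t)"
    by (rule Lim_transform_eventually[OF lim])
  have "eventually (\<lambda>s. s \<in> {t<..<t + h}) (at_right t)"
    using h(1) by (intro eventually_at_right_real) simp
  then have "eventually (\<lambda>s. drift (s - t) W = Phi s Z) (at_right t)"
  proof eventually_elim
    case (elim s)
    then show ?case
      using h(2)[of "s - t"] by simp
  qed
  then have right: "((\<lambda>s. Phi s Z) \<longlongrightarrow> W) (at_right t)"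
    by (rule Lim_transform_eventually[OF lim])
  have "Z' \<in> simple_nongrazing_boundary \<epsilon>\<^sub>1 \<epsilon>\<^sub>2"
    unfolding simple_nongrazing_boundary_def using k(1) simple ng by (auto simp: split_def intro!: bexI[of _ k])
  then show "\<exists>Z'\<in>simple_nongrazing_boundary \<epsilon>\<^sub>1 \<epsilon>\<^sub>2.
      ((\<lambda>t. Phi t Z) \<longlongrightarrow> Z') (at_left t) \<and>
      ((\<lambda>t. Phi t Z) \<longlongrightarrow> impact M\<^sub>1 M\<^sub>2 \<epsilon>\<^sub>1 \<epsilon>\<^sub>2 Z') (at_right t) \<and>
      Phi t Z \<in> {Z', impact M\<^sub>1 M\<^sub>2 \<epsilon>\<^sub>1 \<epsilon>\<^sub>2 Z'}"
    using left right by (intro bexI[of _ Z']) (simp_all add: impact W_def)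
qed

section \<open>Incoming contact states and the final family of maps\<close>

definition incoming :: "('d, 'n1, 'n2) config \<Rightarrow> bool" where
  "incoming Z \<longleftrightarrow> (\<exists>i\<in>particle_pairs. Z \<in> simple_collision_surface \<epsilon>\<^sub>1 \<epsilon>\<^sub>2 (fst i) (snd i) \<and>
     pair_diff i (fst Z) \<bullet> pair_diff i (snd Z) < 0)"

text \<open>
  The flow \<open>Phi\<close> keeps only outgoing states at contact. An incoming state is first replaced by its
  outgoing counterpart, so that the two have the same future.
\<close>

definition outgoing_state :: "('d, 'n1, 'n2) config \<Rightarrow> ('d, 'n1, 'n2) config" where
  "outgoing_state Z = (if incoming Z then impact M\<^sub>1 M\<^sub>2 \<epsilon>\<^sub>1 \<epsilon>\<^sub>2 Z else Z)"

text \<open>The default for states without a global trajectory is constant in time. It stays in the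
  table and depends on \<open>Z\<close> only through \<open>outgoing_state Z\<close>, so the impact
  identity extends to these states.\<close>

definition evolution :: "real \<Rightarrow> ('d, 'n1, 'n2) config \<Rightarrow> ('d, 'n1, 'n2) config" where
  "evolution t Z = (let Y = outgoing_state Z in if Y \<in> global then Phi t Y else Y)"

lemma incoming_iff:
  assumes i: "i \<in> particle_pairs" and Z: "Z \<in> simple_collision_surface \<epsilon>\<^sub>1 \<epsilon>\<^sub>2 (fst i) (snd i)"
  shows "incoming Z \<longleftrightarrow> pair_diff i (fst Z) \<bullet> pair_diff i (snd Z) < 0"
proof -
  have "k = i" if k: "k \<in> particle_pairs" "Z \<in> simple_collision_surface \<epsilon>\<^sub>1 \<epsilon>\<^sub>2 (fst k) (snd k)" for k
  proof (rule ccontr)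
    assume "k \<noteq> i"
    then have "norm (pair_diff k (fst Z)) > pair_dist \<epsilon>\<^sub>1 \<epsilon>\<^sub>2 k"
      using Z k(1) simple_collision_iff[OF i] by blast
    moreover have "norm (pair_diff k (fst Z)) = pair_dist \<epsilon>\<^sub>1 \<epsilon>\<^sub>2 k"
      using k simple_collision_iff[OF k(1)] by blast
    ultimately show False
      by simp
  qed
  then show ?thesis
    using i Z unfolding incoming_def by blast
qed

lemma impact_simple_collision:
  assumes i: "i \<in> particle_pairs" and Z: "Z \<in> simple_collision_surface \<epsilon>\<^sub>1 \<epsilon>\<^sub>2 (fst i) (snd i)"
  defines "Y \<equiv> impact M\<^sub>1 M\<^sub>2 \<epsilon>\<^sub>1 \<epsilon>\<^sub>2 (Z :: ('d, 'n1, 'n2) config)"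
  shows "Y \<in> simple_collision_surface \<epsilon>\<^sub>1 \<epsilon>\<^sub>2 (fst i) (snd i)" "impact M\<^sub>1 M\<^sub>2 \<epsilon>\<^sub>1 \<epsilon>\<^sub>2 Y = Z"
    "pair_diff i (fst Y) \<bullet> pair_diff i (snd Y) = - (pair_diff i (fst Z) \<bullet> pair_diff i (snd Z))"
proof -
  have Y: "Y = (fst Z, mirror i (pair_diff i (fst Z)) (snd Z))"
    unfolding Y_def by (rule impact_eq[OF i Z])
  have dist: "norm (pair_diff i (fst Z)) = pair_dist \<epsilon>\<^sub>1 \<epsilon>\<^sub>2 i"
    using Z simple_collision_iff[OF i] by blast
  show simple: "Y \<in> simple_collision_surface \<epsilon>\<^sub>1 \<epsilon>\<^sub>2 (fst i) (snd i)"
    using Z simple_collision_iff[OF i, of Z] simple_collision_iff[OF i, of Y] by (simp add: Y)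
  show "impact M\<^sub>1 M\<^sub>2 \<epsilon>\<^sub>1 \<epsilon>\<^sub>2 Y = Z"
    using impact_eq[OF i simple] mirror_facts(1)[OF i dist] by (simp add: Y)
  show "pair_diff i (fst Y) \<bullet> pair_diff i (snd Y) = - (pair_diff i (fst Z) \<bullet> pair_diff i (snd Z))"
    using mirror_facts(2)[OF i dist] by (simp add: Y)
qed

text \<open>The impact reverses the sign of the normal relative velocity, so exactly one of the two
  states is incoming, and it is replaced by the other one.\<close>

lemma outgoing_state_impact:
  assumes "Z \<in> simple_nongrazing_boundary \<epsilon>\<^sub>1 \<epsilon>\<^sub>2"
  shows "outgoing_state (impact M\<^sub>1 M\<^sub>2 \<epsilon>\<^sub>1 \<epsilon>\<^sub>2 Z) = outgoing_state Z"
proof -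
  obtain i where i: "i \<in> particle_pairs" and Z: "Z \<in> simple_collision_surface \<epsilon>\<^sub>1 \<epsilon>\<^sub>2 (fst i) (snd i)"
    and ng: "\<not> grazing (fst i) (snd i) Z"
    using assms by (auto simp: simple_nongrazing_boundary_def)
  have "pair_diff i (fst Z) \<bullet> pair_diff i (snd Z) \<noteq> 0"
    using ng by (simp add: grazing_def pair_diff_def)
  then show ?thesis
    using incoming_iff[OF i Z] incoming_iff[OF i impact_simple_collision(1)[OF i Z]]
      impact_simple_collision(2,3)[OF i Z]
    by (simp add: outgoing_state_def)
qed

lemma outgoing_state_global:
  assumes "Z \<in> global"
  shows "outgoing_state Z = Z"
proof -
  have "\<not> incoming Z"
  proof
    assume "incoming Z"
    then obtain i where i: "i \<in> particle_pairs" "Z \<in> simple_collision_surface \<epsilon>\<^sub>1 \<epsilon>\<^sub>2 (fst i) (snd i)"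
      "pair_diff i (fst Z) \<bullet> pair_diff i (snd Z) < 0"
      by (auto simp: incoming_def)
    have "norm (pair_diff i (fst (Phi 0 Z))) = pair_dist \<epsilon>\<^sub>1 \<epsilon>\<^sub>2 i"
      using i(2) simple_collision_iff[OF i(1)] by (simp add: Phi_0)
    from Phi_near_boundary[OF assms i(1) this] have "pair_diff i (fst Z) \<bullet> pair_diff i (snd Z) > 0"
      by (metis Phi_0)
    then show False
      using i(3) by simp
  qed
  then show ?thesis
    by (simp add: outgoing_state_def)
qed

lemma evolution_global: "Z \<in> global \<Longrightarrow> evolution t Z = Phi t Z"
  by (simp add: evolution_def outgoing_state_global)

lemma evolution_table:
  assumes "Z \<in> table"
  shows "evolution t Z \<in> table"
proof -
  have "fst (outgoing_state Z) = fst Z"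
  proof (cases "incoming Z")
    case True
    then obtain i where "i \<in> particle_pairs" "Z \<in> simple_collision_surface \<epsilon>\<^sub>1 \<epsilon>\<^sub>2 (fst i) (snd i)"
      by (auto simp: incoming_def)
    then show ?thesis
      by (simp add: outgoing_state_def impact_eq)
  qed (simp add: outgoing_state_def)
  then have "outgoing_state Z \<in> table"
    using assms by (simp add: table_def)
  then show ?thesis
    by (auto simp: evolution_def Let_def intro: Phi_global subsetD[OF global_subset_table])
qed

lemma AE_globalI:
  assumes "\<And>Z. Z \<in> global \<Longrightarrow> Q Z"
  shows "AE Z in lebesgue_on table. Q Z"
proof (rule AE_I')
  have "table \<in> sets lebesgue"
    using sets_table by simp
  then show "table - global \<in> null_sets (lebesgue_on table)"
    using negligible_not_global by (subst null_sets_restrict_space) (auto simp: negligible_iff_null_sets)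
  show "{Z \<in> space (lebesgue_on table). \<not> Q Z} \<subseteq> table - global"
    using assms by (auto simp: space_restrict_space)
qed

lemma measure_preserving_evolution: "measure_preserving_map (lebesgue_on table) (evolution t)"
proof -
  have T: "table \<in> sets lebesgue"
    using sets_table by simp
  have pre: "evolution t -` A \<inter> table \<in> sets lebesgue \<and>
      emeasure lebesgue (evolution t -` A \<inter> table) = emeasure lebesgue A"
    if A: "A \<in> sets lebesgue" "A \<subseteq> table" for A
  proof -
    \<comment> \<open>Outside \<open>global\<close> nothing is known about the shape of the
      preimage, but it lies in a null set and is therefore Lebesgue measurable.\<close>
    define N where "N = evolution t -` A \<inter> (table - global)"
    have N: "N \<in> null_sets lebesgue"
      using negligible_subset[OF negligible_not_global, of N] by (auto simp: N_def negligible_iff_null_sets)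
    have eq: "evolution t -` A \<inter> table = Phi_vimage t A \<union> N"
      using global_subset_table by (auto simp: Phi_vimage_def N_def evolution_global)
    have P: "Phi_vimage t A \<in> sets lebesgue"
      by (rule sets_Phi_vimage[OF A(1)])
    have "A - global \<in> null_sets lebesgue"
      using negligible_subset[OF negligible_not_global, of "A - global"] A(2)
      by (auto simp: negligible_iff_null_sets)
    then have "emeasure lebesgue ((A \<inter> global) \<union> (A - global)) = emeasure lebesgue (A \<inter> global)"
      using A(1) sets_global by (intro emeasure_Un_null_set) auto
    moreover have "(A \<inter> global) \<union> (A - global) = A"
      by auto
    moreover have "emeasure lebesgue (Phi_vimage t A \<union> N) = emeasure lebesgue (Phi_vimage t A)"
      by (rule emeasure_Un_null_set[OF P N])
    ultimately show ?thesis
      unfolding eq using P N emeasure_Phi_vimage[OF A(1), of t] by auto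
  qed
  have A': "A \<in> sets lebesgue" "A \<subseteq> table" if "A \<in> sets (lebesgue_on table)" for A
    using that T by (auto simp: sets_restrict_space_iff)
  have "evolution t \<in> lebesgue_on table \<rightarrow>\<^sub>M lebesgue_on table"
  proof (rule measurableI)
    show "evolution t Z \<in> space (lebesgue_on table)" if "Z \<in> space (lebesgue_on table)" for Z
      using that evolution_table by (simp add: space_restrict_space)
    show "evolution t -` A \<inter> space (lebesgue_on table) \<in> sets (lebesgue_on table)"
      if "A \<in> sets (lebesgue_on table)" for A
      using pre[OF A'[OF that]] T by (auto simp: space_restrict_space sets_restrict_space_iff)
  qed
  moreover have "emeasure (lebesgue_on table) (evolution t -` A \<inter> space (lebesgue_on table))
      = emeasure (lebesgue_on table) A" if "A \<in> sets (lebesgue_on table)" for A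
    using pre[OF A'[OF that]] A'[OF that] T by (simp add: space_restrict_space emeasure_restrict_space)
  ultimately show ?thesis
    by (simp add: measure_preserving_map_def)
qed

end

lemma hausdorff_measure_empty: "hausdorff_measure k {} = 0"
proof -
  have "hausdorff_premeasure k \<delta> ({} :: 'a::metric_space set) = 0" if "\<delta> > 0" for \<delta>
  proof -
    have "hausdorff_premeasure k \<delta> ({} :: 'a set) \<le> 0"
      unfolding hausdorff_premeasure_def
      by (rule INF_lower2[of "\<lambda>_. {}"]) (use that in auto)
    then show ?thesis
      by simp
  qed
  then show ?thesis
    by (simp add: hausdorff_measure_def)
qed

theorem theorem3p1:
  fixes M\<^sub>1 M\<^sub>2 \<epsilon>\<^sub>1 \<epsilon>\<^sub>2 :: real
  assumes "M\<^sub>1 > 0" "M\<^sub>2 > 0" "\<epsilon>\<^sub>1 > 0" "\<epsilon>\<^sub>2 > 0"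
  defines "D \<equiv> (phase_space \<epsilon>\<^sub>1 \<epsilon>\<^sub>2 ::
                 ('d::finite, 'n1::{finite,linorder}, 'n2::{finite,linorder}) config set)"
  shows "\<exists>\<Psi> :: real \<Rightarrow> ('d, 'n1, 'n2) config \<Rightarrow> ('d, 'n1, 'n2) config.
    (\<forall>t. \<Psi> t \<in> D \<rightarrow> D \<and> measure_preserving_map (lebesgue_on D) (\<Psi> t)) \<and>
    (AE Z in lebesgue_on D. hard_sphere_trajectory M\<^sub>1 M\<^sub>2 \<epsilon>\<^sub>1 \<epsilon>\<^sub>2 Z (\<lambda>t. \<Psi> t Z)) \<and>
    (\<forall>t\<ge>0. \<forall>s\<ge>0.
      (AE Z in lebesgue_on D.
         \<Psi> (t + s) Z = (\<Psi> t \<circ> \<Psi> s) Z \<and> (\<Psi> t \<circ> \<Psi> s) Z = (\<Psi> s \<circ> \<Psi> t) Z) \<and>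
      (AE Z in lebesgue_on D. energy M\<^sub>1 M\<^sub>2 (\<Psi> t Z) = energy M\<^sub>1 M\<^sub>2 Z) \<and>
      hausdorff_AE_on (2 * CARD('d) * (CARD('n1) + CARD('n2)) - 1)
        (simple_nongrazing_boundary \<epsilon>\<^sub>1 \<epsilon>\<^sub>2)
        (\<lambda>Z. \<Psi> t (impact M\<^sub>1 M\<^sub>2 \<epsilon>\<^sub>1 \<epsilon>\<^sub>2 Z) = \<Psi> t Z))"
proof -
  interpret hard_spheres M\<^sub>1 M\<^sub>2 \<epsilon>\<^sub>1 \<epsilon>\<^sub>2 "TYPE('d)" "TYPE('n1)" "TYPE('n2)"
    using assms by unfold_locales
  have D: "D = table"
    unfolding D_def by (rule phase_space_eq)
  show ?thesis
    unfolding D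
  proof (intro exI[of _ evolution] conjI allI impI)
    show "evolution t \<in> table \<rightarrow> table" for t
      using evolution_table by blast
    show "measure_preserving_map (lebesgue_on table) (evolution t)" for t
      by (rule measure_preserving_evolution)
    show "AE Z in lebesgue_on table. hard_sphere_trajectory M\<^sub>1 M\<^sub>2 \<epsilon>\<^sub>1 \<epsilon>\<^sub>2 Z (\<lambda>t. evolution t Z)"
      using hard_sphere_trajectory_Phi by (intro AE_globalI) (simp add: evolution_global)
    fix t s :: real
    show "AE Z in lebesgue_on table. evolution (t + s) Z = (evolution t \<circ> evolution s) Z \<and>
        (evolution t \<circ> evolution s) Z = (evolution s \<circ> evolution t) Z"
      by (intro AE_globalI) (simp add: evolution_global Phi_global Phi_Phi add.commute)
    show "AE Z in lebesgue_on table. energy M\<^sub>1 M\<^sub>2 (evolution t Z) = energy M\<^sub>1 M\<^sub>2 Z"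
      by (intro AE_globalI) (simp add: evolution_global energy_eq e_Phi)
    \<comment> \<open>Both sides are determined by the same outgoing state, so the exceptional set
      is empty for every \<open>t\<close>.\<close>
    have "{Z \<in> simple_nongrazing_boundary \<epsilon>\<^sub>1 \<epsilon>\<^sub>2. evolution t (impact M\<^sub>1 M\<^sub>2 \<epsilon>\<^sub>1 \<epsilon>\<^sub>2 Z) \<noteq> evolution t Z} = {}"
      using outgoing_state_impact by (auto simp: evolution_def)
    then show "hausdorff_AE_on (2 * CARD('d) * (CARD('n1) + CARD('n2)) - 1) (simple_nongrazing_boundary \<epsilon>\<^sub>1 \<epsilon>\<^sub>2)
        (\<lambda>Z. evolution t (impact M\<^sub>1 M\<^sub>2 \<epsilon>\<^sub>1 \<epsilon>\<^sub>2 Z) = evolution t Z)"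
      unfolding hausdorff_AE_on_def by (simp only: hausdorff_measure_empty)
  qed
qed

end
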